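(* Let $\Gamma\subset\partial D$ be a regular piece of the boundary of the scatterer $D$, and suppose that the mean curvature $H$ and Gaussian curvature $K$ of $\Gamma$ satisfy $$H(x)=0\quad\text{and}\quad K(x)=0\quad\text{for } x\in\Gamma .$$ Let $U=(U_j)_{j=1}^3$ be a solution to the elastic scattering system for $D$ and the incident plane wave $U^{in}$ (as described in the context). Then $U$ satisfies the third kind boundary condition on $\Gamma$, $$\nu\cdot U=0\quad\text{and}\quad \nu\wedge TU=0\qquad\text{on }\Gamma,$$ if and only if $$\nu\cdot\big(\nabla(\nabla\cdot U)\big)=0\quad\text{and}\quad \nu\wedge(\nabla\wedge U)=0\qquad\text{on }\Gamma .$$
   Context: Constants: $\lambda,\mu\in\mathbb{R}$ with $\mu>0$ and $3\lambda+2\mu>0$; $\omega>0$; $k_s=\omega/\sqrt{\mu}$, $k_p=\omega/\sqrt{\lambda+2\mu}$. The symbol $\wedge$ denotes the cross product, so $\nabla\wedge$ is the curl. Scatterer: $D\subset\mathbb{R}^3$ is a bounded domain with Lipschitz, piecewise $C^{2,1}$-smooth boundary and connected complement $\mathbb{R}^3\setminus\overline{D}$. $\nu$ is the outward unit normal to $\partial D$. A regular piece $\Gamma$ of $\partial D$ is a $C^{2,1}$-smooth piece of the surface $\partial D$. $H=\frac12(\kappa_1+\kappa_2)$ and $K=\kappa_1\kappa_2$ are the mean and Gaussian curvatures, where $\kappa_1,\kappa_2$ are the principal curvatures. Traction operator: $TU:=2\mu\,\partial_\nu U+\lambda\,\nu\,(\nabla\cdot U)+\mu\,\nu\wedge(\nabla\wedge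 U)$, with $\partial_\nu U:=[\nu\cdot\nabla U_j]_{j=1}^3$. Elastic scattering system: $U$ is complex vector-valued on $\mathbb{R}^3\setminus\overline D$ (locally $H^1$ up to the boundary) with $$(\Delta^*+\omega^2)U=0 \text{ in }\mathbb{R}^3\setminus\overline{D},\qquad \Delta^*U:=\mu\Delta U+(\lambda+\mu)\nabla(\nabla\cdot U),$$ $U=U^{in}+U^{sc}$, where $U^{in}(x)=\alpha_p d\,e^{ik_pd\cdot x}+\alpha_s d^\perp e^{ik_sd\cdot x}$ with $d,d^\perp\in\mathbb{S}^2$, $d\cdot d^\perp=0$, $\alpha_p,\alpha_s\in\mathbb{C}$, and $U^{sc}$ satisfies the Kupradze radiation condition $$(\nabla\wedge\nabla\wedge U^{sc})\wedge\tfrac{x}{\|x\|}-ik_s\nabla\wedge U^{sc}=\mathcal{O}(\|x\|^{-2}),\qquad \tfrac{x}{\|x\|}\cdot\nabla(\nabla\cdot U^{sc})-ik_p\nabla\cdot U^{sc}=\mathcal{O}(\|x\|^{-2})$$ as $\|x\|\to\infty$, uniformly in all directions. Solutions are locally $H^3$ near regular pieces of $\partial D$ (standing regularity), so that the boundary expressions make sense. *)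

theory Defs
  imports "HOL-Analysis.Analysis" "HOL-Library.Landau_Symbols"
begin

section \<open>Partial derivatives, classical smoothness\<close>

definition pd :: "'n::finite \<Rightarrow> (real^'n \<Rightarrow> 'b::real_normed_vector) \<Rightarrow> real^'n \<Rightarrow> 'b" where
  "pd i f x = frechet_derivative f (at x) (axis i 1)"

text \<open>Intended for open \<open>S\<close>: all iterated partial derivatives up to order \<open>k\<close> exist and are continuous.\<close>

primrec Ck_on :: "nat \<Rightarrow> (real^'n::finite) set \<Rightarrow> (real^'n \<Rightarrow> 'b::real_normed_vector) \<Rightarrow> bool" where
  "Ck_on 0 S f \<longleftrightarrow> continuous_on S f"
| "Ck_on (Suc k) S f \<longleftrightarrow> (\<forall>x\<in>S. f differentiable (at x)) \<and> (\<forall>i. Ck_on k S (pd i f))"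

definition smooth_on :: "(real^'n::finite) set \<Rightarrow> (real^'n \<Rightarrow> 'b::real_normed_vector) \<Rightarrow> bool" where
  "smooth_on S f \<longleftrightarrow> (\<forall>k. Ck_on k S f)"

definition C21 :: "(real^2 \<Rightarrow> real) \<Rightarrow> bool" where
  "C21 h \<longleftrightarrow> Ck_on 2 UNIV h \<and> (\<forall>i j. \<exists>L. L-lipschitz_on UNIV (pd i (pd j h)))"


section \<open>Sobolev spaces\<close>

definition L2 :: "'a measure \<Rightarrow> ('a \<Rightarrow> 'b::euclidean_space) \<Rightarrow> bool" where
  "L2 M f \<longleftrightarrow> f \<in> borel_measurable M \<and> integrable M (\<lambda>x. (norm (f x))\<^sup>2)"

definition L2_tendsto :: "'a measure \<Rightarrow> (nat \<Rightarrow> 'a \<Rightarrow> 'b::euclidean_space) \<Rightarrow> ('a \<Rightarrow> 'b) \<Rightarrow> bool" where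
  "L2_tendsto M F f \<longleftrightarrow> (\<forall>n. L2 M (\<lambda>x. F n x - f x)) \<and>
     (\<lambda>n. \<integral>x. (norm (F n x - f x))\<^sup>2 \<partial>M) \<longlonglongrightarrow> 0"

definition test_function :: "(real^3) set \<Rightarrow> (real^3 \<Rightarrow> real) \<Rightarrow> bool" where
  "test_function \<Omega> \<phi> \<longleftrightarrow> smooth_on UNIV \<phi> \<and>
     compact (closure {x. \<phi> x \<noteq> 0}) \<and> closure {x. \<phi> x \<noteq> 0} \<subseteq> \<Omega>"

text \<open>Only used for \<open>f\<close> and \<open>g\<close> that are square integrable on the open set \<open>\<Omega>\<close>, so that both
  integrands are integrable.\<close>

definition weak_pd :: "(real^3) set \<Rightarrow> 3 \<Rightarrow> (real^3 \<Rightarrow> 'b::euclidean_space) \<Rightarrow> (real^3 \<Rightarrow> 'b) \<Rightarrow> bool" where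
  "weak_pd \<Omega> i f g \<longleftrightarrow> (\<forall>\<phi>. test_function \<Omega> \<phi> \<longrightarrow>
     (\<integral>x. pd i \<phi> x *\<^sub>R f x \<partial>lebesgue_on \<Omega>) = - (\<integral>x. \<phi> x *\<^sub>R g x \<partial>lebesgue_on \<Omega>))"

text \<open>\<open>sobolev k \<Omega> f\<close> is \<open>f \<in> H\<^sup>k(\<Omega>)\<close>.\<close>

primrec sobolev :: "nat \<Rightarrow> (real^3) set \<Rightarrow> (real^3 \<Rightarrow> 'b::euclidean_space) \<Rightarrow> bool" where
  "sobolev 0 \<Omega> f \<longleftrightarrow> L2 (lebesgue_on \<Omega>) f"
| "sobolev (Suc k) \<Omega> f \<longleftrightarrow> L2 (lebesgue_on \<Omega>) f \<and>
     (\<forall>i. \<exists>g. weak_pd \<Omega> i f g \<and> sobolev k \<Omega> g)"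

text \<open>Convergence in \<open>H\<^sup>1(\<Omega>)\<close> of functions \<open>F n\<close> that are of class \<open>C\<^sup>1\<close> on the whole space.\<close>

definition H1_tendsto ::
  "(real^3) set \<Rightarrow> (nat \<Rightarrow> real^3 \<Rightarrow> 'b::euclidean_space) \<Rightarrow> (real^3 \<Rightarrow> 'b) \<Rightarrow> bool" where
  "H1_tendsto \<Omega> F f \<longleftrightarrow> L2_tendsto (lebesgue_on \<Omega>) F f \<and>
     (\<forall>i. \<exists>g. weak_pd \<Omega> i f g \<and> L2_tendsto (lebesgue_on \<Omega>) (\<lambda>n. pd i (F n)) g)"


section \<open>Domains with Lipschitz, piecewise smooth boundary\<close>

text \<open>In the Cartesian coordinate system with origin \<open>x\<close> and axes given by the orthogonal map \<open>P\<close>,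
  the set \<open>D\<close> is, near \<open>x\<close>, the region strictly below the graph of \<open>h\<close>.\<close>

definition subgraph_near ::
  "(real^3) set \<Rightarrow> real^3 \<Rightarrow> real \<Rightarrow> (real^3 \<Rightarrow> real^3) \<Rightarrow> (real^2 \<Rightarrow> real) \<Rightarrow> bool" where
  "subgraph_near D x r P h \<longleftrightarrow> 0 < r \<and> orthogonal_transformation P \<and>
     D \<inter> ball x r = {x + P (vector [y$1, y$2, s]) | (y::real^2) s. s < h y} \<inter> ball x r"

definition graph_map :: "real^3 \<Rightarrow> (real^3 \<Rightarrow> real^3) \<Rightarrow> (real^2 \<Rightarrow> real) \<Rightarrow> real^2 \<Rightarrow> real^3" where
  "graph_map x P h y = x + P (vector [y$1, y$2, h y])"

definition lipschitz_boundary :: "(real^3) set \<Rightarrow> bool" where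
  "lipschitz_boundary D \<longleftrightarrow>
     (\<forall>x\<in>frontier D. \<exists>r P h L. subgraph_near D x r P h \<and> L-lipschitz_on UNIV h)"

definition C21_patch ::
  "(real^3) set \<Rightarrow> (real^3) set \<Rightarrow> real^3 \<Rightarrow> real \<Rightarrow> (real^3 \<Rightarrow> real^3) \<Rightarrow> (real^2 \<Rightarrow> real) \<Rightarrow> bool" where
  "C21_patch D \<Gamma> x r P h \<longleftrightarrow> subgraph_near D x r P h \<and> C21 h \<and> frontier D \<inter> ball x r \<subseteq> \<Gamma>"

text \<open>A relatively open part of the boundary along which the boundary is of class \<open>C\<^sup>2\<^sup>,\<^sup>1\<close>.\<close>

definition regular_piece :: "(real^3) set \<Rightarrow> (real^3) set \<Rightarrow> bool" where
  "regular_piece D \<Gamma> \<longleftrightarrow> \<Gamma> \<subseteq> frontier D \<and> (\<forall>x\<in>\<Gamma>. \<exists>r P h. C21_patch D \<Gamma> x r P h)"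

definition piecewise_C21_boundary :: "(real^3) set \<Rightarrow> bool" where
  "piecewise_C21_boundary D \<longleftrightarrow>
     (\<exists>\<G>. finite \<G> \<and> (\<forall>G\<in>\<G>. regular_piece D G \<and> connected G) \<and> frontier D = (\<Union>G\<in>\<G>. closure G))"

definition scatterer :: "(real^3) set \<Rightarrow> bool" where
  "scatterer D \<longleftrightarrow> open D \<and> connected D \<and> D \<noteq> {} \<and> bounded D \<and>
     lipschitz_boundary D \<and> piecewise_C21_boundary D \<and> connected (- closure D)"


section \<open>Normal and curvatures\<close>

text \<open>The unit vector \<open>n\<close> for which, in the limit of small scales, \<open>D\<close> near \<open>x\<close> fills exactly the
  half space \<open>{y. (y - x) \<bullet> n < 0}\<close>; it is unique whenever it exists.\<close>

definition outward_normal :: "(real^3) set \<Rightarrow> real^3 \<Rightarrow> real^3" where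
  "outward_normal D x = (THE n. norm n = 1 \<and>
     (\<forall>\<epsilon>>0. \<exists>\<delta>>0. \<forall>y\<in>ball x \<delta>.
        ((y - x) \<bullet> n < - \<epsilon> * norm (y - x) \<longrightarrow> y \<in> D) \<and>
        ((y - x) \<bullet> n > \<epsilon> * norm (y - x) \<longrightarrow> y \<notin> D)))"

text \<open>Principal curvatures with multiplicity: the eigenvalues of the Weingarten map, i.e. of the
  derivative \<open>S\<close> of the normal along the surface, restricted to the tangent plane. Off the tangent
  plane the derivative within the surface is not unique, and it is not used there.\<close>

definition principal_curvatures :: "(real^3) set \<Rightarrow> real^3 \<Rightarrow> real \<Rightarrow> real \<Rightarrow> bool" where
  "principal_curvatures D x \<kappa>1 \<kappa>2 \<longleftrightarrow>
     (\<exists>S e1 e2. (outward_normal D has_derivative S) (at x within frontier D) \<and>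
        norm e1 = 1 \<and> norm e2 = 1 \<and> e1 \<bullet> e2 = 0 \<and>
        e1 \<bullet> outward_normal D x = 0 \<and> e2 \<bullet> outward_normal D x = 0 \<and>
        S e1 = \<kappa>1 *\<^sub>R e1 \<and> S e2 = \<kappa>2 *\<^sub>R e2)"

definition mean_and_gauss_curvature :: "(real^3) set \<Rightarrow> real^3 \<Rightarrow> real \<Rightarrow> real \<Rightarrow> bool" where
  "mean_and_gauss_curvature D x H K \<longleftrightarrow>
     (\<exists>\<kappa>1 \<kappa>2. principal_curvatures D x \<kappa>1 \<kappa>2 \<and> H = (\<kappa>1 + \<kappa>2) / 2 \<and> K = \<kappa>1 * \<kappa>2)"


section \<open>Boundary traces from the exterior\<close>

text \<open>Surface measure of the part of the graph inside \<open>ball x r\<close>, pulled back to the parameter plane.\<close>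

definition patch_measure ::
  "real^3 \<Rightarrow> real \<Rightarrow> (real^3 \<Rightarrow> real^3) \<Rightarrow> (real^2 \<Rightarrow> real) \<Rightarrow> (real^2) measure" where
  "patch_measure x r P h = density (lebesgue_on {y. graph_map x P h y \<in> ball x r})
     (\<lambda>y. ennreal (sqrt (1 + (\<Sum>i\<in>UNIV. (pd i h y)\<^sup>2))))"

definition ae_on :: "(real^3) set \<Rightarrow> (real^3) set \<Rightarrow> (real^3 \<Rightarrow> bool) \<Rightarrow> bool" where
  "ae_on D \<Gamma> Q \<longleftrightarrow> (\<forall>x\<in>\<Gamma>. \<exists>r P h. C21_patch D \<Gamma> x r P h \<and>
     (AE y in patch_measure x r P h. Q (graph_map x P h y)))"

text \<open>The Sobolev trace, from the exterior of \<open>D\<close>, of \<open>f \<in> H\<^sup>1\<close>, taken locally: the restrictions to \<open>\<Gamma>\<close> of \<open>C\<^sup>1\<close>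
  functions converging to \<open>f\<close> in \<open>H\<^sup>1\<close> converge to \<open>g\<close> in \<open>L\<^sup>2\<close>.\<close>

definition has_trace ::
  "(real^3) set \<Rightarrow> (real^3) set \<Rightarrow> (real^3 \<Rightarrow> 'b::euclidean_space) \<Rightarrow> (real^3 \<Rightarrow> 'b) \<Rightarrow> bool" where
  "has_trace D \<Gamma> f g \<longleftrightarrow> (\<forall>x\<in>\<Gamma>. \<exists>r P h. C21_patch D \<Gamma> x r P h \<and>
     (\<exists>F. (\<forall>n. Ck_on 1 UNIV (F n)) \<and>
          H1_tendsto (ball x r - closure D) F f \<and>
          L2_tendsto (patch_measure x r P h)
            (\<lambda>n y. F n (graph_map x P h y)) (\<lambda>y. g (graph_map x P h y))))"

text \<open>The trace is determined up to a null set of \<open>\<Gamma>\<close>; it is only used inside \<open>ae_on D \<Gamma>\<close>.\<close>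

definition bdry_trace ::
  "(real^3) set \<Rightarrow> (real^3) set \<Rightarrow> (real^3 \<Rightarrow> 'b::euclidean_space) \<Rightarrow> real^3 \<Rightarrow> 'b" where
  "bdry_trace D \<Gamma> f = (SOME g. has_trace D \<Gamma> f g)"


section \<open>Vector calculus for complex fields\<close>

definition cvec :: "real^3 \<Rightarrow> complex^3" where
  "cvec v = (\<chi> i. complex_of_real (v$i))"

text \<open>Bilinear (no complex conjugation), as opposed to the library inner product.\<close>

definition cdot :: "complex^3 \<Rightarrow> complex^3 \<Rightarrow> complex" where
  "cdot a b = (\<Sum>i\<in>UNIV. a$i * b$i)"

definition ccross :: "complex^3 \<Rightarrow> complex^3 \<Rightarrow> complex^3" where
  "ccross a b = vector [a$2 * b$3 - a$3 * b$2, a$3 * b$1 - a$1 * b$3, a$1 * b$2 - a$2 * b$1]"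

definition grad :: "(real^3 \<Rightarrow> complex) \<Rightarrow> real^3 \<Rightarrow> complex^3" where
  "grad f x = (\<chi> i. pd i f x)"

definition divg :: "(real^3 \<Rightarrow> complex^3) \<Rightarrow> real^3 \<Rightarrow> complex" where
  "divg V x = (\<Sum>i\<in>UNIV. pd i V x $ i)"

definition curl :: "(real^3 \<Rightarrow> complex^3) \<Rightarrow> real^3 \<Rightarrow> complex^3" where
  "curl V x = vector [pd 2 V x $ 3 - pd 3 V x $ 2,
                      pd 3 V x $ 1 - pd 1 V x $ 3,
                      pd 1 V x $ 2 - pd 2 V x $ 1]"

definition laplacian :: "(real^3 \<Rightarrow> complex^3) \<Rightarrow> real^3 \<Rightarrow> complex^3" where
  "laplacian V x = (\<Sum>i\<in>UNIV. pd i (pd i V) x)"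


section \<open>Elastic scattering\<close>

definition lame :: "real \<Rightarrow> real \<Rightarrow> (real^3 \<Rightarrow> complex^3) \<Rightarrow> real^3 \<Rightarrow> complex^3" where
  "lame lam \<mu> V x = \<mu> *\<^sub>R laplacian V x + (lam + \<mu>) *\<^sub>R grad (divg V) x"

definition wave_s :: "real \<Rightarrow> real \<Rightarrow> real" where
  "wave_s \<mu> \<omega> = \<omega> / sqrt \<mu>"

definition wave_p :: "real \<Rightarrow> real \<Rightarrow> real \<Rightarrow> real" where
  "wave_p lam \<mu> \<omega> = \<omega> / sqrt (lam + 2 * \<mu>)"

definition incident_wave ::
  "real \<Rightarrow> real \<Rightarrow> real \<Rightarrow> real^3 \<Rightarrow> real^3 \<Rightarrow> complex \<Rightarrow> complex \<Rightarrow> real^3 \<Rightarrow> complex^3" where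
  "incident_wave lam \<mu> \<omega> d d' \<alpha>p \<alpha>s x =
     (\<alpha>p * exp (\<i> * complex_of_real (wave_p lam \<mu> \<omega> * (d \<bullet> x)))) *s cvec d +
     (\<alpha>s * exp (\<i> * complex_of_real (wave_s \<mu> \<omega> * (d \<bullet> x)))) *s cvec d'"

definition kupradze_radiating :: "real \<Rightarrow> real \<Rightarrow> real \<Rightarrow> (real^3 \<Rightarrow> complex^3) \<Rightarrow> bool" where
  "kupradze_radiating lam \<mu> \<omega> V \<longleftrightarrow>
     (\<lambda>x. norm (ccross (curl (curl V) x) (cvec (x /\<^sub>R norm x))
                 - (\<i> * complex_of_real (wave_s \<mu> \<omega>)) *s curl V x))
       \<in> O[at_infinity](\<lambda>x. 1 / (norm x)\<^sup>2) \<and>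
     (\<lambda>x. norm (cdot (cvec (x /\<^sub>R norm x)) (grad (divg V) x)
                 - \<i> * complex_of_real (wave_p lam \<mu> \<omega>) * divg V x))
       \<in> O[at_infinity](\<lambda>x. 1 / (norm x)\<^sup>2)"

text \<open>By interior elliptic regularity, a local \<open>H\<^sup>1\<close> solution of the Navier equation has a smooth
  representative in the open exterior; \<open>U\<close> denotes that representative. Its values on \<open>closure D\<close>
  are irrelevant.\<close>

definition elastic_scattering_solution ::
  "real \<Rightarrow> real \<Rightarrow> real \<Rightarrow> (real^3) set \<Rightarrow> (real^3 \<Rightarrow> complex^3) \<Rightarrow> (real^3 \<Rightarrow> complex^3) \<Rightarrow> bool" where
  "elastic_scattering_solution lam \<mu> \<omega> D Uin U \<longleftrightarrow>
     smooth_on (- closure D) U \<and>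
     (\<forall>R>0. sobolev 1 (ball 0 R - closure D) U) \<and>
     (\<forall>x\<in>- closure D. lame lam \<mu> U x + (\<omega>\<^sup>2) *\<^sub>R U x = 0) \<and>
     kupradze_radiating lam \<mu> \<omega> (\<lambda>x. U x - Uin x)"

definition locally_H3_near :: "(real^3) set \<Rightarrow> (real^3) set \<Rightarrow> (real^3 \<Rightarrow> complex^3) \<Rightarrow> bool" where
  "locally_H3_near D \<Gamma> U \<longleftrightarrow> (\<forall>x\<in>\<Gamma>. \<exists>r>0. sobolev 3 (ball x r - closure D) U)"

text \<open>The boundary values of \<open>T U = 2\<mu> \<partial>\<^sub>\<nu> U + \<lambda> \<nu> (\<nabla> \<cdot> U) + \<mu> \<nu> \<and> (\<nabla> \<and> U)\<close>, where the \<open>j\<close>-th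
  component of \<open>\<partial>\<^sub>\<nu> U\<close> is \<open>\<nu> \<cdot> \<nabla> U\<^sub>j\<close>.\<close>

definition traction ::
  "real \<Rightarrow> real \<Rightarrow> (real^3) set \<Rightarrow> (real^3) set \<Rightarrow> (real^3 \<Rightarrow> complex^3) \<Rightarrow> real^3 \<Rightarrow> complex^3" where
  "traction lam \<mu> D \<Gamma> U x =
     (let \<nu> = outward_normal D x in
        (2 * \<mu>) *\<^sub>R (\<Sum>i\<in>UNIV. (\<nu>$i) *\<^sub>R bdry_trace D \<Gamma> (pd i U) x) +
        lam *\<^sub>R (bdry_trace D \<Gamma> (divg U) x *s cvec \<nu>) +
        \<mu> *\<^sub>R ccross (cvec \<nu>) (bdry_trace D \<Gamma> (curl U) x))"

definition third_kind_condition ::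
  "real \<Rightarrow> real \<Rightarrow> (real^3) set \<Rightarrow> (real^3) set \<Rightarrow> (real^3 \<Rightarrow> complex^3) \<Rightarrow> bool" where
  "third_kind_condition lam \<mu> D \<Gamma> U \<longleftrightarrow>
     ae_on D \<Gamma> (\<lambda>x. cdot (cvec (outward_normal D x)) (bdry_trace D \<Gamma> U x) = 0) \<and>
     ae_on D \<Gamma> (\<lambda>x. ccross (cvec (outward_normal D x)) (traction lam \<mu> D \<Gamma> U x) = 0)"

end

(* Since both principal curvatures vanish, the unit normal is locally constant, so near each of its
   points the piece is a flat disc with the exterior on one side. There, let n be the normal. U is
   smooth in the open exterior and square integrable up to third derivatives, so along almost every
   normal line the fields U, dU, curl U, grad div U have limits at the disc, and these limits are the
   Sobolev traces. If such a limit vanishes on the disc, then so do the limits of its tangential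
   derivatives (integrate by parts on parallel discs). Hence:
   - if n . U = 0, the normal part of the gradient of U is a multiple of n, and then n x TU and
     n x curl U both vanish exactly when n x d_n U does;
   - if n x curl U = 0, then n . curl curl U = - div (n x curl U) = 0, and the Navier equation becomes
     (lambda + 2 mu) n . grad div U + omega^2 n . U = 0, so n . U = 0 iff n . grad div U = 0. *)

theory Submission
  imports Defs "HOL-Computational_Algebra.Polynomial"
begin

section \<open>Calculus of partial derivatives\<close>

text \<open>\<open>bdry_trace\<close> is a \<open>SOME\<close> choice, made separately for each
  field, and \<open>has_trace\<close> and \<open>ae_on\<close> bring their own charts and
  approximating sequences. The pointwise identities between U, its derivatives, curl U and grad div
  U, on which the argument rests, are therefore not immediate for the chosen traces. Limits along
  normal lines supply them: they are tied to the fields themselves, so every identity valid in the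
  exterior passes to the limit almost everywhere. Identifying them with the traces takes three
  things. A trace must exist, or the \<open>SOME\<close> says nothing; translating the exterior
  field along the constant normal and extending it produces the approximants. It must be unique,
  which is the trace inequality applied to differences. And null sets must survive the change from
  an arbitrary chart to the flat one. A second gap lies between \<open>sobolev\<close>, which speaks
  of weak derivatives, and the classical derivatives in the operators; U being smooth off the
  closure of D, the fundamental lemma of the calculus of variations closes it. Third order
  regularity is what gives grad div U a trace.\<close>

lemma has_derivative_pd:
  fixes f :: "real^'n::finite \<Rightarrow> 'b::real_normed_vector"
  assumes "f differentiable (at x)"
  shows "(f has_derivative (\<lambda>v. \<Sum>i\<in>UNIV. v$i *\<^sub>R pd i f x)) (at x)"
proof -
  let ?f' = "frechet_derivative f (at x)"
  have d: "(f has_derivative ?f') (at x)" using assms by (simp add: frechet_derivative_works)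
  then have l: "linear ?f'" by (rule has_derivative_linear)
  have "?f' v = (\<Sum>i\<in>UNIV. v$i *\<^sub>R pd i f x)" for v
  proof -
    have "?f' v = ?f' (\<Sum>i\<in>UNIV. v$i *\<^sub>R axis i 1)"
      using basis_expansion[of v] by (simp add: scalar_mult_eq_scaleR)
    also have "\<dots> = (\<Sum>i\<in>UNIV. v$i *\<^sub>R pd i f x)"
      by (simp add: linear_sum[OF l] linear_cmul[OF l] pd_def)
    finally show ?thesis .
  qed
  then have "?f' = (\<lambda>v. \<Sum>i\<in>UNIV. v$i *\<^sub>R pd i f x)" by blast
  with d show ?thesis by simp
qed

lemma pd_eqI:
  assumes "(f has_derivative f') (at x)"
  shows "pd i f x = f' (axis i 1)"
  unfolding pd_def frechet_derivative_at[OF assms, symmetric] ..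

text \<open>The two functions have the same Frechet derivatives at \<open>x\<close>, so the choice
  made inside \<open>frechet_derivative\<close> is the same for both, even where there is none to
  choose from.\<close>

lemma pd_transform:
  assumes "open S" "x \<in> S" "\<And>x. x \<in> S \<Longrightarrow> f x = g x"
  shows "pd i f x = pd i g x"
proof -
  have "(f has_derivative D) (at x) \<longleftrightarrow> (g has_derivative D) (at x)" for D
    using has_derivative_transform_within_open[OF _ assms(1,2), of f D UNIV g]
      has_derivative_transform_within_open[OF _ assms(1,2), of g D UNIV f] assms(3) by auto
  then show ?thesis by (simp add: pd_def frechet_derivative_def)
qed

lemma differentiable_transform_open:
  assumes "f differentiable (at x)" "open S" "x \<in> S" "\<And>x. x \<in> S \<Longrightarrow> f x = g x"
  shows "g differentiable (at x)"
  using has_derivative_transform_within_open[OF _ assms(2,3), of f _ UNIV g] assms(1,4)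
  unfolding differentiable_def by auto

section \<open>Closure properties of the classes \<open>Ck_on\<close>\<close>

lemma Ck_on_cong:
  assumes "open S" "\<And>x. x \<in> S \<Longrightarrow> f x = g x" "Ck_on k S f"
  shows "Ck_on k S g"
  using assms(2,3)
proof (induction k arbitrary: f g)
  case 0
  then show ?case by (auto cong: continuous_on_cong)
next
  case (Suc k)
  have "g differentiable (at x)" if "x \<in> S" for x
    using Suc.prems that differentiable_transform_open[OF _ assms(1) that, of f g] by auto
  moreover have "Ck_on k S (pd i g)" for i
  proof (rule Suc.IH)
    show "pd i f x = pd i g x" if "x \<in> S" for x
      by (rule pd_transform[OF assms(1) that Suc.prems(1)])
  qed (use Suc.prems(2) in simp)
  ultimately show ?case by simp
qed

lemma Ck_on_subset: "Ck_on k S f \<Longrightarrow> T \<subseteq> S \<Longrightarrow> Ck_on k T f"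
  by (induction k arbitrary: f) (auto intro: continuous_on_subset)

lemma Ck_on_lower: "Ck_on (Suc k) S f \<Longrightarrow> Ck_on k S f"
proof (induction k arbitrary: f)
  case 0
  then show ?case
    by (auto intro!: continuous_at_imp_continuous_on differentiable_imp_continuous_within)
next
  case (Suc k)
  then show ?case by (metis Ck_on.simps(2))
qed

lemma Ck_on_le: "Ck_on k S f \<Longrightarrow> j \<le> k \<Longrightarrow> Ck_on j S f"
  by (induction k) (auto simp del: Ck_on.simps dest: Ck_on_lower simp: le_Suc_eq)

lemma Ck_on_continuous: "Ck_on k S f \<Longrightarrow> continuous_on S f"
  using Ck_on_le[of k S f 0] by simp

lemma pd_const [simp]: "pd i (\<lambda>x. c) = (\<lambda>x. 0)"
  by (intro ext pd_eqI[where f'="\<lambda>_. 0", simplified]) (rule has_derivative_const)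

lemma Ck_on_const: "Ck_on k S (\<lambda>x. c)"
  by (induction k arbitrary: c) auto

lemma pd_add:
  assumes "f differentiable (at x)" "g differentiable (at x)"
  shows "pd i (\<lambda>x. f x + g x) x = pd i f x + pd i g x"
  using pd_eqI[OF has_derivative_add[OF assms[unfolded frechet_derivative_works]]]
  by (simp add: pd_def)

lemma pd_bounded_linear:
  assumes "f differentiable (at x)" "bounded_linear h"
  shows "pd i (\<lambda>x. h (f x)) x = h (pd i f x)"
  using pd_eqI[OF bounded_linear.has_derivative[OF assms(2) assms(1)[unfolded frechet_derivative_works]]]
  by (simp add: pd_def)

lemma pd_scaleR:
  fixes f :: "real^'n::finite \<Rightarrow> 'b::real_normed_vector"
  assumes "u differentiable (at x)" "f differentiable (at x)"
  shows "pd i (\<lambda>x. u x *\<^sub>R f x) x = u x *\<^sub>R pd i f x + pd i u x *\<^sub>R f x"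
  using pd_eqI[OF has_derivative_scaleR[OF assms[unfolded frechet_derivative_works]]]
  by (simp add: pd_def)

text \<open>The formula for \<open>pd\<close> of a sum is available only at points of
  \<open>S\<close>, so the induction hypothesis is applied to the sum of the derivatives and carried
  over by \<open>Ck_on_cong\<close>. The same detour recurs for linear images, products and affine
  substitutions.\<close>

lemma Ck_on_add:
  assumes "open S" "Ck_on k S f" "Ck_on k S g"
  shows "Ck_on k S (\<lambda>x. f x + g x)"
  using assms(2,3)
proof (induction k arbitrary: f g)
  case 0
  then show ?case by (auto intro: continuous_intros)
next
  case (Suc k)
  have "Ck_on k S (pd i (\<lambda>x. f x + g x))" for i
    by (rule Ck_on_cong[OF assms(1) _ Suc.IH[of "pd i f" "pd i g"]])
       (use Suc.prems in \<open>auto simp: pd_add\<close>)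
  with Suc.prems show ?case by auto
qed

lemma Ck_on_bounded_linear:
  assumes "open S" "bounded_linear h" "Ck_on k S f"
  shows "Ck_on k S (\<lambda>x. h (f x))"
  using assms(3)
proof (induction k arbitrary: f)
  case 0
  then show ?case using bounded_linear.continuous_on[OF assms(2)] by auto
next
  case (Suc k)
  have "Ck_on k S (pd i (\<lambda>x. h (f x)))" for i
    by (rule Ck_on_cong[OF assms(1) _ Suc.IH[of "pd i f"]])
       (use Suc.prems assms(2) in \<open>auto simp: pd_bounded_linear\<close>)
  moreover have "(\<lambda>x. h (f x)) differentiable (at x)" if "x \<in> S" for x
    using Suc.prems that unfolding differentiable_def Ck_on.simps
    by (blast intro: bounded_linear.has_derivative[OF assms(2)])
  ultimately show ?case by simp
qed

lemma Ck_on_scaleR: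
  fixes f :: "real^'n::finite \<Rightarrow> 'b::real_normed_vector"
  assumes "open S" "Ck_on k S u" "Ck_on k S f"
  shows "Ck_on k S (\<lambda>x. u x *\<^sub>R f x)"
  using assms(2,3)
proof (induction k arbitrary: f u)
  case 0
  then show ?case by (auto intro: continuous_intros)
next
  case (Suc k)
  have "Ck_on k S (pd i (\<lambda>x. u x *\<^sub>R f x))" for i
  proof (rule Ck_on_cong[OF assms(1)])
    \<comment> \<open>The product rule keeps one factor undifferentiated; it has order
      \<open>Suc k\<close> and must be lowered to \<open>k\<close> for the induction
      hypothesis.\<close>
    show "Ck_on k S (\<lambda>x. u x *\<^sub>R pd i f x + pd i u x *\<^sub>R f x)"
      using Suc.prems Suc.prems[THEN Ck_on_lower] by (intro Ck_on_add assms(1) Suc.IH) auto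
    show "u x *\<^sub>R pd i f x + pd i u x *\<^sub>R f x = pd i (\<lambda>x. u x *\<^sub>R f x) x" if "x \<in> S" for x
      using Suc.prems that pd_scaleR[of u x f i] by simp
  qed
  with Suc.prems show ?case by (auto intro: differentiable_scaleR)
qed

lemma Ck_on_diff2:
  fixes f :: "real^'n::finite \<Rightarrow> 'b::real_normed_vector"
  assumes "open S" "Ck_on k S f" "Ck_on k S g"
  shows "Ck_on k S (\<lambda>x. f x - g x)"
  using Ck_on_add[OF assms(1,2) Ck_on_bounded_linear[OF assms(1) bounded_linear_minus[OF bounded_linear_ident] assms(3)]]
  by simp

lemma Ck_on_sum:
  assumes "open S" "finite I" "\<And>i. i \<in> I \<Longrightarrow> Ck_on k S (f i)"
  shows "Ck_on k S (\<lambda>x. \<Sum>i\<in>I. f i x)"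
  using assms(2,3)
  by (induction I) (auto intro: Ck_on_add[OF assms(1)] Ck_on_const)

lemma Ck_on_prod:
  fixes f :: "'i \<Rightarrow> real^'n::finite \<Rightarrow> real"
  assumes "open S" "finite I" "\<And>i. i \<in> I \<Longrightarrow> Ck_on k S (f i)"
  shows "Ck_on k S (\<lambda>x. \<Prod>i\<in>I. f i x)"
  using assms(2,3)
  by (induction I) (auto intro: Ck_on_scaleR[OF assms(1), where 'b=real, simplified] Ck_on_const)

lemma has_derivative_affine_comp:
  fixes f :: "real^'m::finite \<Rightarrow> 'b::real_normed_vector" and L :: "real^'n::finite \<Rightarrow> real^'m"
  assumes "linear L" "f differentiable (at (c + L x))"
  shows "((\<lambda>x. f (c + L x)) has_derivative (\<lambda>v. \<Sum>j\<in>UNIV. L v $ j *\<^sub>R pd j f (c + L x))) (at x)"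
proof -
  have "((\<lambda>x. c + L x) has_derivative L) (at x)"
    using has_derivative_add[OF has_derivative_const bounded_linear_imp_has_derivative[OF linear_conv_bounded_linear[THEN iffD1, OF assms(1)]]]
    by simp
  from has_derivative_compose[OF this has_derivative_pd[OF assms(2)]] show ?thesis .
qed

text \<open>Two substitutions are needed later: translations, with \<open>L\<close> the identity,
  and the parametrisation of a plane, where \<open>L\<close> maps the parameter plane into
  space.\<close>

lemma Ck_on_affine:
  fixes f :: "real^'m::finite \<Rightarrow> 'b::real_normed_vector" and L :: "real^'n::finite \<Rightarrow> real^'m"
  assumes "open S" "linear L" "Ck_on k S f"
  shows "Ck_on k {x. c + L x \<in> S} (\<lambda>x. f (c + L x))"
  using assms(3)
proof (induction k arbitrary: f)
  case 0
  have "continuous_on UNIV (\<lambda>x. c + L x)"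
    by (intro continuous_intros linear_continuous_on linear_conv_bounded_linear[THEN iffD1, OF assms(2)])
  then show ?case using 0 
    by (auto intro!: continuous_on_compose2[of S f] elim: continuous_on_subset)
next
  case (Suc k)
  have cont: "continuous_on UNIV (\<lambda>x. c + L x)"
    by (intro continuous_intros linear_continuous_on linear_conv_bounded_linear[THEN iffD1, OF assms(2)])
  have op: "open {x. c + L x \<in> S}"
    using open_vimage[OF assms(1) cont] by (simp add: vimage_def)
  have d: "((\<lambda>x. f (c + L x)) has_derivative (\<lambda>v. \<Sum>j\<in>UNIV. L v $ j *\<^sub>R pd j f (c + L x))) (at x)"
    if "c + L x \<in> S" for x
    using Suc.prems that by (intro has_derivative_affine_comp[OF assms(2)]) auto
  have "Ck_on k {x. c + L x \<in> S} (pd i (\<lambda>x. f (c + L x)))" for i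
  proof (rule Ck_on_cong[OF op])
    show "Ck_on k {x. c + L x \<in> S} (\<lambda>x. \<Sum>j\<in>UNIV. L (axis i 1) $ j *\<^sub>R pd j f (c + L x))"
      using Suc.prems
      by (intro Ck_on_sum op Ck_on_bounded_linear[OF op bounded_linear_scaleR_right] Suc.IH) auto
  qed (use d pd_eqI in force)
  then show ?case using d by (auto simp: differentiable_def)
qed

section \<open>Derivatives along lines and the symmetry of second derivatives\<close>

lemma has_vector_derivative_line:
  fixes f :: "real^'n::finite \<Rightarrow> 'b::real_normed_vector"
  assumes "f differentiable (at (x + t *\<^sub>R v))"
  shows "((\<lambda>t. f (x + t *\<^sub>R v)) has_vector_derivative (\<Sum>i\<in>UNIV. v$i *\<^sub>R pd i f (x + t *\<^sub>R v))) (at t)"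
proof -
  have "((\<lambda>t. x + t *\<^sub>R v) has_derivative (\<lambda>t. t *\<^sub>R v)) (at t)"
    by (auto intro!: derivative_eq_intros)
  from has_derivative_compose[OF this has_derivative_pd[OF assms]] show ?thesis
    by (simp add: has_vector_derivative_def scaleR_sum_right)
qed

text \<open>Both iterated derivatives are limits of the same second difference quotient.\<close>

lemma pd_commute:
  fixes f :: "real^'n::finite \<Rightarrow> 'b::euclidean_space"
  assumes "open S" "Ck_on 2 S f" "x \<in> S"
  shows "pd i (pd j f) x = pd j (pd i f) x"
proof -
  \<comment> \<open>The mean value theorem is used twice, first in direction \<open>i\<close>, then
    in direction \<open>j\<close>. It holds for real functions only, hence the inner product with a
    fixed vector \<open>b\<close>; the intermediate points depend on \<open>b\<close>.\<close>
  have main: "\<exists>p. (\<lambda>k. p k) \<longlonglongrightarrow> x \<and> (\<forall>\<^sub>F k in sequentially. 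
      (let s = inverse (real (Suc k)) in
        (f (x + s *\<^sub>R axis i 1 + s *\<^sub>R axis j 1) - f (x + s *\<^sub>R axis i 1) - f (x + s *\<^sub>R axis j 1) + f x) \<bullet> b
         = s * s * (pd j (pd i f) (p k) \<bullet> b)))" for i j and b :: 'b
  proof -
    obtain e where e: "e > 0" "ball x e \<subseteq> S" using assms open_contains_ball by blast
    let ?P = "\<lambda>s q. dist q x \<le> 2 * s \<and>
        (f (x + s *\<^sub>R axis i 1 + s *\<^sub>R axis j 1) - f (x + s *\<^sub>R axis i 1) - f (x + s *\<^sub>R axis j 1) + f x) \<bullet> b
         = s * s * (pd j (pd i f) q \<bullet> b)"
    have ex: "\<exists>q. ?P s q" if s: "s > 0" "2 * s < e" for s
    proof -
      have inS: "x + t *\<^sub>R axis i 1 + u *\<^sub>R axis j 1 \<in> S" "norm (t *\<^sub>R axis i 1 + u *\<^sub>R axis j (1::real)) \<le> 2 * s"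
        if "0 \<le> t" "t \<le> s" "0 \<le> u" "u \<le> s" for t u
      proof -
        have "norm (t *\<^sub>R axis i 1 + u *\<^sub>R axis j (1::real)) \<le> \<bar>t\<bar> + \<bar>u\<bar>"
          by (rule order_trans[OF norm_triangle_ineq]) (simp add: norm_axis_1)
        then show n: "norm (t *\<^sub>R axis i 1 + u *\<^sub>R axis j (1::real)) \<le> 2 * s" using that by simp
        have "dist x (x + t *\<^sub>R axis i 1 + u *\<^sub>R axis j 1) = norm (t *\<^sub>R axis i 1 + u *\<^sub>R axis j (1::real))"
          by (metis dist_norm norm_minus_commute add_diff_cancel_left' add.assoc)
        with n s e(2) show "x + t *\<^sub>R axis i 1 + u *\<^sub>R axis j 1 \<in> S" by auto
      qed
      have df: "f differentiable (at z)" "pd i f differentiable (at z)" if "z \<in> S" for z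
        using assms(2) that by (auto simp: numeral_2_eq_2)
      define G where "G t = (f (x + s *\<^sub>R axis j 1 + t *\<^sub>R axis i 1) - f (x + t *\<^sub>R axis i 1)) \<bullet> b" for t
      define G' where "G' t = (pd i f (x + s *\<^sub>R axis j 1 + t *\<^sub>R axis i 1) - pd i f (x + t *\<^sub>R axis i 1)) \<bullet> b" for t
      have vd: "((\<lambda>t. f (z + t *\<^sub>R axis l 1)) has_vector_derivative pd l f (z + t *\<^sub>R axis l 1)) (at t)"
        if "f differentiable (at (z + t *\<^sub>R axis l 1))" for f :: "real^'n \<Rightarrow> 'b" and z t l
        using has_vector_derivative_line[OF that] by (simp add: axis_def if_distrib if_distribR cong: if_cong)
      have Gd: "(G has_real_derivative G' t) (at t)" if "0 \<le> t" "t \<le> s" for t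
      proof -
        have "f differentiable (at (x + s *\<^sub>R axis j 1 + t *\<^sub>R axis i 1))"
          using inS(1)[of t s] that s df(1) by (simp add: algebra_simps)
        moreover have "f differentiable (at (x + t *\<^sub>R axis i 1))"
          using inS(1)[of t 0] that s df(1) by (simp add: algebra_simps)
        ultimately have "((\<lambda>t. f (x + s *\<^sub>R axis j 1 + t *\<^sub>R axis i 1) - f (x + t *\<^sub>R axis i 1)) has_vector_derivative
             (pd i f (x + s *\<^sub>R axis j 1 + t *\<^sub>R axis i 1) - pd i f (x + t *\<^sub>R axis i 1))) (at t)"
          by (intro has_vector_derivative_diff vd)
        from bounded_linear.has_vector_derivative[OF bounded_linear_inner_left this]
        show ?thesis unfolding G_def G'_def has_real_derivative_iff_has_vector_derivative .
      qed
      obtain t where t: "0 < t" "t < s" "G s - G 0 = s * G' t"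
        using MVT2[of 0 s G G'] s Gd by auto
      define K where "K u = pd i f (x + t *\<^sub>R axis i 1 + u *\<^sub>R axis j 1) \<bullet> b" for u
      have Kd: "(K has_real_derivative pd j (pd i f) (x + t *\<^sub>R axis i 1 + u *\<^sub>R axis j 1) \<bullet> b) (at u)" if "0 \<le> u" "u \<le> s" for u
      proof -
        have "pd i f differentiable (at (x + t *\<^sub>R axis i 1 + u *\<^sub>R axis j 1))"
          using inS(1)[of t u] that t df(2) by simp
        from bounded_linear.has_vector_derivative[OF bounded_linear_inner_left vd[OF this]]
        show ?thesis unfolding K_def has_real_derivative_iff_has_vector_derivative .
      qed
      obtain u where u: "0 < u" "u < s" "K s - K 0 = s * (pd j (pd i f) (x + t *\<^sub>R axis i 1 + u *\<^sub>R axis j 1) \<bullet> b)"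
        using MVT2[of 0 s K "\<lambda>u. pd j (pd i f) (x + t *\<^sub>R axis i 1 + u *\<^sub>R axis j 1) \<bullet> b"] s Kd by auto
      have "G' t = K s - K 0" unfolding G'_def K_def by (simp add: algebra_simps)
      then have "G s - G 0 = s * s * (pd j (pd i f) (x + t *\<^sub>R axis i 1 + u *\<^sub>R axis j 1) \<bullet> b)"
        using t u by simp
      moreover have "dist (x + t *\<^sub>R axis i 1 + u *\<^sub>R axis j 1) x \<le> 2 * s"
        using inS(2)[of t u] t u by (simp add: dist_norm algebra_simps)
      ultimately show ?thesis unfolding G_def
        by (intro exI[of _ "x + t *\<^sub>R axis i 1 + u *\<^sub>R axis j 1"]) (simp add: algebra_simps)
    qed
    define p where "p k = (SOME q. ?P (inverse (real (Suc k))) q)" for k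
    have lim0: "(\<lambda>k. inverse (real (Suc k))) \<longlonglongrightarrow> 0" by (rule LIMSEQ_inverse_real_of_nat)
    have ev: "\<forall>\<^sub>F k in sequentially. 2 * inverse (real (Suc k)) < e"
      using order_tendstoD(2)[OF tendsto_mult[OF tendsto_const lim0, of 2], of e] e by simp
    have P: "\<forall>\<^sub>F k in sequentially. ?P (inverse (real (Suc k))) (p k)"
      using ev
    proof eventually_elim
      case (elim k)
      then show ?case unfolding p_def using someI_ex[OF ex[of "inverse (real (Suc k))"]] by simp
    qed
    have "p \<longlonglongrightarrow> x"
    proof (rule metric_tendsto_imp_tendsto)
      show "(\<lambda>k. 2 * inverse (real (Suc k))) \<longlonglongrightarrow> 0"
        using tendsto_mult[OF tendsto_const[of 2] lim0] by (simp only: mult_zero_right)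
      show "\<forall>\<^sub>F k in sequentially. dist (p k) x \<le> dist (2 * inverse (real (Suc k))) 0"
        using P by eventually_elim simp
    qed
    then show ?thesis
      by (intro exI[of _ p]) (use P in \<open>auto simp: Let_def elim: eventually_mono\<close>)
  qed
  \<comment> \<open>The second difference is symmetric in \<open>i\<close> and \<open>j\<close>. The
    two orders only give different intermediate points, all tending to \<open>x\<close>, where the
    second derivatives are continuous.\<close>
  have "pd i (pd j f) x \<bullet> b = pd j (pd i f) x \<bullet> b" for b
  proof -
    obtain p where p: "p \<longlonglongrightarrow> x" "\<forall>\<^sub>F k in sequentially. 
      (let s = inverse (real (Suc k)) in
        (f (x + s *\<^sub>R axis i 1 + s *\<^sub>R axis j 1) - f (x + s *\<^sub>R axis i 1) - f (x + s *\<^sub>R axis j 1) + f x) \<bullet> b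
         = s * s * (pd j (pd i f) (p k) \<bullet> b))" using main[of i j b] by blast
    obtain q where q: "q \<longlonglongrightarrow> x" "\<forall>\<^sub>F k in sequentially. 
      (let s = inverse (real (Suc k)) in
        (f (x + s *\<^sub>R axis j 1 + s *\<^sub>R axis i 1) - f (x + s *\<^sub>R axis j 1) - f (x + s *\<^sub>R axis i 1) + f x) \<bullet> b
         = s * s * (pd i (pd j f) (q k) \<bullet> b))" using main[of j i b] by blast
    have c: "isCont (pd l (pd m f)) x" for l m
      using assms(2,3) continuous_on_eq_continuous_at[OF assms(1), of "pd l (pd m f)"]
      by (simp add: numeral_2_eq_2)
    have A: "(\<lambda>k. pd j (pd i f) (p k) \<bullet> b) \<longlonglongrightarrow> pd j (pd i f) x \<bullet> b"
      by (intro tendsto_intros isCont_tendsto_compose[OF c p(1)])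
    have B: "(\<lambda>k. pd i (pd j f) (q k) \<bullet> b) \<longlonglongrightarrow> pd i (pd j f) x \<bullet> b"
      by (intro tendsto_intros isCont_tendsto_compose[OF c q(1)])
    have C: "\<forall>\<^sub>F k in sequentially. pd j (pd i f) (p k) \<bullet> b = pd i (pd j f) (q k) \<bullet> b"
      using p(2) q(2)
    proof eventually_elim
      case (elim k)
      then have "inverse (real (Suc k)) * inverse (real (Suc k)) * (pd j (pd i f) (p k) \<bullet> b)
        = inverse (real (Suc k)) * inverse (real (Suc k)) * (pd i (pd j f) (q k) \<bullet> b)"
        unfolding Let_def by (metis (no_types, lifting) add.assoc add.commute diff_diff_eq)
      then show ?case by simp
    qed
    show ?thesis
      by (rule LIMSEQ_unique[OF B Lim_transform_eventually[OF A C]])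
  qed
  then show ?thesis by (metis vector_eq_rdot)
qed


section \<open>Smooth bump functions and extension\<close>

text \<open>The polynomial is a parameter so that the family contains all its derivatives;
  \<open>flat_exp 1\<close> is the usual flat function exp (-1/t).\<close>

definition flat_exp :: "real poly \<Rightarrow> real \<Rightarrow> real" where
  "flat_exp p t = (if t > 0 then poly p (1 / t) * exp (- (1 / t)) else 0)"

text \<open>With u = 1/t, the derivative of p(u) exp(-u) in t is u^2 (p(u) - p'(u)) exp(-u), because
  du/dt = -u^2.\<close>

definition flat_exp_next :: "real poly \<Rightarrow> real poly" where
  "flat_exp_next p = [:0, 0, 1:] * (p - pderiv p)"

lemma poly_times_exp_minus_tendsto_0: "((\<lambda>u::real. poly p u * exp (- u)) \<longlongrightarrow> 0) at_top"
proof -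
  have "((\<lambda>u::real. \<Sum>i\<le>degree p. coeff p i * (u ^ i / exp u)) \<longlongrightarrow> (\<Sum>i\<le>degree p. coeff p i * 0)) at_top"
    by (intro tendsto_intros tendsto_power_div_exp_0)
  moreover have "(\<lambda>u::real. \<Sum>i\<le>degree p. coeff p i * (u ^ i / exp u)) = (\<lambda>u. poly p u * exp (- u))"
    by (simp add: poly_altdef exp_minus divide_inverse sum_distrib_right mult.assoc)
  ultimately show ?thesis by simp
qed

lemma flat_exp_has_derivative:
  "(flat_exp p has_real_derivative flat_exp (flat_exp_next p) t) (at t)"
proof -
  consider "t < 0" | "t > 0" | "t = 0" by linarith
  then show ?thesis
  proof cases
    case 1
    have "((\<lambda>t. 0) has_real_derivative 0) (at t)" by simp
    then have "(flat_exp p has_real_derivative 0) (at t)"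
      by (rule has_field_derivative_transform_within_open[where S="{..<0}"]) (use 1 in \<open>auto simp: flat_exp_def\<close>)
    then show ?thesis using 1 by (simp add: flat_exp_def)
  next
    case 2
    have "((\<lambda>t. poly p (1 / t) * exp (- (1 / t))) has_real_derivative
       (poly (pderiv p) (1/t) * (- (1 / t\<^sup>2))) * exp (- (1/t)) + exp (- (1/t)) * (1 / t\<^sup>2) * poly p (1/t)) (at t)"
      using 2 by (auto intro!: derivative_eq_intros DERIV_chain2[OF poly_DERIV] simp: power2_eq_square field_simps)
    moreover have "(poly (pderiv p) (1/t) * (- (1 / t\<^sup>2))) * exp (- (1/t)) + exp (- (1/t)) * (1 / t\<^sup>2) * poly p (1/t)
      = flat_exp (flat_exp_next p) t"
      using 2 by (simp add: flat_exp_def flat_exp_next_def power2_eq_square field_simps)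
    ultimately have "((\<lambda>t. poly p (1 / t) * exp (- (1 / t))) has_real_derivative flat_exp (flat_exp_next p) t) (at t)"
      by simp
    then show ?thesis
      by (rule has_field_derivative_transform_within_open[where S="{0<..}"]) (use 2 in \<open>auto simp: flat_exp_def\<close>)
  next
    case 3
    have r: "((\<lambda>h. flat_exp p h / h) \<longlongrightarrow> 0) (at_right 0)"
    proof (rule Lim_transform_eventually)
      \<comment> \<open>Dividing by h multiplies the polynomial by its variable 1/h, which is
        \<open>pCons 0 p\<close>.\<close>
      show "((\<lambda>h. poly (pCons 0 p) (inverse h) * exp (- inverse h)) \<longlongrightarrow> 0) (at_right (0::real))"
        by (rule filterlim_compose[OF poly_times_exp_minus_tendsto_0 filterlim_inverse_at_top_right])
      show "\<forall>\<^sub>F h in at_right 0. poly (pCons 0 p) (inverse h) * exp (- inverse h) = flat_exp p h / h"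
        unfolding eventually_at_right_field by (intro exI[of _ 1]) (auto simp: flat_exp_def field_simps)
    qed
    have l: "((\<lambda>h. flat_exp p h / h) \<longlongrightarrow> 0) (at_left 0)"
      by (rule Lim_transform_eventually[OF tendsto_const])
         (auto simp: eventually_at_left_field flat_exp_def intro!: exI[of _ "-1"])
    have "((\<lambda>h. flat_exp p h / h) \<longlongrightarrow> 0) (at 0)"
      using l r by (simp add: filterlim_split_at)
    then show ?thesis using 3 by (simp add: DERIV_def flat_exp_def)
  qed
qed

lemma continuous_on_flat_exp: "continuous_on S (flat_exp p)"
  by (meson DERIV_continuous continuous_at_imp_continuous_on flat_exp_has_derivative)

text \<open>A partial derivative replaces \<open>p\<close> by \<open>flat_exp_next p\<close> and
  multiplies by a constant, so the induction on the order must leave \<open>p\<close> free.\<close>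

lemma smooth_flat_exp_linear:
  fixes l :: "real^'n::finite \<Rightarrow> real"
  assumes "linear l"
  shows "Ck_on k UNIV (\<lambda>z. flat_exp p (c + l z))"
proof (induction k arbitrary: p)
  case 0
  have "continuous_on UNIV (\<lambda>z. c + l z)"
    by (intro continuous_intros linear_continuous_on linear_conv_bounded_linear[THEN iffD1, OF assms])
  then show ?case using continuous_on_compose2[OF continuous_on_flat_exp[of UNIV p]] by simp
next
  case (Suc k)
  have "((\<lambda>z. c + l z) has_derivative l) (at z)" for z
    using has_derivative_add[OF has_derivative_const bounded_linear_imp_has_derivative[OF linear_conv_bounded_linear[THEN iffD1, OF assms]]]
    by simp
  then have d: "((\<lambda>z. flat_exp p (c + l z)) has_derivative (\<lambda>v. flat_exp (flat_exp_next p) (c + l z) * l v)) (at z)" for z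
    using has_derivative_compose[of "\<lambda>z. c + l z" l z UNIV, OF _ flat_exp_has_derivative[unfolded has_field_derivative_def]]
    by (simp add: mult.commute)
  have "pd i (\<lambda>z. flat_exp p (c + l z)) = (\<lambda>z. flat_exp (flat_exp_next p) (c + l z) * l (axis i 1))" for i
    using pd_eqI[OF d] by blast
  then show ?case
    using Suc.IH[of "flat_exp_next p"] d
    by (auto simp: differentiable_def intro!: Ck_on_bounded_linear[OF open_UNIV bounded_linear_mult_left])
qed

lemma flat_exp_1: "flat_exp 1 t = (if t > 0 then exp (- (1 / t)) else 0)"
  by (simp add: flat_exp_def)

lemma flat_exp_1_bounds: "0 \<le> flat_exp 1 t" "flat_exp 1 t \<le> 1" "flat_exp 1 t > 0 \<longleftrightarrow> t > 0"
  "flat_exp 1 t = 0 \<longleftrightarrow> t \<le> 0"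
  by (auto simp: flat_exp_1)

text \<open>\<open>Suc m\<close> steepens the edges: for t > 0 the factor exp (-1 / (Suc m * t))
  increases to 1 with m. The bumps thus approximate the indicator of the open box from below, while
  their supports stay in its closure.\<close>

definition box_bump :: "nat \<Rightarrow> real^'n::finite \<Rightarrow> real^'n \<Rightarrow> real^'n \<Rightarrow> real" where
  "box_bump m a b z = (\<Prod>i\<in>UNIV. flat_exp 1 (real (Suc m) * (z$i - a$i)) * flat_exp 1 (real (Suc m) * (b$i - z$i)))"

lemma smooth_box_bump: "smooth_on UNIV (box_bump m a b)"
  unfolding smooth_on_def
proof
  fix k
  have l: "linear (\<lambda>z::real^'n. c * z$i)" for c i
    by (rule linearI) (auto simp: algebra_simps)
  have 1: "Ck_on k UNIV (\<lambda>z. flat_exp 1 (real (Suc m) * (z$i - a$i)))" for i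
    using smooth_flat_exp_linear[OF l[of "real (Suc m)" i], of k 1 "- real (Suc m) * a$i"]
    by (simp add: algebra_simps)
  have 2: "Ck_on k UNIV (\<lambda>z. flat_exp 1 (real (Suc m) * (b$i - z$i)))" for i
    using smooth_flat_exp_linear[OF l[of "- real (Suc m)" i], of k 1 "real (Suc m) * b$i"]
    by (simp add: algebra_simps)
  have "Ck_on k UNIV (\<lambda>z. \<Prod>i\<in>UNIV. flat_exp 1 (real (Suc m) * (z$i - a$i)) * flat_exp 1 (real (Suc m) * (b$i - z$i)))"
    by (intro Ck_on_prod open_UNIV finite Ck_on_scaleR[where 'b=real, simplified] 1 2)
  then show "Ck_on k UNIV (box_bump m a b)" by (simp add: box_bump_def[abs_def])
qed

lemma box_bump_nz: "box_bump m a b z \<noteq> 0 \<longleftrightarrow> z \<in> box a b"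
  by (auto simp: box_bump_def flat_exp_1_bounds(4) mem_box_cart zero_less_mult_iff not_le)

lemma box_bump_bounds: "0 \<le> box_bump m a b z" "box_bump m a b z \<le> 1"
  by (auto simp: box_bump_def flat_exp_1_bounds intro!: prod_nonneg prod_le_1 mult_le_one)

lemma box_bump_tendsto: "(\<lambda>m. box_bump m a b z) \<longlonglongrightarrow> indicator (box a b) z"
proof (cases "z \<in> box a b")
  case False
  then have "box_bump m a b z = 0" for m using box_bump_nz[of m a b z] by blast
  with False show ?thesis by simp
next
  case True
  have e: "(\<lambda>m. flat_exp 1 (real (Suc m) * t)) \<longlonglongrightarrow> 1" if "t > 0" for t
  proof -
    have "(\<lambda>m. exp (- (inverse (real (Suc m)) * inverse t))) \<longlonglongrightarrow> exp (- (0 * inverse t))"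
      by (intro tendsto_intros LIMSEQ_inverse_real_of_nat)
    moreover have "exp (- (inverse (real (Suc m)) * inverse t)) = flat_exp 1 (real (Suc m) * t)" for m
      using that by (simp add: flat_exp_1 field_simps zero_less_mult_iff del: of_nat_Suc)
    ultimately show ?thesis by simp
  qed
  have "(\<lambda>m. box_bump m a b z) \<longlonglongrightarrow> (\<Prod>i\<in>(UNIV::'a set). 1 * 1)"
    unfolding box_bump_def using True by (intro tendsto_intros e) (auto simp: mem_box_cart)
  then show ?thesis using True by simp
qed

section \<open>Extending C1 functions past a compact set\<close>

lemma Ck_on_Un:
  assumes "open S" "open T" "Ck_on k S f" "Ck_on k T f"
  shows "Ck_on k (S \<union> T) f"
  using assms(3,4)
proof (induction k arbitrary: f)
  case 0
  then show ?case using assms(1,2) by (simp add: continuous_on_open_Un)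
qed auto

text \<open>Multiply by a cut-off that is 1 near \<open>K\<close> and 0 near the complement of
  \<open>S\<close>. Agreement on an open \<open>V\<close>, and not just on \<open>K\<close>, makes
  the partial derivatives agree on \<open>K\<close> too.\<close>

lemma C1_extension:
  fixes f :: "real^'n::finite \<Rightarrow> 'b::real_normed_vector"
  assumes "open S" "Ck_on 1 S f" "compact K" "K \<subseteq> S"
  obtains F V where "Ck_on 1 UNIV F" "open V" "K \<subseteq> V" "V \<subseteq> S" "\<And>x. x \<in> V \<Longrightarrow> F x = f x"
proof -
  have "\<exists>a b. x \<in> box a b \<and> box a b \<subseteq> S" if "x \<in> K" for x
  proof -
    have "x \<in> S" using that assms(4) by auto
    then show ?thesis using open_contains_box[OF assms(1), of x] by metis
  qed
  then obtain A B where AB: "x \<in> box (A x) (B x)" "box (A x) (B x) \<subseteq> S" if "x \<in> K" for x by metis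
  obtain J where J: "J \<subseteq> K" "finite J" "K \<subseteq> (\<Union>x\<in>J. box (A x) (B x))"
  proof (rule compactE_image[OF assms(3), of K "\<lambda>x. box (A x) (B x)"])
    show "K \<subseteq> (\<Union>x\<in>K. box (A x) (B x))" using AB(1) by blast
  qed (auto intro: that)
  \<comment> \<open>Positive on \<open>K\<close> and zero outside \<open>S\<close>, but not yet
    constant on \<open>K\<close>; the step function \<open>\<sigma>\<close> will flatten it.\<close>
  define \<psi> where "\<psi> z = (\<Sum>x\<in>J. box_bump 0 (A x) (B x) z)" for z
  have \<psi>C: "Ck_on 1 UNIV \<psi>" unfolding \<psi>_def
    by (intro Ck_on_sum J open_UNIV smooth_box_bump[unfolded smooth_on_def, rule_format])
  then have cont: "continuous_on UNIV \<psi>" by (rule Ck_on_continuous)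
  have pos: "\<psi> z > 0" if "z \<in> K" for z
  proof -
    obtain x where "x \<in> J" "z \<in> box (A x) (B x)" using subsetD[OF J(3) \<open>z \<in> K\<close>] by blast
    then have "box_bump 0 (A x) (B x) z > 0"
      using box_bump_bounds(1)[of 0 "A x" "B x" z] box_bump_nz[of 0 "A x" "B x" z] by linarith
    then show ?thesis unfolding \<psi>_def using \<open>x \<in> J\<close> J(2) box_bump_bounds(1)
      by (intro sum_pos2[of J x]) auto
  qed
  \<comment> \<open>The minimum of \<open>\<psi>\<close> on the compact set; any positive number
    serves when \<open>K\<close> is empty.\<close>
  obtain \<epsilon> where \<epsilon>: "\<epsilon> > 0" "\<And>z. z \<in> K \<Longrightarrow> \<epsilon> \<le> \<psi> z"
  proof (cases "K = {}")
    case False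
    then obtain z0 where "z0 \<in> K" "\<And>z. z \<in> K \<Longrightarrow> \<psi> z0 \<le> \<psi> z"
      using continuous_attains_inf[OF assms(3) False continuous_on_subset[OF cont subset_UNIV]] by blast
    then show ?thesis using that pos by blast
  qed (use that[of 1] in auto)
  have supp: "z \<in> (\<Union>x\<in>J. box (A x) (B x))" if nz: "\<psi> z \<noteq> 0" for z
  proof -
    obtain x where "x \<in> J" "box_bump 0 (A x) (B x) z \<noteq> 0"
      using nz unfolding \<psi>_def by (rule sum.not_neutral_contains_not_neutral)
    then show ?thesis using box_bump_nz[of 0 "A x" "B x" z] by auto
  qed
  \<comment> \<open>A smooth step from 0 to 1 between \<epsilon>/4 and \<epsilon>/2. The two terms
    of the denominator vanish for t \<le> \<epsilon>/4 and for t \<ge> \<epsilon>/2 respectively, so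
    never together.\<close>
  define \<sigma> where "\<sigma> t = flat_exp 1 (t - \<epsilon>/4) / (flat_exp 1 (t - \<epsilon>/4) + flat_exp 1 (\<epsilon>/2 - t))" for t
  have den: "flat_exp 1 (t - \<epsilon>/4) + flat_exp 1 (\<epsilon>/2 - t) > 0" for t
  proof (cases "t > \<epsilon>/4")
    case True then show ?thesis using flat_exp_1_bounds(1)[of "\<epsilon>/2 - t"] flat_exp_1_bounds(3)[of "t - \<epsilon>/4"] by simp
  next
    case False then show ?thesis using flat_exp_1_bounds(1)[of "t - \<epsilon>/4"] flat_exp_1_bounds(3)[of "\<epsilon>/2 - t"] \<epsilon>(1) by simp
  qed
  define \<sigma>' where "\<sigma>' t = (flat_exp (flat_exp_next 1) (t - \<epsilon>/4) * (flat_exp 1 (t - \<epsilon>/4) + flat_exp 1 (\<epsilon>/2 - t))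
     - flat_exp 1 (t - \<epsilon>/4) * (flat_exp (flat_exp_next 1) (t - \<epsilon>/4) - flat_exp (flat_exp_next 1) (\<epsilon>/2 - t)))
     / (flat_exp 1 (t - \<epsilon>/4) + flat_exp 1 (\<epsilon>/2 - t))\<^sup>2" for t
  have \<sigma>d: "(\<sigma> has_real_derivative \<sigma>' t) (at t)" for t
    unfolding \<sigma>_def \<sigma>'_def using den[of t]
    by (auto intro!: derivative_eq_intros DERIV_chain2[OF flat_exp_has_derivative] simp: power2_eq_square)
  have \<sigma>c: "continuous_on UNIV \<sigma>'"
    unfolding \<sigma>'_def using den
    by (intro continuous_intros continuous_on_compose2[OF continuous_on_flat_exp[of UNIV]]) (auto simp: less_imp_neq[symmetric])
  define ct where "ct z = \<sigma> (\<psi> z)" for z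
  have dpsi: "\<psi> differentiable (at z)" for z using \<psi>C by simp
  have ctd: "(ct has_derivative (\<lambda>v. \<sigma>' (\<psi> z) * (\<Sum>i\<in>UNIV. v$i *\<^sub>R pd i \<psi> z))) (at z)" for z
    unfolding ct_def[abs_def]
    using has_derivative_compose[OF has_derivative_pd[OF dpsi] \<sigma>d[unfolded has_field_derivative_def]]
    by (simp add: mult.commute)
  have "pd i ct = (\<lambda>z. \<sigma>' (\<psi> z) * pd i \<psi> z)" for i
  proof
    fix z show "pd i ct z = \<sigma>' (\<psi> z) * pd i \<psi> z"
      using pd_eqI[OF ctd, of i z] by (simp add: axis_def if_distrib if_distribR cong: if_cong)
  qed
  moreover have "continuous_on UNIV (\<lambda>z. \<sigma>' (\<psi> z) * pd i \<psi> z)" for i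
    using \<psi>C by (intro continuous_intros continuous_on_compose2[OF \<sigma>c cont]) auto
  ultimately have ctC: "Ck_on 1 UNIV ct" using ctd by (auto simp: differentiable_def)
  define F where "F z = (if z \<in> S then ct z *\<^sub>R f z else 0)" for z
  have z0: "ct z = 0" if "\<psi> z < \<epsilon>/4" for z using that by (simp add: ct_def \<sigma>_def flat_exp_1)
  have z1: "ct z = 1" if "\<psi> z > \<epsilon>/2" for z using that \<epsilon>(1) by (simp add: ct_def \<sigma>_def flat_exp_1)
  let ?W = "{z. \<psi> z < \<epsilon>/4}" and ?V = "{z. \<psi> z > \<epsilon>/2}"
  have US: "(\<Union>x\<in>J. box (A x) (B x)) \<subseteq> S" using AB J(1) by blast
  have VS: "?V \<subseteq> S" using supp \<epsilon>(1) US by (smt (verit) mem_Collect_eq subset_iff divide_pos_pos)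
  have oW: "open ?W" and oV: "open ?V"
    by (rule open_Collect_less[OF cont continuous_on_const] open_Collect_less[OF continuous_on_const cont])+
  have "Ck_on 1 S F"
    by (rule Ck_on_cong[OF assms(1) _ Ck_on_scaleR[OF assms(1) Ck_on_subset[OF ctC] assms(2)]]) (auto simp: F_def)
  moreover have "Ck_on 1 ?W F"
    by (rule Ck_on_cong[OF oW _ Ck_on_const[of _ _ 0]]) (auto simp: F_def z0)
  ultimately have "Ck_on 1 (S \<union> ?W) F" using assms(1) oW by (intro Ck_on_Un)
  \<comment> \<open>\<open>F\<close> is C1 on two open sets: on \<open>S\<close>, and where
    \<open>\<psi>\<close> is so small that the cut-off is 0. They cover the space because
    \<open>\<psi>\<close> vanishes off \<open>S\<close>.\<close>
  moreover have "S \<union> ?W = UNIV"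
  proof -
    have "z \<in> S" if "\<not> \<psi> z < \<epsilon>/4" for z
      using that \<epsilon>(1) supp[of z] US by fastforce
    then show ?thesis by auto
  qed
  ultimately have "Ck_on 1 UNIV F" by simp
  then show ?thesis
    by (intro that[of F ?V]) (use oV VS \<epsilon> z1 in \<open>force simp: F_def\<close>)+
qed


section \<open>Weak derivatives of smooth functions\<close>

lemma integrable_on_compact_support:
  fixes f :: "'a::euclidean_space \<Rightarrow> 'b::euclidean_space"
  assumes "compact K" "continuous_on K f" "\<And>x. x \<notin> K \<Longrightarrow> f x = 0"
  shows "integrable lborel f" "integrable lebesgue f"
proof -
  have "(\<lambda>x. indicator K x *\<^sub>R f x) = f" using assms(3) by (auto simp: indicator_def)
  then show 1: "integrable lborel f" using borel_integrable_compact[OF assms(1,2)] by simp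
  then show "integrable lebesgue f" by (simp add: integrable_completion borel_measurable_integrable)
qed

lemma sigma_finite_lebesgue: "sigma_finite_measure (lebesgue :: 'a::euclidean_space measure)"
proof
  obtain A :: "'a set set" where "countable A" "A \<subseteq> sets lborel" "\<Union>A = space lborel" "\<forall>a\<in>A. emeasure lborel a \<noteq> \<infinity>"
    using lborel.sigma_finite_countable by blast
  then show "\<exists>A::'a set set. countable A \<and> A \<subseteq> sets lebesgue \<and> \<Union>A = space lebesgue \<and> (\<forall>a\<in>A. emeasure lebesgue a \<noteq> \<infinity>)"
    by (intro exI[of _ A]) auto
qed

lemma has_vector_derivative_difference_quotient:
  assumes "(g has_vector_derivative p) (at 0)"
  shows "((\<lambda>h. (g h - g 0) /\<^sub>R h) \<longlongrightarrow> p) (at 0)"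
proof (rule LIM_zero_cancel, rule tendsto_norm_zero_cancel, rule Lim_transform_eventually)
  show "((\<lambda>h. norm (g (0 + h) - g 0 - h *\<^sub>R p) / norm h) \<longlongrightarrow> 0) (at 0)"
    using assms unfolding has_vector_derivative_def has_derivative_at by simp
  have "norm (g (0 + h) - g 0 - h *\<^sub>R p) / norm h = norm ((g h - g 0) /\<^sub>R h - p)" if "h \<noteq> 0" for h
  proof -
    have "g h - g 0 - h *\<^sub>R p = h *\<^sub>R ((g h - g 0) /\<^sub>R h - p)" using that by (simp add: scaleR_diff_right)
    then have "norm (g h - g 0 - h *\<^sub>R p) = \<bar>h\<bar> * norm ((g h - g 0) /\<^sub>R h - p)" by (metis norm_scaleR)
    then show ?thesis using that by simp
  qed
  then show "\<forall>\<^sub>F h in at 0. norm (g (0 + h) - g 0 - h *\<^sub>R p) / norm h = norm ((g h - g 0) /\<^sub>R h - p)"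
    by (auto simp: eventually_at_filter)
qed

lemma pd_zero_outside:
  assumes "\<And>x. x \<notin> K \<Longrightarrow> f x = 0" "closed K" "x \<notin> K"
  shows "pd i f x = 0"
  using pd_transform[of "-K" x f "\<lambda>_. 0" i] assms by (simp add: open_Compl)

text \<open>By translation invariance the integral of every difference quotient vanishes.\<close>

lemma integral_pd_eq_0:
  fixes f :: "real^'n::finite \<Rightarrow> 'b::euclidean_space"
  assumes f: "Ck_on 1 UNIV f" and K: "compact K" "\<And>x. x \<notin> K \<Longrightarrow> f x = 0"
  shows "integral\<^sup>L lborel (pd i f) = 0" "integral\<^sup>L lebesgue (pd i f) = 0"
proof -
  define e where "e = (axis i 1 :: real^'n)"
  have ne: "norm e = 1" by (simp add: e_def norm_axis_1)
  have df: "f differentiable (at x)" for x using f by simp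
  have cf: "continuous_on UNIV f" by (rule Ck_on_continuous[OF f])
  have cp: "continuous_on UNIV (pd i f)" using f by simp
  have p0: "pd i f x = 0" if "x \<notin> K" for x using pd_zero_outside[OF K(2) compact_imp_closed[OF K(1)] that] .
  obtain B where B: "\<And>x. norm (pd i f x) \<le> B"
  proof -
    have "bounded (pd i f ` K)"
      by (intro compact_imp_bounded compact_continuous_image continuous_on_subset[OF cp] K(1)) auto
    then obtain B where B: "B > 0" "\<And>x. x \<in> K \<Longrightarrow> norm (pd i f x) \<le> B" unfolding bounded_pos by auto
    then have "norm (pd i f x) \<le> B" for x using p0[of x] by (cases "x \<in> K") auto
    then show ?thesis by (rule that)
  qed
  obtain R where R: "K \<subseteq> ball 0 R" using bounded_subset_ballD[OF compact_imp_bounded[OF K(1)]] by blast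
  \<comment> \<open>All shifts have length at most 1, so enlarging the radius by 1 catches the
    supports of all shifted functions.\<close>
  define C where "C = cball (0::real^'n) (R + 1)"
  have CK: "compact C" by (simp add: C_def)
  define s where "s k = inverse (real (Suc k))" for k
  have s: "0 < s k" "s k \<le> 1" for k by (auto simp: s_def field_simps)
  define q where "q k x = inverse (s k) *\<^sub>R (f (x + s k *\<^sub>R e) - f x)" for k x
  have vd: "((\<lambda>t. f (x + t *\<^sub>R e)) has_vector_derivative pd i f (x + t *\<^sub>R e)) (at t)" for x t
    using has_vector_derivative_line[OF df, of x e t]
    by (simp add: e_def axis_def if_distrib if_distribR cong: if_cong)
  have fz: "f (x + s k *\<^sub>R e) = 0" "f x = 0" if "x \<notin> C" for x k
  proof -
    have "norm x > R + 1" using that by (simp add: C_def)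
    moreover have "norm (x + s k *\<^sub>R e) \<ge> norm x - 1"
      using norm_triangle_ineq2[of x "- s k *\<^sub>R e"] s[of k] ne by simp
    ultimately show "f (x + s k *\<^sub>R e) = 0" "f x = 0" using R by (auto intro!: K(2))
  qed
  have int: "integrable lborel (\<lambda>x. f (x + t *\<^sub>R e))" for t
  proof (rule integrable_on_compact_support)
    show "compact ((\<lambda>x. x - t *\<^sub>R e) ` K)"
      by (intro compact_continuous_image continuous_intros K(1))
    show "continuous_on ((\<lambda>x. x - t *\<^sub>R e) ` K) (\<lambda>x. f (x + t *\<^sub>R e))"
      by (intro continuous_on_compose2[OF cf] continuous_intros) auto
    show "f (x + t *\<^sub>R e) = 0" if "x \<notin> (\<lambda>x. x - t *\<^sub>R e) ` K" for x
      using that by (intro K(2)) force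
  qed
  have tr: "integral\<^sup>L lborel (\<lambda>x. f (x + t *\<^sub>R e)) = integral\<^sup>L lborel f" for t
  proof -
    have "integral\<^sup>L lborel f = integral\<^sup>L (distr lborel borel ((+) (t *\<^sub>R e))) f"
      by (simp add: lborel_distr_plus)
    also have "\<dots> = integral\<^sup>L lborel (\<lambda>x. f (t *\<^sub>R e + x))"
      by (rule integral_distr) (auto intro!: borel_measurable_continuous_onI cf)
    finally show ?thesis by (simp add: add.commute)
  qed
  have q0: "integral\<^sup>L lborel (q k) = 0" for k
    using int[of "s k"] int[of 0] tr[of "s k"] by (simp add: q_def[abs_def])
  \<comment> \<open>The difference quotients vanish off \<open>C\<close> and are bounded by
    \<open>B\<close> through the mean value inequality, which gives an integrable majorant.\<close>
  have "(\<lambda>k. integral\<^sup>L lborel (q k)) \<longlonglongrightarrow> integral\<^sup>L lborel (pd i f)"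
  proof (rule integral_dominated_convergence[where w="\<lambda>x. indicator C x * B"])
    show "pd i f \<in> borel_measurable lborel" using cp borel_measurable_continuous_onI by simp
    show "q k \<in> borel_measurable lborel" for k
      using int[of "s k"] int[of 0] unfolding q_def[abs_def] by (auto intro!: borel_measurable_integrable)
    show "integrable lborel (\<lambda>x. indicator C x * B)"
      using borel_integrable_compact[OF CK continuous_on_const[of C B]] by simp
    have "(\<lambda>k. q k x) \<longlonglongrightarrow> pd i f x" for x
    proof -
      have "((\<lambda>h. (f (x + h *\<^sub>R e) - f x) /\<^sub>R h) \<longlongrightarrow> pd i f x) (at 0)"
        using has_vector_derivative_difference_quotient[where g="\<lambda>h. f (x + h *\<^sub>R e)" and p="pd i f x"]
          vd[where x=x and t=0] by simp
      moreover have "filterlim s (at 0) sequentially"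
        using LIMSEQ_inverse_real_of_nat s(1) unfolding s_def[abs_def] 
        by (intro filterlim_atI) (auto simp: less_imp_neq)
      ultimately show ?thesis unfolding q_def by (rule filterlim_compose)
    qed
    then show "AE x in lborel. (\<lambda>k. q k x) \<longlonglongrightarrow> pd i f x" by simp
    have "norm (q k x) \<le> indicator C x * B" for k x
    proof (cases "x \<in> C")
      case True
      have "norm (f (x + s k *\<^sub>R e) - f (x + 0 *\<^sub>R e)) \<le> B * norm (s k - 0)"
        by (rule differentiable_bound[of UNIV "\<lambda>t. f (x + t *\<^sub>R e)" "\<lambda>t h. h *\<^sub>R pd i f (x + t *\<^sub>R e)"])
           (use vd B in \<open>auto simp: has_vector_derivative_def onorm_scaleR_left_lemma intro!: onorm_le mult_left_mono simp: mult.commute[of B]\<close>)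
      then have "norm (f (x + s k *\<^sub>R e) - f x) \<le> B * s k" using s(1)[of k] by simp
      moreover have "norm (q k x) = norm (f (x + s k *\<^sub>R e) - f x) / s k"
        using s(1)[of k] by (simp add: q_def divide_inverse mult.commute)
      ultimately show ?thesis using True s(1)[of k] by (simp add: pos_divide_le_eq)
    next
      case False
      then show ?thesis using fz(1)[of x k] fz(2)[of x] by (simp add: q_def)
    qed
    then show "AE x in lborel. norm (q k x) \<le> indicator C x * B" for k by simp
  qed
  with q0 show "integral\<^sup>L lborel (pd i f) = 0" by (simp add: LIMSEQ_const_iff)
  then show "integral\<^sup>L lebesgue (pd i f) = 0"
    using cp borel_measurable_continuous_onI by (subst integral_completion) auto
qed

text \<open>The product, extended by 0 outside \<open>S\<close>, is C1 on the whole space with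
  compact support, so \<open>integral_pd_eq_0\<close> applies to it. \<open>f\<close> itself may be
  wild near the boundary of \<open>S\<close>.\<close>

lemma integral_by_parts:
  fixes f :: "real^'n::finite \<Rightarrow> 'b::euclidean_space"
  assumes S: "open S" and f: "Ck_on 1 S f" and u: "Ck_on 1 UNIV u"
    and K: "compact (closure {x. u x \<noteq> 0})" "closure {x. u x \<noteq> 0} \<subseteq> S"
  shows "integrable (lebesgue_on S) (\<lambda>x. pd i u x *\<^sub>R f x)"
    "integrable (lebesgue_on S) (\<lambda>x. u x *\<^sub>R pd i f x)"
    "(\<integral>x. pd i u x *\<^sub>R f x \<partial>lebesgue_on S) = - (\<integral>x. u x *\<^sub>R pd i f x \<partial>lebesgue_on S)"
proof -
  define K where "K = closure {x. u x \<noteq> 0}"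
  have u0: "u x = 0" if "x \<notin> K" for x using that closure_subset[of "{x. u x \<noteq> 0}"] by (auto simp: K_def)
  have pu0: "pd i u x = 0" if "x \<notin> K" for x
    using pd_zero_outside[OF u0 _ that] by (simp add: K_def)
  have KS: "K \<subseteq> S" and cK: "compact K" using K by (auto simp: K_def)
  define F where "F x = (if x \<in> S then u x *\<^sub>R f x else 0)" for x
  have oK: "open (- K)" unfolding K_def by (rule open_Compl) simp
  have "Ck_on 1 S F"
    by (rule Ck_on_cong[OF S _ Ck_on_scaleR[OF S Ck_on_subset[OF u] f]]) (auto simp: F_def)
  moreover have "Ck_on 1 (-K) F"
    by (rule Ck_on_cong[OF oK _ Ck_on_const[of _ _ 0]]) (auto simp: F_def u0)
  ultimately have "Ck_on 1 (S \<union> - K) F" by (rule Ck_on_Un[OF S oK])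
  moreover have "S \<union> - K = UNIV" using KS by auto
  ultimately have FC: "Ck_on 1 UNIV F" by simp
  have F0: "F x = 0" if "x \<notin> K" for x using that by (simp add: F_def u0)
  have pF: "pd i F x = u x *\<^sub>R pd i f x + pd i u x *\<^sub>R f x" if "x \<in> S" for x
  proof -
    have "pd i F x = pd i (\<lambda>x. u x *\<^sub>R f x) x"
      by (rule pd_transform[OF S that]) (simp add: F_def)
    also have "\<dots> = u x *\<^sub>R pd i f x + pd i u x *\<^sub>R f x"
      using f u that by (intro pd_scaleR) auto
    finally show ?thesis .
  qed
  have ig: "integrable (lebesgue_on S) g" if "continuous_on K g" "\<And>x. x \<notin> K \<Longrightarrow> g x = 0" for g :: "real^'n \<Rightarrow> 'b"
    using integrable_on_compact_support(2)[OF cK that] S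
    by (intro integrable_restrict_space[THEN iffD2] integrable_mult_indicator) auto
  have cS: "continuous_on K f" "continuous_on K (pd i f)" "continuous_on K u" "continuous_on K (pd i u)"
    using f u KS Ck_on_continuous[OF f] Ck_on_continuous[OF u] by (auto intro: continuous_on_subset)
  show 1: "integrable (lebesgue_on S) (\<lambda>x. pd i u x *\<^sub>R f x)"
    by (rule ig) (auto intro: continuous_intros cS simp: pu0)
  show 2: "integrable (lebesgue_on S) (\<lambda>x. u x *\<^sub>R pd i f x)"
    by (rule ig) (auto intro: continuous_intros cS simp: u0)
  have "(\<integral>x. u x *\<^sub>R pd i f x + pd i u x *\<^sub>R f x \<partial>lebesgue_on S) = (\<integral>x. pd i F x \<partial>lebesgue_on S)"
    by (rule Bochner_Integration.integral_cong) (auto simp: pF)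
  also have "\<dots> = integral\<^sup>L lebesgue (\<lambda>x. indicator S x *\<^sub>R pd i F x)"
    using S by (intro integral_restrict_space) auto
  also have "(\<lambda>x. indicator S x *\<^sub>R pd i F x) = pd i F"
    using pd_zero_outside[OF F0 compact_imp_closed[OF cK]] KS by (force simp: indicator_def)
  also have "integral\<^sup>L lebesgue (pd i F) = 0" by (rule integral_pd_eq_0(2)[OF FC cK F0])
  finally show "(\<integral>x. pd i u x *\<^sub>R f x \<partial>lebesgue_on S) = - (\<integral>x. u x *\<^sub>R pd i f x \<partial>lebesgue_on S)"
    using 1 2 by (simp add: add_eq_0_iff)
qed

section \<open>The fundamental lemma of the calculus of variations\<close>

lemma closure_box_bump: "closure {x. box_bump m a b x \<noteq> 0} \<subseteq> cbox a b"
  by (rule closure_minimal) (auto simp: box_bump_nz mem_box_cart less_imp_le)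

text \<open>Open boxes form an intersection-stable generator of the Borel sets, so vanishing
  integrals spread to all Borel sets; the total integral enters at complements. Lebesgue sets differ
  from Borel sets by null sets.\<close>

lemma AE_eq_0_of_box_integrals:
  fixes V :: "'a::euclidean_space \<Rightarrow> 'b::euclidean_space"
  assumes V: "integrable lebesgue V" and V0: "integral\<^sup>L lebesgue V = 0"
    and box: "\<And>a b. set_lebesgue_integral lebesgue (box a b) V = 0"
  shows "AE x in lebesgue. V x = 0"
proof (rule sigma_finite_measure.density_zero[OF sigma_finite_lebesgue V])
  have B: "set_lebesgue_integral lebesgue A V = 0" if "A \<in> sets borel" for A
  proof -
    have "A \<in> sigma_sets UNIV (range (\<lambda>(a, b). box a b))"
      using that by (simp add: borel_eq_box)
    have bs: "sigma_sets UNIV (range (\<lambda>(a, b). box a b :: 'a set)) = sets borel" by (simp add: borel_eq_box)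
    have Is: "Int_stable (range (\<lambda>(a, b). box a b :: 'a set))" by (auto simp: Int_stable_def box_Int_box)
    show ?thesis using \<open>A \<in> sigma_sets _ _\<close>
    proof (induction rule: sigma_sets_induct_disjoint[OF Is Pow_UNIV[THEN equalityD2, THEN subset_trans[OF subset_UNIV]], consumes 1, case_names basic empty compl union])
      case (basic A)
      then show ?case using box by auto
    next
      case empty
      then show ?case by (simp add: set_lebesgue_integral_def)
    next
      case (compl A)
      then have A: "A \<in> sets lebesgue" unfolding bs by simp
      have iA: "integrable lebesgue (\<lambda>x. indicator A x *\<^sub>R V x)"
        using V A by (intro integrable_mult_indicator)
      have "(\<lambda>x. indicator (UNIV - A) x *\<^sub>R V x) = (\<lambda>x. V x - indicator A x *\<^sub>R V x)"
        by (auto simp: indicator_def)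
      then show ?case using compl(2) V0 V iA by (simp add: set_lebesgue_integral_def)
    next
      case (union A)
      then have A: "A n \<in> sets lebesgue" for n unfolding bs by auto
      have "set_lebesgue_integral lebesgue (\<Union>n. A n) V = (\<Sum>n. set_lebesgue_integral lebesgue (A n) V)"
        using A V union(1) unfolding set_integrable_def disjoint_family_on_def
        by (intro lebesgue_integral_countable_add) (auto simp: set_integrable_def intro!: integrable_mult_indicator)
      then show ?case using union by simp
    qed
  qed
  fix A :: "'a set" assume "A \<in> sets lebesgue"
  then obtain B N where BN: "B \<in> sets borel" "negligible N" "B \<union> N = A" by (rule sets_lebesgue_almost_borel)
  have "A - B \<union> (B - A) \<in> null_sets lebesgue"
    using BN by (intro negligible_iff_null_sets[THEN iffD1] negligible_subset[OF BN(2)]) auto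
  then have "set_lebesgue_integral lebesgue A V = set_lebesgue_integral lebesgue B V"
    using V \<open>A \<in> _\<close> BN(1) by (intro set_integral_null_delta) auto
  then show "set_lebesgue_integral lebesgue A V = 0" using B[OF BN(1)] by simp
qed

text \<open>The bumps recover the integrals over boxes by dominated convergence. As \<open>w\<close>
  is only locally integrable in \<open>S\<close>, it is cut down to one closed box at a time, and
  countably many of these exhaust \<open>S\<close>.\<close>

lemma AE_eq_0_of_bump_integrals:
  fixes w :: "real^'n::finite \<Rightarrow> 'b::euclidean_space"
  assumes S: "open S" and w: "\<And>a b. cbox a b \<subseteq> S \<Longrightarrow> set_integrable lebesgue (cbox a b) w"
    and bump: "\<And>m a b. cbox a b \<subseteq> S \<Longrightarrow> (\<integral>x. box_bump m a b x *\<^sub>R w x \<partial>lebesgue_on S) = 0"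
  shows "AE x in lebesgue_on S. w x = 0"
proof -
  have sS: "S \<in> sets lebesgue" using S by auto
  have bx: "set_lebesgue_integral lebesgue (box a b) w = 0" if ab: "cbox a b \<subseteq> S" for a b
  proof -
    have W: "integrable lebesgue (\<lambda>x. indicator (cbox a b) x *\<^sub>R w x)"
      using w[OF ab] by (simp add: set_integrable_def)
    have sub: "box a b \<subseteq> cbox a b" by (rule box_subset_cbox)
    have eq: "indicator S x *\<^sub>R (box_bump m a b x *\<^sub>R w x) = box_bump m a b x *\<^sub>R (indicator (cbox a b) x *\<^sub>R w x)" for m x
    proof (cases "x \<in> box a b")
      case True
      then have "x \<in> S" "x \<in> cbox a b" using sub ab by auto
      then show ?thesis by simp
    next
      case False
      then show ?thesis using box_bump_nz[of m a b x] by simp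
    qed
    have z: "(\<integral>x. box_bump m a b x *\<^sub>R (indicator (cbox a b) x *\<^sub>R w x) \<partial>lebesgue) = 0" for m
    proof -
      have "(\<integral>x. box_bump m a b x *\<^sub>R w x \<partial>lebesgue_on S) = (\<integral>x. indicator S x *\<^sub>R (box_bump m a b x *\<^sub>R w x) \<partial>lebesgue)"
        using sS by (intro integral_restrict_space) simp
      then show ?thesis using bump[OF ab, of m] by (simp only: eq)
    qed
    have cb: "box_bump m a b \<in> borel_measurable lebesgue" for m
      using smooth_box_bump[of m a b] 
      by (intro measurable_completion) (auto simp: smooth_on_def intro!: borel_measurable_continuous_onI dest!: spec[of _ 0])
    have "(\<lambda>m. \<integral>x. box_bump m a b x *\<^sub>R (indicator (cbox a b) x *\<^sub>R w x) \<partial>lebesgue) \<longlonglongrightarrow>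
        (\<integral>x. indicator (box a b) x *\<^sub>R (indicator (cbox a b) x *\<^sub>R w x) \<partial>lebesgue)"
    proof (rule integral_dominated_convergence[where w="\<lambda>x. norm (indicator (cbox a b) x *\<^sub>R w x)"])
      show "integrable lebesgue (\<lambda>x. norm (indicator (cbox a b) x *\<^sub>R w x))" using W by (rule integrable_norm)
      show "(\<lambda>x. indicator (box a b) x *\<^sub>R (indicator (cbox a b) x *\<^sub>R w x)) \<in> borel_measurable lebesgue"
        by (intro borel_measurable_scaleR borel_measurable_indicator borel_measurable_integrable[OF W]) auto
      show "(\<lambda>x. box_bump m a b x *\<^sub>R (indicator (cbox a b) x *\<^sub>R w x)) \<in> borel_measurable lebesgue" for m
        by (intro borel_measurable_scaleR cb borel_measurable_integrable[OF W])
      show "AE x in lebesgue. (\<lambda>m. box_bump m a b x *\<^sub>R (indicator (cbox a b) x *\<^sub>R w x)) \<longlonglongrightarrow>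
          indicator (box a b) x *\<^sub>R (indicator (cbox a b) x *\<^sub>R w x)"
        by (intro AE_I2 tendsto_intros box_bump_tendsto)
      show "AE x in lebesgue. norm (box_bump m a b x *\<^sub>R (indicator (cbox a b) x *\<^sub>R w x)) \<le> norm (indicator (cbox a b) x *\<^sub>R w x)" for m
        by (intro AE_I2) (auto simp: box_bump_bounds indicator_def intro: mult_left_le_one_le)
    qed
    then have "(\<integral>x. indicator (box a b) x *\<^sub>R (indicator (cbox a b) x *\<^sub>R w x) \<partial>lebesgue) = 0"
      by (simp only: z LIMSEQ_const_iff)
    moreover have "(\<lambda>x. indicator (box a b) x *\<^sub>R (indicator (cbox a b) x *\<^sub>R w x)) = (\<lambda>x. indicator (box a b) x *\<^sub>R w x)"
      using sub by (intro ext) (auto simp: indicator_def)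
    ultimately show ?thesis by (simp add: set_lebesgue_integral_def)
  qed
  have cb: "AE x in lebesgue. x \<in> cbox c d \<longrightarrow> w x = 0" if cd: "cbox c d \<subseteq> S" for c d
  proof -
    have sub: "box c d \<subseteq> cbox c d" by (rule box_subset_cbox)
    \<comment> \<open>Cut off on the open box: its intersection with another open box is again an
      open box, whose closure stays inside \<open>S\<close>.\<close>
    define V where "V x = indicator (box c d) x *\<^sub>R w x" for x
    have "integrable lebesgue (\<lambda>x. indicator (cbox c d) x *\<^sub>R w x)"
      using w[OF cd] by (simp add: set_integrable_def)
    then have "integrable lebesgue (\<lambda>x. indicator (box c d) x *\<^sub>R (indicator (cbox c d) x *\<^sub>R w x))"
      by (rule integrable_mult_indicator[rotated]) auto
    also have "(\<lambda>x. indicator (box c d) x *\<^sub>R (indicator (cbox c d) x *\<^sub>R w x)) = V"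
      using sub by (intro ext) (auto simp: V_def indicator_def)
    finally have V: "integrable lebesgue V" .
    have "AE x in lebesgue. V x = 0"
    proof (rule AE_eq_0_of_box_integrals[OF V])
      show "integral\<^sup>L lebesgue V = 0" using bx[OF cd] by (simp add: V_def[abs_def] set_lebesgue_integral_def)
      fix a b
      obtain a' b' where ab: "box a b \<inter> box c d = box a' b'"
        by (rule that[OF box_Int_box])
      show "set_lebesgue_integral lebesgue (box a b) V = 0"
      proof (cases "box a' b' = {}")
        case True
        then have z: "indicator (box a b) x *\<^sub>R V x = 0" for x using ab by (auto simp: V_def indicator_def)
        show ?thesis unfolding set_lebesgue_integral_def z by simp
      next
        case False
        have "cbox a' b' = closure (box a' b')" using closure_box[OF False] by simp
        also have "\<dots> \<subseteq> closure (box c d)" using ab by (intro closure_mono) blast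
        also have "\<dots> \<subseteq> cbox c d" by (intro closure_minimal sub) auto
        finally have "cbox a' b' \<subseteq> S" using cd by auto
        from bx[OF this] show ?thesis
          by (simp add: set_lebesgue_integral_def V_def indicator_inter_arith ab[symmetric])
      qed
    qed
    moreover have "AE x in lebesgue. x \<notin> cbox c d - box c d"
      using negligible_frontier_interval[of c d] unfolding negligible_iff_null_sets by (rule AE_not_in)
    ultimately show ?thesis by eventually_elim (auto simp: V_def)
  qed
  obtain \<D> where D: "countable \<D>" "\<And>X. X \<in> \<D> \<Longrightarrow> X \<subseteq> S" "\<And>X. X \<in> \<D> \<Longrightarrow> \<exists>a b. X = cbox a b" "\<Union>\<D> = S"
    using open_countable_Union_open_cbox[OF S] by (metis Pow_iff subsetD)
  have "AE x in lebesgue. \<forall>X\<in>\<D>. x \<in> X \<longrightarrow> w x = 0"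
    unfolding AE_ball_countable[OF D(1)] using D(2,3) cb by blast
  then have "AE x in lebesgue. x \<in> S \<longrightarrow> w x = 0"
    by eventually_elim (use D(4) in blast)
  then show ?thesis by (simp add: AE_restrict_space_iff sS)
qed

section \<open>Weak and classical derivatives\<close>

lemma test_function_box_bump: "cbox a b \<subseteq> S \<Longrightarrow> test_function S (box_bump m a b)"
  using closure_box_bump[of m a b] bounded_subset[OF bounded_cbox closure_box_bump[of m a b]]
  unfolding test_function_def compact_eq_bounded_closed by (auto simp: smooth_box_bump)

lemma weak_pd_classical:
  fixes f :: "real^3 \<Rightarrow> 'b::euclidean_space"
  assumes "open S" "Ck_on 1 S f"
  shows "weak_pd S i f (pd i f)"
  unfolding weak_pd_def
proof (intro allI impI)
  fix \<phi> assume "test_function S \<phi>"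
  then have "Ck_on 1 UNIV \<phi>" "compact (closure {x. \<phi> x \<noteq> 0})" "closure {x. \<phi> x \<noteq> 0} \<subseteq> S"
    unfolding test_function_def smooth_on_def by blast+
  from integral_by_parts(3)[OF assms this]
  show "(\<integral>x. pd i \<phi> x *\<^sub>R f x \<partial>lebesgue_on S) = - (\<integral>x. \<phi> x *\<^sub>R pd i f x \<partial>lebesgue_on S)" .
qed

text \<open>\<open>sobolev\<close> only asserts that some weak derivative exists. Testing it and the
  classical derivative against the bumps, with the same integral of \<open>f\<close> on the other
  side, identifies the two.\<close>

lemma weak_pd_unique:
  fixes f :: "real^3 \<Rightarrow> 'b::euclidean_space"
  assumes S: "open S" and f: "Ck_on 1 S f" and w: "weak_pd S i f g"
    and g: "\<And>a b. cbox a b \<subseteq> S \<Longrightarrow> set_integrable lebesgue (cbox a b) g"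
  shows "AE x in lebesgue_on S. g x = pd i f x"
proof -
  have sS: "S \<in> sets lebesgue" using S by auto
  have cp: "continuous_on S (pd i f)" using f by simp
  have p: "set_integrable lebesgue (cbox a b) (pd i f)" if "cbox a b \<subseteq> S" for a b
    using borel_integrable_compact[OF compact_cbox continuous_on_subset[OF cp that]]
    by (simp add: set_integrable_def integrable_completion borel_measurable_integrable)
  have "AE x in lebesgue_on S. g x - pd i f x = 0"
  proof (rule AE_eq_0_of_bump_integrals[OF S])
    show "set_integrable lebesgue (cbox a b) (\<lambda>x. g x - pd i f x)" if "cbox a b \<subseteq> S" for a b
      using g[OF that] p[OF that] by (rule set_integral_diff)
    fix m a b assume ab: "cbox a b \<subseteq> S"
    have C: "Ck_on 1 UNIV (box_bump m a b)" using smooth_box_bump by (auto simp only: smooth_on_def)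
    have t: "test_function S (box_bump m a b)" by (rule test_function_box_bump[OF ab])
    then have K: "compact (closure {x. box_bump m a b x \<noteq> 0})" "closure {x. box_bump m a b x \<noteq> 0} \<subseteq> S"
      by (auto simp: test_function_def)
    note ibp = integral_by_parts[OF S f C K, of i]
    have "set_integrable lebesgue (cbox a b) (\<lambda>x. box_bump m a b x *\<^sub>R g x)"
      unfolding set_integrable_def
    proof (rule Bochner_Integration.integrable_bound)
      show "integrable lebesgue (\<lambda>x. indicator (cbox a b) x *\<^sub>R g x)" using g[OF ab] by (simp add: set_integrable_def)
      have "box_bump m a b \<in> borel_measurable lebesgue"
        using Ck_on_continuous[OF C] by (intro measurable_completion) (simp add: borel_measurable_continuous_onI)
      then have "(\<lambda>x. box_bump m a b x *\<^sub>R (indicator (cbox a b) x *\<^sub>R g x)) \<in> borel_measurable lebesgue"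
        using g[OF ab] unfolding set_integrable_def by (rule borel_measurable_scaleR[OF _ borel_measurable_integrable])
      then show "(\<lambda>x. indicator (cbox a b) x *\<^sub>R (box_bump m a b x *\<^sub>R g x)) \<in> borel_measurable lebesgue"
        by (simp add: mult.commute)
      show "AE x in lebesgue. norm (indicator (cbox a b) x *\<^sub>R (box_bump m a b x *\<^sub>R g x)) \<le> norm (indicator (cbox a b) x *\<^sub>R g x)"
        by (intro AE_I2) (auto simp: box_bump_bounds indicator_def intro: mult_left_le_one_le)
    qed
    \<comment> \<open>The bump is 0 off the open box, so it makes no difference whether one
      integrates over \<open>cbox a b\<close> or over \<open>S\<close>.\<close>
    moreover have "indicator (cbox a b) x *\<^sub>R (box_bump m a b x *\<^sub>R g x) = indicator S x *\<^sub>R (box_bump m a b x *\<^sub>R g x)" for x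
      using ab box_subset_cbox[of a b] box_bump_nz[of m a b x] by (cases "x \<in> box a b") (auto simp: indicator_def)
    ultimately have ig: "integrable (lebesgue_on S) (\<lambda>x. box_bump m a b x *\<^sub>R g x)"
      using sS by (simp only: set_integrable_def) (rule integrable_restrict_space[THEN iffD2], auto)
    have "(\<integral>x. box_bump m a b x *\<^sub>R (g x - pd i f x) \<partial>lebesgue_on S)
      = (\<integral>x. box_bump m a b x *\<^sub>R g x \<partial>lebesgue_on S) - (\<integral>x. box_bump m a b x *\<^sub>R pd i f x \<partial>lebesgue_on S)"
      using ig ibp(2) by (simp add: scaleR_diff_right)
    also have "\<dots> = 0" using w t ibp(3) unfolding weak_pd_def by auto
    finally show "(\<integral>x. box_bump m a b x *\<^sub>R (g x - pd i f x) \<partial>lebesgue_on S) = 0" .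
  qed
  then show ?thesis by simp
qed

text \<open>A test function on \<open>T\<close> is also one on \<open>S\<close>, and it vanishes
  together with its derivative on the rest of \<open>S\<close>.\<close>

lemma weak_pd_subset:
  assumes "weak_pd S i f g" "T \<subseteq> S" "open T" "open S"
  shows "weak_pd T i f g"
  unfolding weak_pd_def
proof (intro allI impI)
  fix \<phi> assume t: "test_function T \<phi>"
  then have tS: "test_function S \<phi>" using assms(2) by (auto simp: test_function_def)
  have z: "\<phi> x = 0" if "x \<notin> T" for x
    using t that closure_subset[of "{x. \<phi> x \<noteq> 0}"] by (auto simp: test_function_def)
  have pz: "pd i \<phi> x = 0" if "x \<notin> T" for x
  proof (rule pd_zero_outside[of "closure {x. \<phi> x \<noteq> 0}"])
    show "\<phi> x = 0" if "x \<notin> closure {x. \<phi> x \<noteq> 0}" for x using that closure_subset[of "{x. \<phi> x \<noteq> 0}"] by auto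
    show "x \<notin> closure {x. \<phi> x \<noteq> 0}" using t that by (auto simp: test_function_def)
  qed simp
  have e: "(\<integral>x. h x \<partial>lebesgue_on T) = (\<integral>x. h x \<partial>lebesgue_on S)" if "\<And>x. x \<notin> T \<Longrightarrow> h x = 0" for h :: "real^3 \<Rightarrow> 'a"
  proof -
    have "(\<integral>x. h x \<partial>lebesgue_on T) = (\<integral>x. indicator T x *\<^sub>R h x \<partial>lebesgue)"
      using assms by (intro integral_restrict_space) auto
    also have "(\<lambda>x. indicator T x *\<^sub>R h x) = (\<lambda>x. indicator S x *\<^sub>R h x)"
      using that assms(2) by (intro ext) (auto simp: indicator_def)
    also have "(\<integral>x. indicator S x *\<^sub>R h x \<partial>lebesgue) = (\<integral>x. h x \<partial>lebesgue_on S)"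
      using assms by (intro integral_restrict_space[symmetric]) auto
    finally show ?thesis .
  qed
  show "(\<integral>x. pd i \<phi> x *\<^sub>R f x \<partial>lebesgue_on T) = - (\<integral>x. \<phi> x *\<^sub>R g x \<partial>lebesgue_on T)"
    using assms(1) tS by (simp add: weak_pd_def e z pz)
qed

section \<open>Square integrable functions\<close>

lemma L2_cong_AE:
  assumes "L2 M f" "g \<in> borel_measurable M" "AE x in M. f x = g x"
  shows "L2 M g"
proof -
  have "integrable M (\<lambda>x. (norm (g x))\<^sup>2)"
    by (rule integrable_cong_AE_imp[of M "\<lambda>x. (norm (f x))\<^sup>2"]) (use assms in \<open>auto simp: L2_def\<close>)
  with assms(2) show ?thesis by (simp add: L2_def)
qed

lemma L2_bounded_linear:
  fixes h :: "'b::euclidean_space \<Rightarrow> 'c::euclidean_space"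
  assumes "bounded_linear h" "L2 M f"
  shows "L2 M (\<lambda>x. h (f x))"
proof -
  obtain K where K: "\<And>x. norm (h x) \<le> norm x * K" "K \<ge> 0" using bounded_linear.nonneg_bounded[OF assms(1)] by blast
  have m: "f \<in> borel_measurable M" using assms(2) by (simp add: L2_def)
  have mh: "(\<lambda>x. h (f x)) \<in> borel_measurable M"
    using measurable_compose[OF m borel_measurable_continuous_onI[OF linear_continuous_on[OF assms(1)]]] .
  have "integrable M (\<lambda>x. (norm (h (f x)))\<^sup>2)"
  proof (rule Bochner_Integration.integrable_bound)
    show "integrable M (\<lambda>x. K\<^sup>2 * (norm (f x))\<^sup>2)" using assms(2) by (simp add: L2_def)
    have "(norm (h (f x)))\<^sup>2 \<le> K\<^sup>2 * (norm (f x))\<^sup>2" for x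
      using power_mono[OF K(1)[of "f x"], of 2] by (simp add: power_mult_distrib mult.commute)
    then show "AE x in M. norm ((norm (h (f x)))\<^sup>2) \<le> norm (K\<^sup>2 * (norm (f x))\<^sup>2)" by simp
  qed (use mh in simp)
  with mh show ?thesis by (simp add: L2_def)
qed

lemma norm_add_power2_le: "(norm (a + b))\<^sup>2 \<le> 2 * (norm a)\<^sup>2 + 2 * (norm (b::'a::real_normed_vector))\<^sup>2"
proof -
  have "(norm (a + b))\<^sup>2 \<le> (norm a + norm b)\<^sup>2" by (intro power_mono norm_triangle_ineq) simp
  also have "\<dots> \<le> 2 * (norm a)\<^sup>2 + 2 * (norm b)\<^sup>2"
    using sum_squares_bound[of "norm a" "norm b"] by (simp add: power2_sum)
  finally show ?thesis .
qed

lemma L2_add: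
  assumes "L2 M f" "L2 M g"
  shows "L2 M (\<lambda>x. f x + g x)"
proof -
  have m: "(\<lambda>x. f x + g x) \<in> borel_measurable M"
    using assms unfolding L2_def by (intro borel_measurable_add) auto
  have "integrable M (\<lambda>x. (norm (f x + g x))\<^sup>2)"
  proof (rule Bochner_Integration.integrable_bound)
    show "integrable M (\<lambda>x. 2 * (norm (f x))\<^sup>2 + 2 * (norm (g x))\<^sup>2)" using assms by (simp add: L2_def)
    show "AE x in M. norm ((norm (f x + g x))\<^sup>2) \<le> norm (2 * (norm (f x))\<^sup>2 + 2 * (norm (g x))\<^sup>2)"
      by (intro AE_I2) (simp add: norm_add_power2_le)
  qed (use m in simp)
  with m show ?thesis by (simp add: L2_def)
qed

lemma L2_zero: "L2 M (\<lambda>x. 0)" by (simp add: L2_def)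

lemma L2_diff: "L2 M f \<Longrightarrow> L2 M g \<Longrightarrow> L2 M (\<lambda>x. f x - g x)"
  using L2_add[OF _ L2_bounded_linear[OF bounded_linear_minus[OF bounded_linear_ident]], of M f g] by simp

lemma L2_subset:
  fixes f :: "'a::euclidean_space \<Rightarrow> 'b::euclidean_space"
  assumes "L2 (lebesgue_on S) f" "T \<subseteq> S" "S \<in> sets lebesgue" "T \<in> sets lebesgue"
  shows "L2 (lebesgue_on T) f"
proof -
  have m: "f \<in> borel_measurable (lebesgue_on T)"
    using assms(1) unfolding L2_def by (blast intro: measurable_restrict_mono[OF _ assms(2)])
  have "integrable lebesgue (\<lambda>x. indicator S x *\<^sub>R (norm (f x))\<^sup>2)"
    using assms by (intro integrable_restrict_space[THEN iffD1]) (auto simp: L2_def)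
  then have "integrable lebesgue (\<lambda>x. indicator T x *\<^sub>R (indicator S x *\<^sub>R (norm (f x))\<^sup>2))"
    by (rule integrable_mult_indicator[OF assms(4)])
  also have "(\<lambda>x. indicator T x *\<^sub>R (indicator S x *\<^sub>R (norm (f x))\<^sup>2)) = (\<lambda>x. indicator T x *\<^sub>R (norm (f x))\<^sup>2)"
    using assms(2) by (intro ext) (auto simp: indicator_def)
  finally have "integrable (lebesgue_on T) (\<lambda>x. (norm (f x))\<^sup>2)"
    using assms(4) by (subst integrable_restrict_space) auto
  with m show ?thesis by (simp add: L2_def)
qed

text \<open>The bound |f| \<le> |f|^2 + 1 suffices on a set of finite measure.\<close>

lemma L2_integrable_bounded:
  fixes f :: "'a::euclidean_space \<Rightarrow> 'b::euclidean_space"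
  assumes "L2 (lebesgue_on S) f" "bounded S" "S \<in> sets lebesgue"
  shows "integrable (lebesgue_on S) f"
proof (rule Bochner_Integration.integrable_bound)
  have "integrable (lebesgue_on S) (\<lambda>x. 1 :: real)"
    using assms by (intro finite_measure.integrable_const finite_measure_lebesgue_on bounded_set_imp_lmeasurable)
  then show "integrable (lebesgue_on S) (\<lambda>x. (norm (f x))\<^sup>2 + 1)" using assms(1) by (simp add: L2_def)
  show "f \<in> borel_measurable (lebesgue_on S)" using assms(1) by (simp add: L2_def)
  have "norm (f x) \<le> (norm (f x))\<^sup>2 + 1" for x
    using sum_squares_bound[of "norm (f x)" 1] norm_ge_zero[of "f x"]
    unfolding power_one mult_1_right by linarith
  then show "AE x in lebesgue_on S. norm (f x) \<le> norm ((norm (f x))\<^sup>2 + 1)" by simp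
qed

lemma L2_integrable_cbox:
  fixes f :: "'a::euclidean_space \<Rightarrow> 'b::euclidean_space"
  assumes "L2 (lebesgue_on S) f" "cbox a b \<subseteq> S" "S \<in> sets lebesgue"
  shows "set_integrable lebesgue (cbox a b) f"
  using L2_integrable_bounded[OF L2_subset[OF assms] bounded_cbox]
  by (simp add: set_integrable_def integrable_restrict_space)

section \<open>Classical functions with square integrable derivatives\<close>

lemma continuous_on_measurable_lebesgue_on:
  "continuous_on S f \<Longrightarrow> open S \<Longrightarrow> f \<in> borel_measurable (lebesgue_on S)"
  by (rule continuous_imp_measurable_on_sets_lebesgue) auto

text \<open>The intersection of H^k and C^k, phrased with classical derivatives throughout, so that
  no choice of weak derivatives has to be carried along.\<close>

primrec H_reg :: "nat \<Rightarrow> (real^'n::finite) set \<Rightarrow> (real^'n \<Rightarrow> 'b::euclidean_space) \<Rightarrow> bool" where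
  "H_reg 0 S f \<longleftrightarrow> continuous_on S f \<and> L2 (lebesgue_on S) f"
| "H_reg (Suc k) S f \<longleftrightarrow> (\<forall>x\<in>S. f differentiable (at x)) \<and> L2 (lebesgue_on S) f \<and> (\<forall>i. H_reg k S (pd i f))"

lemma H_reg_L2: "H_reg k S f \<Longrightarrow> L2 (lebesgue_on S) f"
  by (cases k) auto

lemma H_reg_Ck: "H_reg k S f \<Longrightarrow> Ck_on k S f"
  by (induction k arbitrary: f) auto

lemma H_reg_pd: "H_reg (Suc k) S f \<Longrightarrow> H_reg k S (pd i f)"
  by simp

lemma H_reg_lower: "H_reg (Suc k) S f \<Longrightarrow> H_reg k S f"
proof (induction k arbitrary: f)
  case 0
  then show ?case
    by (auto intro!: continuous_at_imp_continuous_on differentiable_imp_continuous_within)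
next
  case (Suc k)
  have "H_reg k S (pd i f)" for i using Suc.prems by (intro Suc.IH) simp
  with Suc.prems show ?case by simp
qed

lemma H_reg_cong:
  assumes "open S" "\<And>x. x \<in> S \<Longrightarrow> f x = g x" "H_reg k S f"
  shows "H_reg k S g"
  using assms(2,3)
proof (induction k arbitrary: f g)
  case 0
  have "L2 (lebesgue_on S) g"
  proof (rule L2_cong_AE)
    show "g \<in> borel_measurable (lebesgue_on S)"
      using 0 by (subst measurable_cong[of _ g f]) (auto simp: L2_def)
  qed (use 0 in auto)
  with 0 show ?case by (auto cong: continuous_on_cong)
next
  case (Suc k)
  have "g differentiable (at x)" if "x \<in> S" for x
    using Suc.prems that differentiable_transform_open[OF _ assms(1) that, of f g] by auto
  moreover have "H_reg k S (pd i g)" for i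
  proof (rule Suc.IH)
    show "pd i f x = pd i g x" if "x \<in> S" for x
      by (rule pd_transform[OF assms(1) that Suc.prems(1)])
  qed (use Suc.prems(2) in simp)
  moreover have "L2 (lebesgue_on S) g"
  proof (rule L2_cong_AE)
    show "g \<in> borel_measurable (lebesgue_on S)"
      using Suc.prems by (subst measurable_cong[of _ g f]) (auto simp: L2_def)
  qed (use Suc.prems in auto)
  ultimately show ?case by simp
qed

lemma H_reg_subset: "H_reg k S f \<Longrightarrow> T \<subseteq> S \<Longrightarrow> open S \<Longrightarrow> open T \<Longrightarrow> H_reg k T f"
proof (induction k arbitrary: f)
  case 0
  then show ?case using L2_subset[of S f T] by (auto intro: continuous_on_subset)
next
  case (Suc k)
  then show ?case using L2_subset[of S f T] by auto
qed

lemma H_reg_add: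
  assumes "open S" "H_reg k S f" "H_reg k S g"
  shows "H_reg k S (\<lambda>x. f x + g x)"
  using assms(2,3)
proof (induction k arbitrary: f g)
  case 0
  then show ?case by (auto intro: continuous_intros L2_add)
next
  case (Suc k)
  have "H_reg k S (pd i (\<lambda>x. f x + g x))" for i
    by (rule H_reg_cong[OF assms(1) _ Suc.IH[of "pd i f" "pd i g"]])
       (use Suc.prems in \<open>auto simp: pd_add\<close>)
  with Suc.prems show ?case by (auto intro: L2_add)
qed

lemma H_reg_bounded_linear:
  fixes h :: "'b::euclidean_space \<Rightarrow> 'c::euclidean_space"
  assumes "open S" "bounded_linear h" "H_reg k S f"
  shows "H_reg k S (\<lambda>x. h (f x))"
  using assms(3)
proof (induction k arbitrary: f)
  case 0
  then show ?case using bounded_linear.continuous_on[OF assms(2)] L2_bounded_linear[OF assms(2)] by auto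
next
  case (Suc k)
  have "H_reg k S (pd i (\<lambda>x. h (f x)))" for i
    by (rule H_reg_cong[OF assms(1) _ Suc.IH[of "pd i f"]])
       (use Suc.prems assms(2) in \<open>auto simp: pd_bounded_linear\<close>)
  moreover have "(\<lambda>x. h (f x)) differentiable (at x)" if "x \<in> S" for x
    using Suc.prems that unfolding differentiable_def H_reg.simps
    by (blast intro: bounded_linear.has_derivative[OF assms(2)])
  moreover have "L2 (lebesgue_on S) (\<lambda>x. h (f x))"
    by (rule L2_bounded_linear[OF assms(2)]) (use Suc.prems in simp)
  ultimately show ?case by simp
qed

lemma H_reg_zero: "H_reg k S (\<lambda>x. 0)"
  by (induction k) (auto simp: L2_zero)

lemma H_reg_sum:
  assumes "open S" "finite I" "\<And>i. i \<in> I \<Longrightarrow> H_reg k S (f i)"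
  shows "H_reg k S (\<lambda>x. \<Sum>i\<in>I. f i x)"
  using assms(2,3)
  by (induction I) (auto intro: H_reg_add[OF assms(1)] H_reg_zero)

lemma sobolev_L2: "sobolev k S f \<Longrightarrow> L2 (lebesgue_on S) f"
  by (cases k) auto

lemma sobolev_cong_AE:
  assumes S: "open S" and "sobolev k S f" "g \<in> borel_measurable (lebesgue_on S)" "AE x in lebesgue_on S. f x = g x"
  shows "sobolev k S g"
proof -
  have L: "L2 (lebesgue_on S) g" using L2_cong_AE[OF sobolev_L2] assms by blast
  show ?thesis
  proof (cases k)
    case 0 then show ?thesis using L by simp
  next
    case (Suc j)
    have W: "weak_pd S i g h" if h: "weak_pd S i f h" for i h
      unfolding weak_pd_def
    proof (intro allI impI)
      fix \<phi> assume t: "test_function S \<phi>"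
      then have C: "Ck_on 1 UNIV \<phi>" unfolding test_function_def smooth_on_def by blast
      then have "pd i \<phi> \<in> borel_measurable lebesgue"
        by (intro measurable_completion) (simp add: borel_measurable_continuous_onI)
      then have m: "pd i \<phi> \<in> borel_measurable (lebesgue_on S)" by (rule measurable_restrict_space1)
      have "(\<integral>x. pd i \<phi> x *\<^sub>R g x \<partial>lebesgue_on S) = (\<integral>x. pd i \<phi> x *\<^sub>R f x \<partial>lebesgue_on S)"
        using assms(3,4) sobolev_L2[OF assms(2)] m by (intro integral_cong_AE) (auto simp: L2_def)
      then show "(\<integral>x. pd i \<phi> x *\<^sub>R g x \<partial>lebesgue_on S) = - (\<integral>x. \<phi> x *\<^sub>R h x \<partial>lebesgue_on S)"
        using h t by (simp add: weak_pd_def)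
    qed
    show ?thesis using assms(2) L W unfolding Suc sobolev.simps by blast
  qed
qed

text \<open>By \<open>weak_pd_unique\<close> the weak derivative supplied at each order is almost
  everywhere the classical one, so the induction can continue with \<open>pd i f\<close> in its
  place.\<close>

lemma sobolev_imp_H_reg:
  fixes f :: "real^3 \<Rightarrow> 'b::euclidean_space"
  assumes S: "open S" and "sobolev k S f" "Ck_on k S f"
  shows "H_reg k S f"
  using assms(2,3)
proof (induction k arbitrary: f)
  case 0
  then show ?case by simp
next
  case (Suc k)
  have "H_reg k S (pd i f)" for i
  proof -
    obtain g where g: "weak_pd S i f g" "sobolev k S g" using Suc.prems(1) by auto
    have C1: "Ck_on 1 S f" using Suc.prems(2) Ck_on_le[of "Suc k" S f 1] by simp
    have "AE x in lebesgue_on S. g x = pd i f x"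
      by (rule weak_pd_unique[OF S C1 g(1) L2_integrable_cbox[OF sobolev_L2[OF g(2)]]]) (use S in auto)
    moreover have "pd i f \<in> borel_measurable (lebesgue_on S)"
      using C1 by (intro continuous_on_measurable_lebesgue_on S) simp
    ultimately have "sobolev k S (pd i f)" using sobolev_cong_AE[OF S g(2)] by blast
    then show ?thesis using Suc.IH Suc.prems(2) by simp
  qed
  then show ?case using Suc.prems by simp
qed


section \<open>Limits along normal lines\<close>

lemma prod_Basis_cart: "(\<Prod>b\<in>Basis. (v::real^'n::finite) \<bullet> b) = (\<Prod>i\<in>UNIV. v $ i)"
proof -
  have B: "(Basis :: (real^'n) set) = range (\<lambda>i. axis i 1)" by (auto simp: Basis_vec_def)
  have "inj (\<lambda>i. axis i (1::real) :: real^'n)" by (auto simp: inj_on_def axis_eq_axis)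
  then show ?thesis unfolding B by (subst prod.reindex) (auto simp: inner_axis)
qed

text \<open>Separates the two parameters of a plane from the height above it, so that Fubini's
  theorem can integrate over the height alone.\<close>

definition join3 :: "(real^2) \<times> real \<Rightarrow> real^3" where
  "join3 p = vector [fst p $ 1, fst p $ 2, snd p]"

lemma join3_nth [simp]: "join3 p $ 1 = fst p $ 1" "join3 p $ 2 = fst p $ 2" "join3 p $ 3 = snd p"
  by (simp_all add: join3_def)

lemma linear_join3: "linear join3"
  by (rule linearI) (auto simp: vec_eq_iff forall_3)

lemma continuous_on_linear:
  fixes L :: "'a::euclidean_space \<Rightarrow> 'b::euclidean_space"
  assumes "linear L" "continuous_on S f"
  shows "continuous_on S (\<lambda>x. L (f x))"
  using bounded_linear.continuous_on[OF linear_conv_bounded_linear[THEN iffD1, OF assms(1)] assms(2)] .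

lemma borel_measurable_linear:
  fixes L :: "'a::euclidean_space \<Rightarrow> 'b::euclidean_space"
  shows "linear L \<Longrightarrow> L \<in> borel_measurable borel"
  by (rule borel_measurable_continuous_onI, rule continuous_on_linear[OF _ continuous_on_id])

text \<open>Lebesgue measure is determined by the volumes of boxes, and the preimage of a box is the
  product of a plane box and an interval.\<close>

lemma lborel_distr_join3: "distr lborel borel join3 = lborel"
proof (rule lborel_eqI[symmetric])
  have m: "join3 \<in> borel_measurable borel" by (rule borel_measurable_linear[OF linear_join3])
  fix l u :: "real^3" assume le: "\<And>b. b \<in> Basis \<Longrightarrow> l \<bullet> b \<le> u \<bullet> b"
  have le': "l $ i \<le> u $ i" for i using le[of "axis i 1"] by (auto simp: Basis_vec_def inner_axis)
  define l2 u2 where "l2 = (vector [l$1, l$2] :: real^2)" and "u2 = (vector [u$1, u$2] :: real^2)"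
  have pre: "join3 -` box l u = box l2 u2 \<times> box (l$3) (u$3)"
    by (auto simp: mem_box_cart forall_3 forall_2 l2_def u2_def)
  have b2: "emeasure lborel (box l2 u2) = ennreal ((u$1 - l$1) * (u$2 - l$2))"
  proof -
    have "emeasure lborel (box l2 u2) = ennreal (\<Prod>b\<in>Basis. (u2 - l2) \<bullet> b)"
    proof (rule emeasure_lborel_box)
      fix b :: "real^2" assume "b \<in> Basis"
      then obtain i where "b = axis i 1" by (auto simp: Basis_vec_def)
      then show "l2 \<bullet> b \<le> u2 \<bullet> b" using le' exhaust_2[of i] by (auto simp: inner_axis l2_def u2_def)
    qed
    then show ?thesis unfolding prod_Basis_cart UNIV_2 by (simp add: l2_def u2_def)
  qed
  have "emeasure (distr lborel borel join3) (box l u) = emeasure lborel (box l2 u2 \<times> box (l$3) (u$3))"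
    using m pre by (subst emeasure_distr) auto
  also have "\<dots> = emeasure lborel (box l2 u2) * emeasure lborel (box (l$3) (u$3))"
    unfolding lborel_prod[symmetric] by (rule lborel.emeasure_pair_measure_Times) auto
  also have "emeasure lborel (box (l$3) (u$3)) = ennreal (u$3 - l$3)"
    using emeasure_lborel_box[of "l$3" "u$3"] le'[of 3] by simp
  also have "emeasure lborel (box l2 u2) * ennreal (u$3 - l$3) = ennreal ((u$1 - l$1) * (u$2 - l$2) * (u$3 - l$3))"
    unfolding b2 by (rule ennreal_mult''[symmetric]) (use le'[of 3] in simp)
  also have "\<dots> = ennreal (\<Prod>b\<in>Basis. (u - l) \<bullet> b)" unfolding prod_Basis_cart UNIV_3 by (simp add: mult.assoc)
  finally show "emeasure (distr lborel borel join3) (box l u) = ennreal (\<Prod>b\<in>Basis. (u - l) \<bullet> b)" .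
qed simp

text \<open>The same criterion: the preimage of a box is its image under the inverse orthogonal map,
  which preserves Lebesgue measure.\<close>

lemma lborel_distr_orthogonal:
  fixes Q :: "real^'n::{finite,wellorder} \<Rightarrow> real^'n::_"
  assumes "orthogonal_transformation Q"
  shows "distr lborel borel Q = lborel"
proof (rule lborel_eqI[symmetric])
  have lin: "linear Q" using assms by (rule orthogonal_transformation_linear)
  have m: "Q \<in> borel_measurable borel" by (rule borel_measurable_linear[OF lin])
  have inv: "orthogonal_transformation (inv Q)" by (rule orthogonal_transformation_inv[OF assms])
  have bij: "bij Q" by (rule orthogonal_transformation_bij[OF assms])
  fix l u :: "real^'n::_" assume le: "\<And>b. b \<in> Basis \<Longrightarrow> l \<bullet> b \<le> u \<bullet> b"
  have eq: "Q -` box l u = inv Q ` box l u" by (rule bij_vimage_eq_inv_image[OF bij])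
  have b: "Q -` box l u \<in> sets borel" using m by (simp add: measurable_sets_borel)
  have lm: "inv Q ` box l u \<in> lmeasurable" by (rule measurable_orthogonal_image[OF inv]) simp
  have "emeasure (distr lborel borel Q) (box l u) = emeasure lborel (Q -` box l u)"
    using m by (subst emeasure_distr) auto
  also have "\<dots> = emeasure lebesgue (Q -` box l u)" using b by simp
  also have "\<dots> = ennreal (measure lebesgue (inv Q ` box l u))"
    unfolding eq using lm by (simp add: emeasure_eq_measure2)
  also have "measure lebesgue (inv Q ` box l u) = measure lebesgue (box l u)"
    by (rule measure_orthogonal_image[OF inv]) simp
  also have "ennreal (measure lebesgue (box l u)) = emeasure lborel (box l u)"
    by (simp add: emeasure_eq_measure2 measure_completion)
  also have "\<dots> = ennreal (\<Prod>b\<in>Basis. (u - l) \<bullet> b)" using le by (rule emeasure_lborel_box)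
  finally show "emeasure (distr lborel borel Q) (box l u) = ennreal (\<Prod>b\<in>Basis. (u - l) \<bullet> b)" .
qed simp

text \<open>A plane is written as the graph of 0, so that a flat disc is literally a patch in the
  sense of \<open>C21_patch\<close>.\<close>

abbreviation plane_pt :: "real^3 \<Rightarrow> (real^3 \<Rightarrow> real^3) \<Rightarrow> real^2 \<Rightarrow> real^3" where
  "plane_pt x Q \<equiv> graph_map x Q (\<lambda>_. 0)"

lemma plane_pt_eq: "plane_pt x Q y = x + Q (join3 (y, 0))"
  by (simp add: graph_map_def join3_def)

lemma plane_pt_add:
  assumes "linear Q"
  shows "plane_pt x Q y + s *\<^sub>R Q (axis 3 1) = x + Q (join3 (y, s))"
proof -
  have "join3 (y, s) = join3 (y, 0) + s *\<^sub>R axis 3 1" by (simp add: vec_eq_iff forall_3 axis_def)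
  then show ?thesis by (simp add: plane_pt_eq linear_add[OF assms] linear_cmul[OF assms])
qed

lemma continuous_on_plane_pt: "linear Q \<Longrightarrow> continuous_on S (plane_pt x Q)"
  unfolding plane_pt_eq[abs_def]
  by (rule continuous_on_add[OF continuous_on_const], erule continuous_on_linear,
      rule continuous_on_linear[OF linear_join3], intro continuous_intros)

lemma nn_integral_plane_coordinates:
  assumes Q: "orthogonal_transformation Q" and u: "u \<in> borel_measurable borel"
  shows "(\<integral>\<^sup>+ z. u z \<partial>lborel) = (\<integral>\<^sup>+ y. \<integral>\<^sup>+ s. u (plane_pt x Q y + s *\<^sub>R Q (axis 3 1)) \<partial>lborel \<partial>lborel)"
proof -
  have lin: "linear Q" using Q by (rule orthogonal_transformation_linear)
  note mQ = borel_measurable_linear[OF lin] and mJ = borel_measurable_linear[OF linear_join3]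
  have "(\<integral>\<^sup>+ z. u z \<partial>lborel) = (\<integral>\<^sup>+ z. u z \<partial>distr lborel borel ((+) x))" by (simp add: lborel_distr_plus)
  also have "\<dots> = (\<integral>\<^sup>+ z. u (x + z) \<partial>lborel)"
    using u by (subst nn_integral_distr) auto
  also have "\<dots> = (\<integral>\<^sup>+ z. u (x + z) \<partial>distr lborel borel Q)" by (simp add: lborel_distr_orthogonal[OF Q])
  also have "\<dots> = (\<integral>\<^sup>+ z. u (x + Q z) \<partial>lborel)"
    using u mQ by (subst nn_integral_distr) auto
  also have "\<dots> = (\<integral>\<^sup>+ z. u (x + Q z) \<partial>distr lborel borel join3)" by (simp add: lborel_distr_join3)
  also have "\<dots> = (\<integral>\<^sup>+ p. u (x + Q (join3 p)) \<partial>lborel)"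
    using u mQ mJ by (subst nn_integral_distr) auto
  also have "\<dots> = (\<integral>\<^sup>+ p. u (x + Q (join3 p)) \<partial>(lborel \<Otimes>\<^sub>M lborel))" by (simp add: lborel_prod)
  also have "\<dots> = (\<integral>\<^sup>+ y. \<integral>\<^sup>+ s. u (x + Q (join3 (y, s))) \<partial>lborel \<partial>lborel)"
  proof (rule lborel.nn_integral_fst[symmetric])
    have "(\<lambda>p. u (x + Q (join3 p))) \<in> borel_measurable borel"
      using u mQ mJ by measurable
    then show "(\<lambda>p. u (x + Q (join3 p))) \<in> borel_measurable (lborel \<Otimes>\<^sub>M lborel)"
      unfolding lborel_prod by (simp add: measurable_cong_sets[OF sets_lborel refl])
  qed
  finally show ?thesis by (simp add: plane_pt_add[OF lin])
qed

lemma measurable_plane_coordinates: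
  assumes "linear Q" "u \<in> borel_measurable borel"
  shows "(\<lambda>(y, s). u (plane_pt x Q y + s *\<^sub>R Q (axis 3 1))) \<in> borel_measurable (borel \<Otimes>\<^sub>M borel)"
proof -
  note mQ = borel_measurable_linear[OF assms(1)] and mJ = borel_measurable_linear[OF linear_join3]
  have "(\<lambda>p. u (x + Q (join3 p))) \<in> borel_measurable borel" using assms(2) mQ mJ by measurable
  moreover have "(\<lambda>p. u (x + Q (join3 p))) = (\<lambda>(y, s). u (x + Q (join3 (y, s))))" by auto
  ultimately show ?thesis by (simp only: plane_pt_add[OF assms(1)] borel_prod)
qed

text \<open>The increment is the integral of \<open>h\<close> over [s, t]; Cauchy-Schwarz against
  the indicator of this interval yields the factor t - s.\<close>

lemma power2_norm_increment_le:
  fixes g h :: "real \<Rightarrow> 'b::euclidean_space"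
  assumes st: "s \<le> t" and d: "\<And>r. r \<in> {s..t} \<Longrightarrow> (g has_vector_derivative h r) (at r)" and c: "continuous_on {s..t} h"
  shows "ennreal ((norm (g t - g s))\<^sup>2) \<le> ennreal (t - s) * (\<integral>\<^sup>+ r. indicator {s..t} r * ennreal ((norm (h r))\<^sup>2) \<partial>lborel)"
proof -
  have hb: "has_bochner_integral lborel (\<lambda>r. indicator {s..t} r *\<^sub>R h r) (g t - g s)"
    using st c d by (intro has_bochner_integral_FTC_Icc) (auto intro: has_vector_derivative_at_within)
  let ?w = "\<lambda>r. indicator {s..t} r *\<^sub>R h r"
  have m: "?w \<in> borel_measurable lborel" using hb by (auto simp: has_bochner_integral_iff)
  have "ennreal (norm (g t - g s)) \<le> (\<integral>\<^sup>+ r. ennreal (norm (?w r)) \<partial>lborel)"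
    using integral_norm_bound_ennreal[of lborel ?w] hb by (auto simp: has_bochner_integral_iff)
  also have "\<dots> = (\<integral>\<^sup>+ r. indicator {s..t} r * ennreal (norm (?w r)) \<partial>lborel)"
    by (intro nn_integral_cong) (auto simp: indicator_def)
  finally have "(ennreal (norm (g t - g s)))\<^sup>2 \<le> (\<integral>\<^sup>+ r. indicator {s..t} r * ennreal (norm (?w r)) \<partial>lborel)\<^sup>2"
    by (intro power_mono) auto
  also have "\<dots> \<le> (\<integral>\<^sup>+ r. (indicator {s..t} r)\<^sup>2 \<partial>lborel) * (\<integral>\<^sup>+ r. (ennreal (norm (?w r)))\<^sup>2 \<partial>lborel)"
  proof (rule Cauchy_Schwarz_nn_integral)
    show "(\<lambda>r. ennreal (norm (?w r))) \<in> borel_measurable lborel"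
      by (rule measurable_compose[OF measurable_compose[OF m borel_measurable_norm] measurable_ennreal])
  qed simp
  also have "(\<integral>\<^sup>+ r. (indicator {s..t} r)\<^sup>2 \<partial>lborel) = (\<integral>\<^sup>+ r. indicator {s..t} r \<partial>lborel)"
    by (intro nn_integral_cong) (auto simp: indicator_def)
  also have "\<dots> = ennreal (t - s)" using st by simp
  also have "(\<integral>\<^sup>+ r. (ennreal (norm (?w r)))\<^sup>2 \<partial>lborel) = (\<integral>\<^sup>+ r. indicator {s..t} r * ennreal ((norm (h r))\<^sup>2) \<partial>lborel)"
    by (intro nn_integral_cong) (auto simp: indicator_def ennreal_power)
  finally show ?thesis by (simp add: ennreal_power)
qed

text \<open>By the increment estimate \<open>g\<close> is Hoelder continuous of order 1/2, hence
  Cauchy at the endpoint. The majorant \<open>w\<close> and its total integral \<open>I\<close> let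
  one bound serve all subintervals.\<close>

lemma has_limit_at_endpoint:
  fixes g h :: "real \<Rightarrow> 'b::euclidean_space"
  assumes d: "\<And>r. r \<in> {0<..<\<tau>} \<Longrightarrow> (g has_vector_derivative h r) (at r)" and c: "continuous_on {0<..<\<tau>} h"
    and I: "\<And>r. r \<in> {0<..<\<tau>} \<Longrightarrow> ennreal ((norm (h r))\<^sup>2) \<le> w r" "(\<integral>\<^sup>+ r. w r \<partial>lborel) = I" "I < \<infinity>" and \<tau>: "\<tau> > 0"
  obtains L where "(g \<longlongrightarrow> L) (at_right 0)"
    "\<And>s. s \<in> {0<..<\<tau>} \<Longrightarrow> ennreal ((norm (g s - L))\<^sup>2) \<le> ennreal s * I"
proof -
  have inc: "ennreal ((norm (g t - g s))\<^sup>2) \<le> ennreal (t - s) * I" if "0 < s" "s \<le> t" "t < \<tau>" for s t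
  proof -
    have "ennreal ((norm (g t - g s))\<^sup>2) \<le> ennreal (t - s) * (\<integral>\<^sup>+ r. indicator {s..t} r * ennreal ((norm (h r))\<^sup>2) \<partial>lborel)"
      using that d by (intro power2_norm_increment_le) (auto intro: continuous_on_subset[OF c])
    also have "\<dots> \<le> ennreal (t - s) * I"
      unfolding I(2)[symmetric]
      using that I(1) by (intro mult_left_mono nn_integral_mono) (auto simp: indicator_def)
    finally show ?thesis .
  qed
  obtain J where J: "I = ennreal J" "J \<ge> 0" using I(3) by (cases I) auto
  have incr: "(norm (g t - g s))\<^sup>2 \<le> (t - s) * J" if "0 < s" "s \<le> t" "t < \<tau>" for s t
    using inc[OF that] J that by (simp add: ennreal_mult'[symmetric])
  have incr': "(norm (g t - g s))\<^sup>2 \<le> max s t * J" if "0 < s" "s < \<tau>" "0 < t" "t < \<tau>" for s t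
  proof (cases "s \<le> t")
    case True
    have "(t - s) * J \<le> max s t * J" using that J True by (intro mult_right_mono) auto
    then show ?thesis using incr[of s t] that True by linarith
  next
    case False
    have "(s - t) * J \<le> max s t * J" using that J False by (intro mult_right_mono) auto
    then show ?thesis using incr[of t s] that False by (simp add: norm_minus_commute)
  qed
  \<comment> \<open>Some sequence in the open interval tending to 0; starting at \<tau>/2 keeps it
    inside.\<close>
  define a where "a k = \<tau> / 2 * inverse (real (Suc k))" for k
  have a: "0 < a k" "a k < \<tau>" for k
  proof -
    show "0 < a k" using \<tau> by (simp add: a_def)
    have "a k \<le> \<tau> / 2 * 1" unfolding a_def using \<tau> by (intro mult_left_mono) (auto simp: field_simps)
    then show "a k < \<tau>" using \<tau> by simp
  qed
  have a0: "a \<longlonglongrightarrow> 0" unfolding a_def[abs_def] using tendsto_mult[OF tendsto_const LIMSEQ_inverse_real_of_nat, of "\<tau>/2"] by simp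
  have "Cauchy (\<lambda>k. g (a k))"
  proof (rule metric_CauchyI)
    fix e :: real assume e: "e > 0"
    have "(\<lambda>k. a k * J) \<longlonglongrightarrow> 0" using tendsto_mult[OF a0 tendsto_const, of J] by simp
    then have "\<forall>\<^sub>F k in sequentially. a k * J < e\<^sup>2" using e by (intro order_tendstoD(2)) auto
    then obtain M where M: "\<And>k. k \<ge> M \<Longrightarrow> a k * J < e\<^sup>2" by (auto simp: eventually_sequentially)
    show "\<exists>M. \<forall>m\<ge>M. \<forall>n\<ge>M. dist (g (a m)) (g (a n)) < e"
    proof (intro exI[of _ M] allI impI)
      fix m n assume "m \<ge> M" "n \<ge> M"
      then have "max (a n) (a m) * J < e\<^sup>2" using M by (simp add: max_def)
      then have "(norm (g (a m) - g (a n)))\<^sup>2 < e\<^sup>2" using incr'[of "a n" "a m"] a by (meson order_le_less_trans)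
      then show "dist (g (a m)) (g (a n)) < e" using e by (simp add: dist_norm power_less_imp_less_base)
    qed
  qed
  then obtain L where L: "(\<lambda>k. g (a k)) \<longlonglongrightarrow> L" using Cauchy_convergent_iff convergent_def by blast
  have bd: "(norm (g s - L))\<^sup>2 \<le> s * J" if s: "s \<in> {0<..<\<tau>}" for s
  proof (rule tendsto_le)
    show "(\<lambda>k. (norm (g s - g (a k)))\<^sup>2) \<longlonglongrightarrow> (norm (g s - L))\<^sup>2" by (intro tendsto_intros L)
    show "(\<lambda>k. max (a k) s * J) \<longlonglongrightarrow> s * J"
      using tendsto_mult[OF tendsto_max[OF a0 tendsto_const[of s]] tendsto_const[of J]] s by simp
    show "\<forall>\<^sub>F k in sequentially. (norm (g s - g (a k)))\<^sup>2 \<le> max (a k) s * J"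
      using incr' a s by (auto intro!: always_eventually)
  qed simp
  have "(g \<longlongrightarrow> L) (at_right 0)"
  proof (rule LIM_zero_cancel, rule tendsto_norm_zero_cancel)
    have "((\<lambda>s. sqrt (s * J)) \<longlongrightarrow> sqrt (0 * J)) (at_right 0)"
      by (intro tendsto_intros)
    then have lim: "((\<lambda>s. sqrt (s * J)) \<longlongrightarrow> 0) (at_right 0)" by simp
    show "((\<lambda>s. norm (g s - L)) \<longlongrightarrow> 0) (at_right 0)"
    proof (rule tendsto_sandwich[OF _ _ tendsto_const lim])
      show "\<forall>\<^sub>F s in at_right 0. norm (g s - L) \<le> sqrt (s * J)"
        unfolding eventually_at_right_field using \<tau> bd by (intro exI[of _ \<tau>]) (auto intro!: real_le_rsqrt)
    qed simp
  qed
  moreover have "ennreal ((norm (g s - L))\<^sup>2) \<le> ennreal s * I" if "s \<in> {0<..<\<tau>}" for s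
    using bd[OF that] that J by (simp add: ennreal_mult'[symmetric])
  ultimately show ?thesis by (rule that)
qed

section \<open>Normal limits and the trace inequality\<close>

lemma nn_integral_L2:
  fixes f :: "'a::euclidean_space \<Rightarrow> 'b::euclidean_space"
  assumes "L2 (lebesgue_on S) f" "S \<in> sets lebesgue"
  shows "(\<integral>\<^sup>+ z. indicator S z * ennreal ((norm (f z))\<^sup>2) \<partial>lborel) = ennreal (\<integral>z. (norm (f z))\<^sup>2 \<partial>lebesgue_on S)"
proof -
  have "(\<integral>\<^sup>+ z. indicator S z * ennreal ((norm (f z))\<^sup>2) \<partial>lborel) = (\<integral>\<^sup>+ z. ennreal ((norm (f z))\<^sup>2) * indicator S z \<partial>lebesgue)"
    by (simp add: nn_integral_completion mult.commute)
  also have "\<dots> = (\<integral>\<^sup>+ z. ennreal ((norm (f z))\<^sup>2) \<partial>lebesgue_on S)"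
    using assms(2) by (intro nn_integral_restrict_space[symmetric]) simp
  also have "\<dots> = ennreal (\<integral>z. (norm (f z))\<^sup>2 \<partial>lebesgue_on S)"
    using assms(1) by (intro nn_integral_eq_integral) (auto simp: L2_def)
  finally show ?thesis .
qed

definition dir_deriv :: "real^'n::finite \<Rightarrow> (real^'n \<Rightarrow> 'b::real_normed_vector) \<Rightarrow> real^'n \<Rightarrow> 'b" where
  "dir_deriv v f z = (\<Sum>i\<in>UNIV. v$i *\<^sub>R pd i f z)"

lemma H_reg_dir_deriv:
  "open S \<Longrightarrow> H_reg (Suc k) S f \<Longrightarrow> H_reg k S (dir_deriv v f)"
  unfolding dir_deriv_def[abs_def]
  by (intro H_reg_sum finite_UNIV H_reg_bounded_linear[OF _ bounded_linear_scaleR_right]) auto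

text \<open>Taken along one fixed sequence of heights: this gives a definite function, measurable as
  a limit of measurable ones, whether or not the full one-sided limit exists.\<close>

definition normal_limit :: "real^3 \<Rightarrow> (real^3 \<Rightarrow> 'b::euclidean_space) \<Rightarrow> real^3 \<Rightarrow> 'b" where
  "normal_limit n f z = lim (\<lambda>k. f (z + inverse (real (Suc k)) *\<^sub>R n))"

lemma borel_measurable_indicator_open:
  fixes f :: "'a::euclidean_space \<Rightarrow> 'b::euclidean_space"
  assumes "open S" "continuous_on S f"
  shows "(\<lambda>z. indicator S z * ennreal ((norm (f z))\<^sup>2)) \<in> borel_measurable borel"
proof -
  have "(\<lambda>z. indicator S z *\<^sub>R f z) \<in> borel_measurable borel"
    using assms by (intro borel_measurable_continuous_on_indicator) auto
  then have "(\<lambda>z. ennreal ((norm (indicator S z *\<^sub>R f z))\<^sup>2)) \<in> borel_measurable borel" by measurable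
  also have "(\<lambda>z. ennreal ((norm (indicator S z *\<^sub>R f z))\<^sup>2)) = (\<lambda>z. indicator S z * ennreal ((norm (f z))\<^sup>2))"
    by (intro ext) (auto simp: indicator_def)
  finally show ?thesis .
qed

text \<open>By Fubini the squared normal derivative has finite integral along almost every normal
  line; \<open>has_limit_at_endpoint\<close> applies there, and its bound is integrated over the
  parameter set \<open>D\<close>. The third claim is the trace inequality: the limit is controlled
  by \<open>f\<close> and its normal derivative on a cylinder of height \<tau>.\<close>

lemma normal_limit_estimates:
  fixes f :: "real^3 \<Rightarrow> 'b::euclidean_space"
  assumes S: "open S" and f: "H_reg 1 S f" and Q: "orthogonal_transformation Q" and n: "n = Q (axis 3 1)"
    and \<tau>: "\<tau> > 0" and cyl: "\<And>y s. y \<in> D \<Longrightarrow> 0 < s \<Longrightarrow> s < \<tau> \<Longrightarrow> plane_pt x Q y + s *\<^sub>R n \<in> S"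
    and D: "D \<in> sets borel"
  defines "A \<equiv> \<integral>z. (norm (f z))\<^sup>2 \<partial>lebesgue_on S" and "B \<equiv> \<integral>z. (norm (dir_deriv n f z))\<^sup>2 \<partial>lebesgue_on S"
  shows "AE y in lborel. y \<in> D \<longrightarrow> (\<lambda>k. f (plane_pt x Q y + inverse (real (Suc k)) *\<^sub>R n)) \<longlonglongrightarrow> normal_limit n f (plane_pt x Q y)" (is ?a)
    and "\<And>s. 0 < s \<Longrightarrow> s < \<tau> \<Longrightarrow>
      (\<integral>\<^sup>+ y. indicator D y * ennreal ((norm (f (plane_pt x Q y + s *\<^sub>R n) - normal_limit n f (plane_pt x Q y)))\<^sup>2) \<partial>lborel) \<le> ennreal (s * B)" (is "\<And>s. _ \<Longrightarrow> _ \<Longrightarrow> ?b s")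
    and "(\<integral>\<^sup>+ y. indicator D y * ennreal ((norm (normal_limit n f (plane_pt x Q y)))\<^sup>2) \<partial>lborel) \<le> ennreal (2 / \<tau> * A + 2 * \<tau> * B)" (is ?c)
proof -
  have lin: "linear Q" using Q by (rule orthogonal_transformation_linear)
  have sS: "S \<in> sets lebesgue" using S by auto
  let ?P = "plane_pt x Q"
  define W where "W z = indicator S z * ennreal ((norm (f z))\<^sup>2)" for z
  define U where "U z = indicator S z * ennreal ((norm (dir_deriv n f z))\<^sup>2)" for z
  have d0: "H_reg 0 S (dir_deriv n f)" using H_reg_dir_deriv[OF S, of 0 f n] f by simp
  have Wm: "W \<in> borel_measurable borel" unfolding W_def[abs_def]
    by (rule borel_measurable_indicator_open[OF S Ck_on_continuous[OF H_reg_Ck[OF f]]])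
  have Um: "U \<in> borel_measurable borel" unfolding U_def[abs_def]
    by (rule borel_measurable_indicator_open[OF S]) (use d0 in simp)
  have WA: "(\<integral>\<^sup>+ z. W z \<partial>lborel) = ennreal A" unfolding W_def A_def by (rule nn_integral_L2[OF H_reg_L2[OF f] sS])
  have UB: "(\<integral>\<^sup>+ z. U z \<partial>lborel) = ennreal B" unfolding U_def B_def by (rule nn_integral_L2[OF H_reg_L2[OF d0] sS])
  have A0: "A \<ge> 0" and B0: "B \<ge> 0" unfolding A_def B_def by (auto intro!: integral_nonneg_AE)
  \<comment> \<open>The squared normal derivative, and then the squared field, integrated along the
    normal line over \<open>y\<close>; the indicators inside \<open>U\<close> and \<open>W\<close>
    cut the line down to \<open>S\<close>.\<close>
  define I where "I y = (\<integral>\<^sup>+ s. U (?P y + s *\<^sub>R n) \<partial>lborel)" for y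
  define J where "J y = (\<integral>\<^sup>+ s. W (?P y + s *\<^sub>R n) \<partial>lborel)" for y
  have Im: "I \<in> borel_measurable borel" unfolding I_def[abs_def] n
    using measurable_plane_coordinates[OF lin Um, of x] by (intro lborel.borel_measurable_nn_integral) simp
  have Jm: "J \<in> borel_measurable borel" unfolding J_def[abs_def] n
    using measurable_plane_coordinates[OF lin Wm, of x] by (intro lborel.borel_measurable_nn_integral) simp
  have IB: "(\<integral>\<^sup>+ y. I y \<partial>lborel) = ennreal B"
    unfolding I_def n UB[symmetric] by (rule nn_integral_plane_coordinates[OF Q Um, symmetric])
  have JA: "(\<integral>\<^sup>+ y. J y \<partial>lborel) = ennreal A"
    unfolding J_def n WA[symmetric] by (rule nn_integral_plane_coordinates[OF Q Wm, symmetric])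
  have If: "AE y in lborel. I y \<noteq> \<infinity>"
    by (rule nn_integral_PInf_AE) (use Im IB in auto)
  let ?L = "\<lambda>y. normal_limit n f (?P y)"
  have key: "(\<lambda>k. f (?P y + inverse (real (Suc k)) *\<^sub>R n)) \<longlonglongrightarrow> ?L y \<and>
      (\<forall>s\<in>{0<..<\<tau>}. ennreal ((norm (f (?P y + s *\<^sub>R n) - ?L y))\<^sup>2) \<le> ennreal s * I y)" if y: "y \<in> D" "I y \<noteq> \<infinity>" for y
  proof -
    have inS: "?P y + r *\<^sub>R n \<in> S" if "r \<in> {0<..<\<tau>}" for r using cyl[OF y(1)] that by simp
    obtain L where L: "((\<lambda>s. f (?P y + s *\<^sub>R n)) \<longlongrightarrow> L) (at_right 0)"
      "\<And>s. s \<in> {0<..<\<tau>} \<Longrightarrow> ennreal ((norm (f (?P y + s *\<^sub>R n) - L))\<^sup>2) \<le> ennreal s * I y"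
    proof (rule has_limit_at_endpoint[where g="\<lambda>s. f (?P y + s *\<^sub>R n)" and h="\<lambda>s. dir_deriv n f (?P y + s *\<^sub>R n)"
          and w="\<lambda>s. U (?P y + s *\<^sub>R n)" and I="I y" and \<tau>=\<tau>])
      fix r assume r: "r \<in> {0<..<\<tau>}"
      show "((\<lambda>s. f (?P y + s *\<^sub>R n)) has_vector_derivative dir_deriv n f (?P y + r *\<^sub>R n)) (at r)"
        unfolding dir_deriv_def using f inS[OF r] by (intro has_vector_derivative_line) auto
      show "ennreal ((norm (dir_deriv n f (?P y + r *\<^sub>R n)))\<^sup>2) \<le> U (?P y + r *\<^sub>R n)"
        using inS[OF r] by (simp add: U_def)
    next
      show "continuous_on {0<..<\<tau>} (\<lambda>s. dir_deriv n f (?P y + s *\<^sub>R n))"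
      proof (rule continuous_on_compose2[of S "dir_deriv n f" _ "\<lambda>s. ?P y + s *\<^sub>R n"])
        show "continuous_on S (dir_deriv n f)" using d0 by simp
        show "continuous_on {0<..<\<tau>} (\<lambda>s. ?P y + s *\<^sub>R n)" by (intro continuous_intros)
      qed (use inS in auto)
    qed (use \<tau> y(2) in \<open>auto simp: I_def top.not_eq_extremum\<close>)
    have "filterlim (\<lambda>k. inverse (real (Suc k))) (at_right 0) sequentially"
      using LIMSEQ_inverse_real_of_nat by (auto simp: filterlim_at intro!: always_eventually)
    then have lim: "(\<lambda>k. f (?P y + inverse (real (Suc k)) *\<^sub>R n)) \<longlonglongrightarrow> L"
      by (rule filterlim_compose[OF L(1)])
    then have "?L y = L" unfolding normal_limit_def by (rule limI)
    with lim L(2) show ?thesis by simp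
  qed
  show ?a using If by eventually_elim (use key in blast)
  show "?b s" if s: "0 < s" "s < \<tau>" for s
  proof -
    have "(\<integral>\<^sup>+ y. indicator D y * ennreal ((norm (f (?P y + s *\<^sub>R n) - ?L y))\<^sup>2) \<partial>lborel) \<le> (\<integral>\<^sup>+ y. ennreal s * I y \<partial>lborel)"
    proof (rule nn_integral_mono_AE)
      show "AE y in lborel. indicator D y * ennreal ((norm (f (?P y + s *\<^sub>R n) - ?L y))\<^sup>2) \<le> ennreal s * I y"
        using If
      proof eventually_elim
        case (elim y)
        then show ?case using key[of y] s by (cases "y \<in> D") auto
      qed
    qed
    also have "\<dots> = ennreal s * ennreal B" using Im IB by (simp add: nn_integral_cmult)
    finally show ?thesis using s B0 by (simp add: ennreal_mult')
  qed
  \<comment> \<open>Pointwise form of the trace inequality. At each height s, |L|^2 \<le> 2 |f(s)|^2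
    + 2 |f(s) - L|^2, and the last term is at most 2 \<tau> I. Averaging over s in (0, \<tau>) gives
    the factor 2/\<tau> in front of \<open>J\<close>.\<close>
  have pt: "ennreal ((norm (?L y))\<^sup>2) \<le> ennreal (2/\<tau>) * J y + ennreal (2 * \<tau>) * I y" if y: "y \<in> D" "I y \<noteq> \<infinity>" for y
  proof -
    have 1: "ennreal ((norm (?L y))\<^sup>2) \<le> 2 * W (?P y + s *\<^sub>R n) + ennreal (2 * \<tau>) * I y" if s: "s \<in> {0<..<\<tau>}" for s
    proof -
      have inS: "?P y + s *\<^sub>R n \<in> S" using cyl[OF y(1)] s by simp
      have "ennreal ((norm (?L y))\<^sup>2) \<le> ennreal (2 * (norm (f (?P y + s *\<^sub>R n)))\<^sup>2 + 2 * (norm (f (?P y + s *\<^sub>R n) - ?L y))\<^sup>2)"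
        using norm_add_power2_le[of "f (?P y + s *\<^sub>R n)" "- (f (?P y + s *\<^sub>R n) - ?L y)"] unfolding norm_minus_cancel
        by (intro ennreal_leI) simp
      also have "\<dots> = 2 * W (?P y + s *\<^sub>R n) + 2 * ennreal ((norm (f (?P y + s *\<^sub>R n) - ?L y))\<^sup>2)"
        using inS by (simp add: W_def ennreal_plus ennreal_mult')
      also have "2 * ennreal ((norm (f (?P y + s *\<^sub>R n) - ?L y))\<^sup>2) \<le> 2 * (ennreal \<tau> * I y)"
      proof (rule mult_left_mono)
        have "ennreal ((norm (f (?P y + s *\<^sub>R n) - ?L y))\<^sup>2) \<le> ennreal s * I y" using key[OF y] s by blast
        also have "\<dots> \<le> ennreal \<tau> * I y" using s by (intro mult_right_mono ennreal_leI) auto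
        finally show "ennreal ((norm (f (?P y + s *\<^sub>R n) - ?L y))\<^sup>2) \<le> ennreal \<tau> * I y" .
      qed simp
      also have "2 * (ennreal \<tau> * I y) = ennreal (2 * \<tau>) * I y" using \<tau> by (simp add: ennreal_mult' mult.assoc)
      finally show ?thesis by (simp add: add_left_mono)
    qed
    have mW: "(\<lambda>s. W (?P y + s *\<^sub>R n)) \<in> borel_measurable borel"
    proof -
      have "(\<lambda>s::real. ?P y + s *\<^sub>R n) \<in> borel_measurable borel"
        by (intro borel_measurable_continuous_onI continuous_intros)
      from measurable_compose[OF this Wm] show ?thesis .
    qed
    have "ennreal \<tau> * ennreal ((norm (?L y))\<^sup>2) = (\<integral>\<^sup>+ s. ennreal ((norm (?L y))\<^sup>2) * indicator {0<..<\<tau>} s \<partial>lborel)"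
      using \<tau> by (subst nn_integral_cmult_indicator) (auto simp: mult.commute)
    also have "\<dots> \<le> (\<integral>\<^sup>+ s. 2 * W (?P y + s *\<^sub>R n) + ennreal (2 * \<tau>) * I y * indicator {0<..<\<tau>} s \<partial>lborel)"
      using 1 by (intro nn_integral_mono) (auto simp: indicator_def)
    also have "\<dots> = 2 * J y + ennreal (2 * \<tau>) * I y * ennreal \<tau>"
    proof -
      have "(\<integral>\<^sup>+ s. 2 * W (?P y + s *\<^sub>R n) + ennreal (2 * \<tau>) * I y * indicator {0<..<\<tau>} s \<partial>lborel)
         = (\<integral>\<^sup>+ s. 2 * W (?P y + s *\<^sub>R n) \<partial>lborel) + (\<integral>\<^sup>+ s. ennreal (2 * \<tau>) * I y * indicator {0<..<\<tau>} s \<partial>lborel)"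
        using mW by (intro nn_integral_add) auto
      also have "(\<integral>\<^sup>+ s. 2 * W (?P y + s *\<^sub>R n) \<partial>lborel) = 2 * J y"
        unfolding J_def using mW by (intro nn_integral_cmult) auto
      also have "(\<integral>\<^sup>+ s. ennreal (2 * \<tau>) * I y * indicator {0<..<\<tau>} s \<partial>lborel) = ennreal (2 * \<tau>) * I y * ennreal \<tau>"
        using \<tau> by (subst nn_integral_cmult_indicator) auto
      finally show ?thesis .
    qed
    finally have le: "ennreal (1/\<tau>) * (ennreal \<tau> * ennreal ((norm (?L y))\<^sup>2)) \<le> ennreal (1/\<tau>) * (2 * J y + ennreal (2 * \<tau>) * I y * ennreal \<tau>)"
      by (rule mult_left_mono) simp
    have one: "ennreal (1/\<tau>) * ennreal \<tau> = 1" using \<tau> by (simp add: ennreal_mult'[symmetric])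
    have "ennreal (1/\<tau> * 2) = ennreal (1/\<tau>) * ennreal 2" by (rule ennreal_mult'') simp
    then have two: "ennreal (1/\<tau>) * 2 = ennreal (2/\<tau>)" by simp
    have "ennreal (1/\<tau>) * (ennreal \<tau> * ennreal ((norm (?L y))\<^sup>2)) = ennreal ((norm (?L y))\<^sup>2)"
      by (simp only: mult.assoc[symmetric] one mult_1_left)
    moreover have "ennreal (1/\<tau>) * (2 * J y + ennreal (2 * \<tau>) * I y * ennreal \<tau>) = ennreal (2/\<tau>) * J y + ennreal (2 * \<tau>) * I y"
    proof -
      have "ennreal (1/\<tau>) * (2 * J y + ennreal (2 * \<tau>) * I y * ennreal \<tau>) 
        = (ennreal (1/\<tau>) * 2) * J y + (ennreal (1/\<tau>) * ennreal \<tau>) * (ennreal (2 * \<tau>) * I y)"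
        by (simp only: distrib_left ac_simps)
      then show ?thesis by (simp only: one two mult_1_left)
    qed
    ultimately show ?thesis using le by simp
  qed
  have "(\<integral>\<^sup>+ y. indicator D y * ennreal ((norm (?L y))\<^sup>2) \<partial>lborel) \<le> (\<integral>\<^sup>+ y. ennreal (2/\<tau>) * J y + ennreal (2 * \<tau>) * I y \<partial>lborel)"
  proof (rule nn_integral_mono_AE)
    show "AE y in lborel. indicator D y * ennreal ((norm (?L y))\<^sup>2) \<le> ennreal (2/\<tau>) * J y + ennreal (2 * \<tau>) * I y"
      using If
    proof eventually_elim
      case (elim y)
      then show ?case using pt[of y] by (cases "y \<in> D") auto
    qed
  qed
  also have "\<dots> = ennreal (2/\<tau>) * ennreal A + ennreal (2 * \<tau>) * ennreal B"
    using Im Jm IB JA by (subst nn_integral_add) (auto simp: nn_integral_cmult)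
  also have "\<dots> = ennreal (2 / \<tau> * A + 2 * \<tau> * B)"
  proof -
    have "ennreal (2/\<tau>) * ennreal A = ennreal (2/\<tau> * A)" "ennreal (2 * \<tau>) * ennreal B = ennreal (2 * \<tau> * B)"
      by (rule ennreal_mult''[OF A0, symmetric], rule ennreal_mult''[OF B0, symmetric])
    then show ?thesis using \<tau> A0 B0 by (simp only:) (rule ennreal_plus[symmetric], auto)
  qed
  finally show ?c .
qed


section \<open>Approximation in a half ball\<close>

lemma L2_tendstoI:
  assumes "\<And>k. (\<lambda>x. F k x - f x) \<in> borel_measurable M"
    and "\<And>k. (\<integral>\<^sup>+ x. ennreal ((norm (F k x - f x))\<^sup>2) \<partial>M) < \<infinity>"
    and "(\<lambda>k. \<integral>\<^sup>+ x. ennreal ((norm (F k x - f x))\<^sup>2) \<partial>M) \<longlonglongrightarrow> 0"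
  shows "L2_tendsto M F f"
proof -
  have L: "L2 M (\<lambda>x. F k x - f x)" for k
    using assms(1)[of k] assms(2)[of k] by (auto simp: L2_def integrable_iff_bounded)
  then have e: "(\<integral>\<^sup>+ x. ennreal ((norm (F k x - f x))\<^sup>2) \<partial>M) = ennreal (\<integral>x. (norm (F k x - f x))\<^sup>2 \<partial>M)" for k
    by (intro nn_integral_eq_integral) (auto simp: L2_def)
  have "(\<lambda>k. \<integral>x. (norm (F k x - f x))\<^sup>2 \<partial>M) \<longlonglongrightarrow> 0"
    using assms(3) unfolding e ennreal_0[symmetric] by (subst (asm) tendsto_ennreal_iff) auto
  with L show ?thesis by (simp add: L2_tendsto_def)
qed

lemma L2_tendstoD:
  assumes "L2_tendsto M F f"
  shows "(\<lambda>k. \<integral>\<^sup>+ x. ennreal ((norm (F k x - f x))\<^sup>2) \<partial>M) \<longlonglongrightarrow> 0"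
proof -
  have e: "(\<integral>\<^sup>+ x. ennreal ((norm (F k x - f x))\<^sup>2) \<partial>M) = ennreal (\<integral>x. (norm (F k x - f x))\<^sup>2 \<partial>M)" for k
    using assms by (intro nn_integral_eq_integral) (auto simp: L2_def L2_tendsto_def)
  have "(\<lambda>k. ennreal (\<integral>x. (norm (F k x - f x))\<^sup>2 \<partial>M)) \<longlonglongrightarrow> ennreal 0"
    using assms by (intro tendsto_ennrealI) (simp add: L2_tendsto_def)
  then show ?thesis by (simp add: e)
qed

lemma nn_integral_lebesgue_on:
  "S \<in> sets lebesgue \<Longrightarrow> (\<integral>\<^sup>+ x. h x \<partial>lebesgue_on S) = (\<integral>\<^sup>+ x. indicator S x * h x \<partial>lborel)"
  by (subst nn_integral_restrict_space) (auto simp: nn_integral_completion mult.commute)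

text \<open>Cauchy--Schwarz on a finite measure space turns L2 convergence into convergence of the integrals.\<close>

lemma L2_tendsto_integral:
  fixes u :: "nat \<Rightarrow> 'a \<Rightarrow> 'b::euclidean_space"
  assumes "finite_measure M" "L2_tendsto M u v" "\<And>k. integrable M (u k)" "integrable M v"
    and \<psi>: "\<psi> \<in> borel_measurable M" "\<And>x. \<bar>\<psi> x\<bar> \<le> C"
  shows "(\<lambda>k. \<integral>x. \<psi> x *\<^sub>R u k x \<partial>M) \<longlonglongrightarrow> (\<integral>x. \<psi> x *\<^sub>R v x \<partial>M)"
proof -
  interpret finite_measure M by fact
  \<comment> \<open>Any argument of \<open>\<psi>\<close> shows that the bound is
    nonnegative.\<close>
  have C0: "C \<ge> 0" using \<psi>(2)[of undefined] by linarith
  have i: "integrable M (\<lambda>x. \<psi> x *\<^sub>R g x)" if "integrable M g" for g :: "'a \<Rightarrow> 'b"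
  proof (rule Bochner_Integration.integrable_bound)
    show "integrable M (\<lambda>x. C *\<^sub>R g x)" using that by (rule integrable_scaleR_right)
    show "(\<lambda>x. \<psi> x *\<^sub>R g x) \<in> borel_measurable M" using that \<psi>(1) by (intro borel_measurable_scaleR) auto
    show "AE x in M. norm (\<psi> x *\<^sub>R g x) \<le> norm (C *\<^sub>R g x)"
      using \<psi>(2) C0 by (intro AE_I2) (auto intro!: mult_right_mono)
  qed
  define d where "d k = (\<integral>x. (norm (u k x - v x))\<^sup>2 \<partial>M)" for k
  have d: "d \<longlonglongrightarrow> 0" "\<And>k. integrable M (\<lambda>x. (norm (u k x - v x))\<^sup>2)"
    using assms(2) by (auto simp: L2_tendsto_def L2_def d_def[abs_def])
  let ?m = "measure M (space M)"
  have bd: "(\<integral>x. norm (u k x - v x) \<partial>M) \<le> sqrt (?m * d k)" for k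
  proof (rule real_le_rsqrt)
    have n: "integrable M (\<lambda>x. norm (u k x - v x))" using assms(3,4) by auto
    have m: "(\<lambda>x. u k x - v x) \<in> borel_measurable M" using assms(3)[of k] assms(4) by auto
    have "(ennreal (\<integral>x. norm (u k x - v x) \<partial>M))\<^sup>2 = (\<integral>\<^sup>+ x. 1 * ennreal (norm (u k x - v x)) \<partial>M)\<^sup>2"
      using n by (subst nn_integral_eq_integral[symmetric]) auto
    also have "\<dots> \<le> (\<integral>\<^sup>+ x. 1\<^sup>2 \<partial>M) * (\<integral>\<^sup>+ x. (ennreal (norm (u k x - v x)))\<^sup>2 \<partial>M)"
      using m by (intro Cauchy_Schwarz_nn_integral) auto
    also have "(\<integral>\<^sup>+ x. 1\<^sup>2 \<partial>M) = ennreal ?m" by (simp add: emeasure_eq_measure)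
    also have "(\<integral>\<^sup>+ x. (ennreal (norm (u k x - v x)))\<^sup>2 \<partial>M) = ennreal (d k)"
      unfolding d_def using d(2)[of k] by (subst nn_integral_eq_integral[symmetric]) (auto simp: ennreal_power)
    finally have "ennreal ((\<integral>x. norm (u k x - v x) \<partial>M)\<^sup>2) \<le> ennreal (?m * d k)"
      by (simp add: ennreal_power ennreal_mult' integral_nonneg_AE)
    moreover have "0 \<le> ?m * d k" by (auto simp: d_def intro!: integral_nonneg_AE)
    ultimately show "(\<integral>x. norm (u k x - v x) \<partial>M)\<^sup>2 \<le> ?m * d k" by simp
  qed
  have le: "norm ((\<integral>x. \<psi> x *\<^sub>R u k x \<partial>M) - (\<integral>x. \<psi> x *\<^sub>R v x \<partial>M)) \<le> C * sqrt (?m * d k)" for k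
  proof -
    have "(\<integral>x. \<psi> x *\<^sub>R u k x \<partial>M) - (\<integral>x. \<psi> x *\<^sub>R v x \<partial>M) = (\<integral>x. \<psi> x *\<^sub>R (u k x - v x) \<partial>M)"
      using i[OF assms(3)[of k]] i[OF assms(4)] by (simp add: scaleR_diff_right)
    also have "norm \<dots> \<le> (\<integral>x. norm (\<psi> x *\<^sub>R (u k x - v x)) \<partial>M)" by (rule integral_norm_bound)
    also have "\<dots> \<le> (\<integral>x. C * norm (u k x - v x) \<partial>M)"
      using assms(3,4) \<psi>(2) i[OF Bochner_Integration.integrable_diff[OF assms(3)[of k] assms(4)]]
      by (intro integral_mono integrable_norm) (auto intro!: mult_right_mono)
    also have "\<dots> \<le> C * sqrt (?m * d k)" using bd[of k] C0 by (simp add: mult_left_mono)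
    finally show ?thesis .
  qed
  have "(\<lambda>k. C * sqrt (?m * d k)) \<longlonglongrightarrow> C * sqrt (?m * 0)" by (intro tendsto_intros d)
  then have lim: "(\<lambda>k. C * sqrt (?m * d k)) \<longlonglongrightarrow> 0" by simp
  show ?thesis
  proof (rule LIM_zero_cancel, rule tendsto_norm_zero_cancel, rule tendsto_sandwich[OF _ _ tendsto_const lim])
    show "\<forall>\<^sub>F k in sequentially. norm ((\<integral>x. \<psi> x *\<^sub>R u k x \<partial>M) - (\<integral>x. \<psi> x *\<^sub>R v x \<partial>M)) \<le> C * sqrt (?m * d k)"
      using le by simp
  qed simp
qed

lemma L2_continuous:
  fixes f :: "'a::euclidean_space \<Rightarrow> 'b::euclidean_space"
  assumes "continuous_on UNIV f" "bounded S" "S \<in> sets lebesgue"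
  shows "L2 (lebesgue_on S) f"
proof -
  obtain a where a: "S \<subseteq> cbox (-a) a" using bounded_subset_cbox_symmetric[OF assms(2)] by blast
  have m: "f \<in> borel_measurable lebesgue"
    using assms(1) by (intro measurable_completion) (simp add: borel_measurable_continuous_onI)
  have "integrable lborel (\<lambda>x. indicator (cbox (-a) a) x *\<^sub>R (norm (f x))\<^sup>2)"
    by (rule borel_integrable_compact[OF compact_cbox
          continuous_on_power[OF continuous_on_norm[OF continuous_on_subset[OF assms(1) subset_UNIV]]]])
  then have "integrable lebesgue (\<lambda>x. indicator (cbox (-a) a) x *\<^sub>R (norm (f x))\<^sup>2)"
    by (simp add: integrable_completion borel_measurable_integrable)
  then have "integrable (lebesgue_on (cbox (-a) a)) (\<lambda>x. (norm (f x))\<^sup>2)"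
    by (subst integrable_restrict_space) auto
  then have "L2 (lebesgue_on (cbox (-a) a)) f"
    using measurable_restrict_space1[OF m] by (simp add: L2_def)
  then show ?thesis by (rule L2_subset[OF _ a _ assms(3)]) simp
qed

lemma norm_diff_power2_le: "(norm (a - b))\<^sup>2 \<le> 2 * (norm a)\<^sup>2 + 2 * (norm (b::'a::real_normed_vector))\<^sup>2"
  using norm_add_power2_le[of a "- b"] by simp

text \<open>Pointwise convergence together with convergence of the norms gives convergence in L2.\<close>

lemma translation_continuous_L2:
  fixes u :: "real^'n::finite \<Rightarrow> 'b::euclidean_space"
  assumes B: "open B" and u: "continuous_on B u" "L2 (lebesgue_on B) u"
    and B': "open B'" "B' \<subseteq> B" "negligible (frontier B')"
    and s: "s \<longlonglongrightarrow> 0" "\<And>k z. z \<in> B' \<Longrightarrow> z + s k *\<^sub>R n \<in> B"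
  shows "(\<lambda>k. \<integral>\<^sup>+ z. indicator B' z * ennreal ((norm (u (z + s k *\<^sub>R n) - u z))\<^sup>2) \<partial>lborel) \<longlonglongrightarrow> 0"
proof -
  define v where "v z = indicator B z *\<^sub>R u z" for z
  have vm: "v \<in> borel_measurable borel" unfolding v_def[abs_def]
    using B u(1) by (intro borel_measurable_continuous_on_indicator) auto
  have v2: "integrable lborel (\<lambda>z. (norm (v z))\<^sup>2)"
  proof -
    have "integrable lebesgue (\<lambda>z. indicator B z *\<^sub>R (norm (u z))\<^sup>2)"
      using u(2) B by (intro integrable_restrict_space[THEN iffD1]) (auto simp: L2_def)
    also have "(\<lambda>z. indicator B z *\<^sub>R (norm (u z))\<^sup>2) = (\<lambda>z. (norm (v z))\<^sup>2)"
      by (intro ext) (auto simp: v_def indicator_def)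
    finally show ?thesis using vm by (subst (asm) integrable_completion) auto
  qed
  have vc: "isCont v z" if "z \<in> B'" for z
  proof -
    have "continuous_on B v" using u(1) by (subst continuous_on_cong[of B B v u]) (auto simp: v_def)
    then show ?thesis using that B B'(2) by (auto simp: continuous_on_eq_continuous_at)
  qed
  have sz: "(\<lambda>k. z + s k *\<^sub>R n) \<longlonglongrightarrow> z" "(\<lambda>k. z - s k *\<^sub>R n) \<longlonglongrightarrow> z" for z
  proof -
    have "(\<lambda>k. z + s k *\<^sub>R n) \<longlonglongrightarrow> z + 0 *\<^sub>R n" "(\<lambda>k. z - s k *\<^sub>R n) \<longlonglongrightarrow> z - 0 *\<^sub>R n"
      by (intro tendsto_intros s)+
    then show "(\<lambda>k. z + s k *\<^sub>R n) \<longlonglongrightarrow> z" "(\<lambda>k. z - s k *\<^sub>R n) \<longlonglongrightarrow> z" by simp_all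
  qed
  \<comment> \<open>\<open>a k\<close> is the squared norm of the shifted field on
    \<open>B'\<close>, and \<open>b k\<close> is the same with the shift moved from the field to the
    domain. Their integrals agree, but it is \<open>b k\<close> that has a majorant independent of
    k.\<close>
  define a where "a k z = indicator B' z * (norm (v (z + s k *\<^sub>R n)))\<^sup>2" for k z
  define a0 where "a0 z = indicator B' z * (norm (v z))\<^sup>2" for z
  define b where "b k z = indicator B' (z - s k *\<^sub>R n) * (norm (v z))\<^sup>2" for k z
  have B'm: "B' \<in> sets borel" using B'(1) by auto
  have tm: "(\<lambda>z. z + c) \<in> borel_measurable borel" for c :: "real^'n"
    by (intro borel_measurable_continuous_onI continuous_intros)
  have ib: "indicator B' \<in> borel_measurable borel" using B'm by simp
  have bm: "b k \<in> borel_measurable borel" for k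
    unfolding b_def[abs_def] diff_conv_add_uminus using measurable_compose[OF tm ib] vm by measurable
  have am: "a k \<in> borel_measurable borel" for k
    unfolding a_def[abs_def] using measurable_compose[OF tm vm] ib by measurable
  have a0m: "a0 \<in> borel_measurable borel" unfolding a0_def[abs_def] using vm ib by measurable
  have bi: "integrable lborel (b k)" for k
    by (rule Bochner_Integration.integrable_bound[OF v2]) (use bm in \<open>auto simp: b_def indicator_def\<close>)
  have a0i: "integrable lborel a0"
    by (rule Bochner_Integration.integrable_bound[OF v2]) (use a0m in \<open>auto simp: a0_def indicator_def\<close>)
  have ab: "(\<lambda>z. b k (s k *\<^sub>R n + z)) = a k" for k by (auto simp: a_def b_def add.commute)
  have ai: "integrable lborel (a k)" for k
    using bi[of k] integrable_distr_eq[of "(+) (s k *\<^sub>R n)" lborel borel "b k"] bm[of k]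
    by (simp add: lborel_distr_plus ab)
  have ab_eq: "integral\<^sup>L lborel (a k) = integral\<^sup>L lborel (b k)" for k
    using integral_distr[of "(+) (s k *\<^sub>R n)" lborel borel "b k"] bm[of k]
    by (simp add: lborel_distr_plus ab)
  \<comment> \<open>Off the frontier of \<open>B'\<close> the shifted indicator is eventually equal
    to the original one.\<close>
  have fr: "AE z in lborel. z \<notin> frontier B'"
    using B'(3) unfolding negligible_iff_null_sets by (metis AE_not_in AE_completion_iff)
  have bl: "(\<lambda>k. integral\<^sup>L lborel (b k)) \<longlonglongrightarrow> integral\<^sup>L lborel a0"
  proof (rule integral_dominated_convergence[OF _ _ v2])
    show "AE z in lborel. (\<lambda>k. b k z) \<longlonglongrightarrow> a0 z"
      using fr
    proof eventually_elim
      case (elim z)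
      have "\<forall>\<^sub>F k in sequentially. b k z = a0 z"
      proof (cases "z \<in> B'")
        case True
        show ?thesis
          by (rule eventually_mono[OF topological_tendstoD[OF sz(2) B'(1) True]])
             (simp add: a0_def b_def True)
      next
        case False
        then have "z \<in> - closure B'" using elim B'(1) by (simp add: frontier_def interior_open)
        then have "\<forall>\<^sub>F k in sequentially. z - s k *\<^sub>R n \<in> - closure B'"
          by (intro topological_tendstoD[OF sz(2)]) auto
        then show ?thesis
        proof eventually_elim
          case (elim k)
          then show ?case using closure_subset[of B'] False by (auto simp: a0_def b_def indicator_def)
        qed
      qed
      then show ?case by (rule tendsto_eventually)
    qed
    show "AE z in lborel. norm (b k z) \<le> (norm (v z))\<^sup>2" for k by (auto simp: b_def indicator_def)
  qed (use a0m bm in auto)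
  have at: "AE z in lborel. (\<lambda>k. a k z) \<longlonglongrightarrow> a0 z"
  proof (intro AE_I2)
    fix z show "(\<lambda>k. a k z) \<longlonglongrightarrow> a0 z"
    proof (cases "z \<in> B'")
      case True
      then show ?thesis unfolding a_def a0_def
        by (intro tendsto_intros isCont_tendsto_compose[OF vc sz(1)])
    qed (simp add: a_def a0_def)
  qed
  have nna: "(\<integral>\<^sup>+ z. ennreal (norm (a k z)) \<partial>lborel) = ennreal (integral\<^sup>L lborel (a k))" for k
    using ai[of k] by (subst nn_integral_eq_integral[symmetric]) (auto simp: a_def)
  have nna0: "(\<integral>\<^sup>+ z. ennreal (norm (a0 z)) \<partial>lborel) = ennreal (integral\<^sup>L lborel a0)"
    using a0i by (subst nn_integral_eq_integral[symmetric]) (auto simp: a0_def)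
  have Sch: "(\<lambda>k. \<integral>\<^sup>+ z. ennreal (norm (a k z - a0 z)) \<partial>lborel) \<longlonglongrightarrow> 0"
  proof (rule Scheffe_lemma1[OF ai a0i at])
    have "(\<lambda>k. \<integral>\<^sup>+ z. ennreal (norm (a k z)) \<partial>lborel) \<longlonglongrightarrow> (\<integral>\<^sup>+ z. ennreal (norm (a0 z)) \<partial>lborel)"
      unfolding nna nna0 ab_eq by (intro tendsto_ennrealI bl)
    then show "limsup (\<lambda>k. \<integral>\<^sup>+ z. ennreal (norm (a k z)) \<partial>lborel) \<le> (\<integral>\<^sup>+ z. ennreal (norm (a0 z)) \<partial>lborel)"
      by (simp add: lim_imp_Limsup)
  qed
  define d where "d k z = indicator B' z * (norm (v (z + s k *\<^sub>R n) - v z))\<^sup>2" for k z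
  have dm: "d k \<in> borel_measurable borel" for k
    unfolding d_def[abs_def] using measurable_compose[OF tm vm] vm ib by measurable
  \<comment> \<open>The squared difference is split at 4 a0. The lower part is dominated; since d
    \<le> 2 a + 2 a0, the excess is at most 2 |a - a0|, which \<open>Sch\<close> controls in
    L1.\<close>
  define c where "c k z = min (d k z) (4 * a0 z)" for k z
  have cm: "c k \<in> borel_measurable borel" for k unfolding c_def[abs_def] using dm a0m by measurable
  have a0p: "a0 z \<ge> 0" and dp: "d k z \<ge> 0" and cp: "c k z \<ge> 0" for k z
    by (auto simp: a0_def d_def c_def)
  have cl: "(\<lambda>k. integral\<^sup>L lborel (c k)) \<longlonglongrightarrow> integral\<^sup>L lborel (\<lambda>z::real^'n. 0)"
  proof (rule integral_dominated_convergence[where w="\<lambda>z. 4 * a0 z"])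
    show "AE z in lborel. (\<lambda>k. c k z) \<longlonglongrightarrow> 0"
    proof (intro AE_I2)
      fix z show "(\<lambda>k. c k z) \<longlonglongrightarrow> 0"
      proof (cases "z \<in> B'")
        case True
        have "(\<lambda>k. d k z) \<longlonglongrightarrow> indicator B' z * (norm (v z - v z))\<^sup>2" unfolding d_def
          by (intro tendsto_intros isCont_tendsto_compose[OF vc[OF True] sz(1)])
        then have "(\<lambda>k. c k z) \<longlonglongrightarrow> min 0 (4 * a0 z)" unfolding c_def by (intro tendsto_intros) simp
        then show ?thesis using a0p[of z] by simp
      qed (simp add: c_def d_def a0_def)
    qed
    show "AE z in lborel. norm (c k z) \<le> 4 * a0 z" for k using cp[of k] by (intro AE_I2) (simp add: c_def)
  qed (use a0i cm in auto)
  have ci: "integrable lborel (c k)" for k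
    by (rule Bochner_Integration.integrable_bound[of _ "\<lambda>z. 4 * a0 z"]) (use a0i cm cp in \<open>auto simp: c_def\<close>)
  have cnn: "(\<lambda>k. \<integral>\<^sup>+ z. ennreal (c k z) \<partial>lborel) \<longlonglongrightarrow> 0"
  proof -
    have "(\<integral>\<^sup>+ z. ennreal (c k z) \<partial>lborel) = ennreal (integral\<^sup>L lborel (c k))" for k
      using ci cp by (intro nn_integral_eq_integral) auto
    moreover have "(\<lambda>k. ennreal (integral\<^sup>L lborel (c k))) \<longlonglongrightarrow> ennreal 0"
      using cl by (intro tendsto_ennrealI) simp
    ultimately show ?thesis by simp
  qed
  have le: "(\<integral>\<^sup>+ z. indicator B' z * ennreal ((norm (u (z + s k *\<^sub>R n) - u z))\<^sup>2) \<partial>lborel)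
     \<le> (\<integral>\<^sup>+ z. ennreal (c k z) \<partial>lborel) + 2 * (\<integral>\<^sup>+ z. ennreal (norm (a k z - a0 z)) \<partial>lborel)" for k
  proof -
    have "(\<integral>\<^sup>+ z. indicator B' z * ennreal ((norm (u (z + s k *\<^sub>R n) - u z))\<^sup>2) \<partial>lborel) = (\<integral>\<^sup>+ z. ennreal (d k z) \<partial>lborel)"
    proof (rule nn_integral_cong)
      fix z show "indicator B' z * ennreal ((norm (u (z + s k *\<^sub>R n) - u z))\<^sup>2) = ennreal (d k z)"
        using s(2)[of z k] B'(2) by (cases "z \<in> B'") (auto simp: d_def v_def)
    qed
    also have "\<dots> \<le> (\<integral>\<^sup>+ z. ennreal (c k z) + 2 * ennreal (norm (a k z - a0 z)) \<partial>lborel)"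
    proof (rule nn_integral_mono)
      fix z
      have "d k z \<le> 2 * a k z + 2 * a0 z"
        unfolding d_def a_def a0_def using norm_diff_power2_le[of "v (z + s k *\<^sub>R n)" "v z"]
        by (cases "z \<in> B'") auto
      then have "d k z \<le> c k z + 2 * norm (a k z - a0 z)" using dp[of k z] unfolding c_def by (auto simp: min_def)
      then have "ennreal (d k z) \<le> ennreal (c k z + 2 * norm (a k z - a0 z))" by (rule ennreal_leI)
      also have "\<dots> = ennreal (c k z) + 2 * ennreal (norm (a k z - a0 z))"
        using cp[of k z] by (simp add: ennreal_plus ennreal_mult')
      finally show "ennreal (d k z) \<le> ennreal (c k z) + 2 * ennreal (norm (a k z - a0 z))" .
    qed
    also have "\<dots> = (\<integral>\<^sup>+ z. ennreal (c k z) \<partial>lborel) + 2 * (\<integral>\<^sup>+ z. ennreal (norm (a k z - a0 z)) \<partial>lborel)"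
      using cm am a0m by (simp add: nn_integral_add nn_integral_cmult)
    finally show ?thesis .
  qed
  have "(\<lambda>k. (\<integral>\<^sup>+ z. ennreal (c k z) \<partial>lborel) + 2 * (\<integral>\<^sup>+ z. ennreal (norm (a k z - a0 z)) \<partial>lborel)) \<longlonglongrightarrow> 0 + 2 * 0"
    by (intro tendsto_add cnn ennreal_tendsto_cmult Sch) auto
  then have lim: "(\<lambda>k. (\<integral>\<^sup>+ z. ennreal (c k z) \<partial>lborel) + 2 * (\<integral>\<^sup>+ z. ennreal (norm (a k z - a0 z)) \<partial>lborel)) \<longlonglongrightarrow> 0" by simp
  show ?thesis
    by (rule tendsto_sandwich[OF _ _ tendsto_const lim]) (use le in auto)
qed

section \<open>Half balls and the chart of a flat disc\<close>

definition half_ball :: "real^3 \<Rightarrow> real^3 \<Rightarrow> real \<Rightarrow> (real^3) set" where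
  "half_ball x n r = {z \<in> ball x r. (z - x) \<bullet> n > 0}"

lemma open_half_ball [simp]: "open (half_ball x n r)"
proof -
  have "half_ball x n r = ball x r \<inter> {z. 0 < (z - x) \<bullet> n}" by (auto simp: half_ball_def)
  moreover have "open {z. 0 < (z - x) \<bullet> n}"
    by (rule open_Collect_less) (intro continuous_intros)+
  ultimately show ?thesis by auto
qed

lemma half_ball_lebesgue [simp]: "half_ball x n r \<in> sets lebesgue"
  by (simp add: borel_open)

lemma bounded_half_ball [simp]: "bounded (half_ball x n r)"
  by (rule bounded_subset[OF bounded_ball]) (auto simp: half_ball_def)

lemma half_ball_mono: "r \<le> r' \<Longrightarrow> half_ball x n r \<subseteq> half_ball x n r'"
  by (auto simp: half_ball_def)

lemma negligible_frontier_half_ball: "negligible (frontier (half_ball x n r))"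
proof (rule negligible_convex_frontier)
  have "half_ball x n r = ball x r \<inter> {z. n \<bullet> z > n \<bullet> x}"
    by (auto simp: half_ball_def inner_diff_left inner_diff_right inner_commute)
  then show "convex (half_ball x n r)" by (simp add: convex_Int convex_halfspace_gt)
qed

locale flat_chart =
  fixes x :: "real^3" and Q :: "real^3 \<Rightarrow> real^3" and n :: "real^3"
  assumes Q: "orthogonal_transformation Q" and n: "n = Q (axis 3 1)"
begin

lemma lin: "linear Q" using Q by (rule orthogonal_transformation_linear)

lemma norm_n: "norm n = 1"
  using Q by (simp add: n orthogonal_transformation_norm norm_axis_1)

abbreviation "P \<equiv> plane_pt x Q"

lemma inner_n: "Q v \<bullet> n = v $ 3"
  using Q by (simp add: n orthogonal_transformation_def inner_axis)

lemma P_inner: "(P y + s *\<^sub>R n - x) \<bullet> n = s"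
  using plane_pt_add[OF lin, of x y s] by (simp add: inner_n flip: n)

lemma P_norm: "norm (P y - x) = norm y"
proof -
  have "norm (P y - x) = norm (join3 (y, 0))"
    using Q by (simp add: plane_pt_eq orthogonal_transformation_norm)
  also have "\<dots> = norm y" by (simp add: norm_eq_sqrt_inner inner_vec_def sum_3 sum_2)
  finally show ?thesis .
qed

lemma P_in_ball: "P y \<in> ball x r \<longleftrightarrow> norm y < r"
  using P_norm[of y] by (simp add: dist_norm norm_minus_commute)

lemma P_in_half_ball: "norm y + s < r \<Longrightarrow> 0 < s \<Longrightarrow> P y + s *\<^sub>R n \<in> half_ball x n r"
proof -
  assume s: "norm y + s < r" "0 < s"
  have "norm (P y + s *\<^sub>R n - x) \<le> norm (P y - x) + norm (s *\<^sub>R n)"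
    by (metis add_diff_eq add.commute norm_triangle_ineq)
  also have "\<dots> = norm y + s" using s by (simp add: P_norm norm_n)
  finally show ?thesis using s P_inner[of y s] by (simp add: half_ball_def dist_norm norm_minus_commute)
qed

lemma shift_half_ball:
  assumes "z \<in> half_ball x n r'" "0 \<le> s" "r' + s \<le> r"
  shows "z + s *\<^sub>R n \<in> half_ball x n r"
proof -
  have "norm (z + s *\<^sub>R n - x) \<le> norm (z - x) + norm (s *\<^sub>R n)"
    by (metis add_diff_eq add.commute norm_triangle_ineq)
  moreover have "norm (z - x) < r'" using assms(1) by (simp add: half_ball_def dist_norm norm_minus_commute)
  ultimately have "norm (z + s *\<^sub>R n - x) < r" using assms(2,3) by (simp add: norm_n)
  moreover have "(z + s *\<^sub>R n - x) \<bullet> n = (z - x) \<bullet> n + s"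
    using norm_n by (simp add: algebra_simps dot_square_norm)
  ultimately show ?thesis using assms by (simp add: half_ball_def dist_norm norm_minus_commute)
qed

abbreviation "disc r \<equiv> {y::real^2. norm y < r}"

lemma open_disc: "open (disc r)"
  by (rule open_Collect_less) (intro continuous_intros)+

lemma disc_lebesgue: "disc r \<in> sets lebesgue" and disc_borel: "disc r \<in> sets borel"
  using open_disc by auto

lemma bounded_disc: "bounded (disc r)"
  by (rule bounded_subset[OF bounded_ball[of 0 r]]) auto

lemma patch_measure_flat: "patch_measure x r Q (\<lambda>_. 0) = lebesgue_on (disc r)"
proof -
  have "{y. P y \<in> ball x r} = disc r" using P_in_ball by blast
  then show ?thesis unfolding patch_measure_def by (simp add: density_1)
qed

text \<open>Over the smaller disc the half ball contains a cylinder of height r - r'. This is why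
  the estimates below give up part of the radius.\<close>

lemma disc_cylinder:
  "y \<in> disc r' \<Longrightarrow> 0 < s \<Longrightarrow> s < r - r' \<Longrightarrow> P y + s *\<^sub>R n \<in> half_ball x n r"
  by (rule P_in_half_ball) auto

lemmas estimates = normal_limit_estimates[OF open_half_ball _ Q n _ disc_cylinder disc_borel]

lemma normal_limit_AE:
  fixes f :: "real^3 \<Rightarrow> 'b::euclidean_space"
  assumes "H_reg 1 (half_ball x n r) f" "r' < r"
  shows "AE y in lborel. norm y < r' \<longrightarrow>
    (\<lambda>k. f (P y + inverse (real (Suc k)) *\<^sub>R n)) \<longlonglongrightarrow> normal_limit n f (P y)"
  using estimates(1)[OF assms(1), of "r - r'" r'] assms(2) by simp

text \<open>The heights 1/(k+1) from index \<open>N\<close> on; \<open>N\<close> is chosen so that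
  already the first of them stays below the top of the available cylinder.\<close>

definition step :: "nat \<Rightarrow> nat \<Rightarrow> real" where
  "step N k = inverse (real (Suc (k + N)))"

lemma step: "step N \<longlonglongrightarrow> 0" "0 < step N k" "step N k \<le> inverse (real (Suc N))"
proof -
  show "step N \<longlonglongrightarrow> 0" unfolding step_def[abs_def]
    by (rule LIMSEQ_ignore_initial_segment[OF LIMSEQ_inverse_real_of_nat])
  show "0 < step N k" by (simp add: step_def)
  show "step N k \<le> inverse (real (Suc N))" unfolding step_def by (rule le_imp_inverse_le) auto
qed

lemma normal_limit_step: "normal_limit n f z = lim (\<lambda>k. f (z + step N k *\<^sub>R n))"
proof -
  have "(\<lambda>k. f (z + inverse (real (Suc k)) *\<^sub>R n)) \<longlonglongrightarrow> L \<longleftrightarrow> (\<lambda>k. f (z + step N k *\<^sub>R n)) \<longlonglongrightarrow> L" for L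
    unfolding step_def using LIMSEQ_ignore_initial_segment LIMSEQ_offset[of "\<lambda>k. f (z + inverse (real (Suc k)) *\<^sub>R n)" N L]
    by blast
  then show ?thesis by (simp add: normal_limit_def lim_def)
qed

text \<open>The squared L2 distance between the slice at height s and the limit is at most s times
  the integral of the squared normal derivative, by the second of the
  \<open>estimates\<close>.\<close>

lemma slices:
  fixes f :: "real^3 \<Rightarrow> 'b::euclidean_space"
  assumes f: "H_reg 1 (half_ball x n r) f" and r: "r' < r" and N: "inverse (real (Suc N)) < r - r'"
  shows "L2_tendsto (lebesgue_on (disc r')) (\<lambda>k y. f (P y + step N k *\<^sub>R n)) (\<lambda>y. normal_limit n f (P y))" (is ?a)
    and "L2 (lebesgue_on (disc r')) (\<lambda>y. normal_limit n f (P y))" (is ?b)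
    and "continuous_on (disc r') (\<lambda>y. f (P y + step N k *\<^sub>R n))" (is "?c k")
    and "L2 (lebesgue_on (disc r')) (\<lambda>y. f (P y + step N k *\<^sub>R n))" (is "?d k")
proof -
  have sk: "0 < step N k" "step N k < r - r'" for k using step(2,3)[of N k] N by auto
  have fc: "continuous_on (half_ball x n r) f" by (rule Ck_on_continuous[OF H_reg_Ck[OF f]])
  show c: "?c k" for k
  proof (rule continuous_on_compose2[OF fc])
    show "continuous_on (disc r') (\<lambda>y. P y + step N k *\<^sub>R n)"
      by (intro continuous_on_add continuous_on_plane_pt lin continuous_on_const)
  qed (use disc_cylinder sk in blast)
  have m: "(\<lambda>y. f (P y + step N k *\<^sub>R n)) \<in> borel_measurable (lebesgue_on (disc r'))" for k
    by (rule continuous_on_measurable_lebesgue_on[OF c open_disc])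
  have ml: "(\<lambda>y. normal_limit n f (P y)) \<in> borel_measurable (lebesgue_on (disc r'))"
    unfolding normal_limit_step[of f _ N] using m by (rule borel_measurable_lim_metric)
  define B where "B = (\<integral>z. (norm (dir_deriv n f z))\<^sup>2 \<partial>lebesgue_on (half_ball x n r))"
  have bd: "(\<integral>\<^sup>+ y. ennreal ((norm (f (P y + step N k *\<^sub>R n) - normal_limit n f (P y)))\<^sup>2) \<partial>lebesgue_on (disc r')) \<le> ennreal (step N k * B)" for k
    unfolding nn_integral_lebesgue_on[OF disc_lebesgue] B_def
    by (rule estimates(2)[OF f, of "r - r'" r']) (use r sk in auto)
  show a: ?a
  proof (rule L2_tendstoI)
    show "(\<lambda>y. f (P y + step N k *\<^sub>R n) - normal_limit n f (P y)) \<in> borel_measurable (lebesgue_on (disc r'))" for k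
      using m ml by (rule borel_measurable_diff)
    show "(\<integral>\<^sup>+ y. ennreal ((norm (f (P y + step N k *\<^sub>R n) - normal_limit n f (P y)))\<^sup>2) \<partial>lebesgue_on (disc r')) < \<infinity>" for k
      using bd[of k] by (rule order_le_less_trans) simp
    have "(\<lambda>k. ennreal (step N k * B)) \<longlonglongrightarrow> ennreal (0 * B)" by (intro tendsto_ennrealI tendsto_intros step)
    then have lim: "(\<lambda>k. ennreal (step N k * B)) \<longlonglongrightarrow> 0" by simp
    show "(\<lambda>k. \<integral>\<^sup>+ y. ennreal ((norm (f (P y + step N k *\<^sub>R n) - normal_limit n f (P y)))\<^sup>2) \<partial>lebesgue_on (disc r')) \<longlonglongrightarrow> 0"
      by (rule tendsto_sandwich[OF _ _ tendsto_const lim]) (use bd in auto)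
  qed
  have "(\<integral>\<^sup>+ y. ennreal ((norm (normal_limit n f (P y)))\<^sup>2) \<partial>lebesgue_on (disc r')) < \<infinity>"
    unfolding nn_integral_lebesgue_on[OF disc_lebesgue]
    by (rule order_le_less_trans[OF estimates(3)[OF f, of "r - r'" r']]) (use r in auto)
  then show b: ?b using ml by (simp add: L2_def integrable_iff_bounded)
  show "?d k" for k
    using L2_add[OF _ b, of "\<lambda>y. f (P y + step N k *\<^sub>R n) - normal_limit n f (P y)"] a by (simp add: L2_tendsto_def)
qed

text \<open>\<open>has_trace\<close> wants approximants that are C1 on all of space, while
  \<open>f\<close> is under control only in the open half ball. The translate z -> f(z + s n) is C1
  near the closed smaller half ball and can be extended from there.\<close>

lemma trace_approximation:
  fixes f :: "real^3 \<Rightarrow> 'b::euclidean_space"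
  assumes f: "H_reg 1 (half_ball x n r) f" and r: "0 < r'" "r' < r"
  obtains F where "\<And>k. Ck_on 1 UNIV (F k)" "H1_tendsto (half_ball x n r') F f"
    "L2_tendsto (patch_measure x r' Q (\<lambda>_. 0)) (\<lambda>k y. F k (P y)) (\<lambda>y. normal_limit n f (P y))"
proof -
  obtain N where N: "inverse (real (Suc N)) < r - r'" using reals_Archimedean[of "r - r'"] r by auto
  let ?s = "step N"
  have sk: "0 < ?s k" "?s k < r - r'" for k using step(2,3)[of N k] N by auto
  let ?B = "half_ball x n r" and ?B' = "half_ball x n r'"
  define K where "K = {z \<in> cball x r'. (z - x) \<bullet> n \<ge> 0}"
  have "closed {z. 0 \<le> (z - x) \<bullet> n}" by (rule closed_Collect_le) (intro continuous_intros)+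
  moreover have "K = cball x r' \<inter> {z. 0 \<le> (z - x) \<bullet> n}" by (auto simp: K_def)
  ultimately have K: "compact K" by (simp add: compact_Int_closed)
  have BK: "?B' \<subseteq> K" by (auto simp: half_ball_def K_def)
  have fC: "Ck_on 1 ?B f" by (rule H_reg_Ck[OF f])
  \<comment> \<open>Domain of the translated function; it contains the closed half ball
    \<open>K\<close> because \<open>?s k\<close> is positive and less than r - r'.\<close>
  define W where "W k = {z. ?s k *\<^sub>R n + z \<in> ?B}" for k
  have oW: "open (W k)" for k
    unfolding W_def using open_vimage[OF open_half_ball, of "\<lambda>z. ?s k *\<^sub>R n + z"]
    by (simp add: vimage_def continuous_intros)
  have OC: "Ck_on 1 (W k) (\<lambda>z. f (?s k *\<^sub>R n + z))" for k
    unfolding W_def by (rule Ck_on_affine[OF open_half_ball linear_ident fC])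
  have KO: "K \<subseteq> W k" for k
  proof
    fix z assume z: "z \<in> K"
    have "norm (?s k *\<^sub>R n + z - x) \<le> norm (z - x) + norm (?s k *\<^sub>R n)"
      by (metis add_diff_eq add.commute norm_triangle_ineq)
    moreover have "norm (z - x) \<le> r'" using z by (simp add: K_def dist_norm norm_minus_commute)
    ultimately have "norm (?s k *\<^sub>R n + z - x) < r" using sk[of k] by (simp add: norm_n)
    moreover have "(?s k *\<^sub>R n + z - x) \<bullet> n = (z - x) \<bullet> n + ?s k"
      using norm_n by (simp add: algebra_simps dot_square_norm)
    ultimately show "z \<in> W k" using z sk[of k] by (simp add: W_def K_def half_ball_def dist_norm norm_minus_commute)
  qed
  have "\<exists>F V. Ck_on 1 UNIV F \<and> open V \<and> K \<subseteq> V \<and> V \<subseteq> W k \<and> (\<forall>z\<in>V. F z = f (?s k *\<^sub>R n + z))" for k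
    by (rule C1_extension[OF oW OC K KO]) blast
  then obtain F V where F: "\<And>k. Ck_on 1 UNIV (F k)" and V: "\<And>k. open (V k)" "\<And>k. K \<subseteq> V k" "\<And>k. V k \<subseteq> W k"
    and FV: "\<And>k z. z \<in> V k \<Longrightarrow> F k z = f (?s k *\<^sub>R n + z)" by metis
  have FB: "F k z = f (z + ?s k *\<^sub>R n)" if "z \<in> K" for k z
    using FV[of z k] V(2)[of k] that by (auto simp: add.commute)
  have pF: "pd i (F k) z = pd i f (z + ?s k *\<^sub>R n)" if "z \<in> K" for i k z
  proof -
    have zV: "z \<in> V k" using V(2) that by blast
    then have zO: "?s k *\<^sub>R n + z \<in> ?B" using V(3)[of k] by (auto simp: W_def)
    have "pd i (F k) z = pd i (\<lambda>z. f (?s k *\<^sub>R n + z)) z" by (rule pd_transform[OF V(1) zV FV])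
    also have "\<dots> = (\<Sum>j\<in>UNIV. axis i 1 $ j *\<^sub>R pd j f (?s k *\<^sub>R n + z))"
      by (rule pd_eqI[OF has_derivative_affine_comp[OF linear_ident]]) (use fC zO in simp)
    also have "\<dots> = pd i f (?s k *\<^sub>R n + z)" by (simp add: axis_def if_distrib if_distribR cong: if_cong)
    finally show ?thesis by (simp add: add.commute)
  qed
  \<comment> \<open>Applied to the field and to each of its first derivatives: on \<open>K\<close>
    the approximants and their derivatives are translates, so continuity of translations in L2 gives
    the convergence.\<close>
  have conv: "L2_tendsto (lebesgue_on ?B') G u"
    if G: "\<And>k. continuous_on UNIV (G k)" and u: "H_reg 0 ?B u" and GB: "\<And>k z. z \<in> K \<Longrightarrow> G k z = u (z + ?s k *\<^sub>R n)"
    for G and u :: "real^3 \<Rightarrow> 'b"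
  proof (rule L2_tendstoI)
    have uB: "L2 (lebesgue_on ?B') u" by (rule L2_subset[OF H_reg_L2[OF u] half_ball_mono]) (use r in auto)
    have L: "L2 (lebesgue_on ?B') (\<lambda>z. G k z - u z)" for k
      by (rule L2_diff[OF L2_continuous[OF G] uB]) auto
    then show "(\<lambda>z. G k z - u z) \<in> borel_measurable (lebesgue_on ?B')" for k by (simp add: L2_def)
    show "(\<integral>\<^sup>+ z. ennreal ((norm (G k z - u z))\<^sup>2) \<partial>lebesgue_on ?B') < \<infinity>" for k
      using L[of k] by (simp add: L2_def integrable_iff_bounded)
    have sh: "z + ?s k *\<^sub>R n \<in> ?B" if "z \<in> ?B'" for k z
      by (rule shift_half_ball[OF that]) (use sk[of k] in auto)
    have "(\<lambda>k. \<integral>\<^sup>+ z. indicator ?B' z * ennreal ((norm (u (z + ?s k *\<^sub>R n) - u z))\<^sup>2) \<partial>lborel) \<longlonglongrightarrow> 0"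
      by (rule translation_continuous_L2[OF open_half_ball _ H_reg_L2[OF u] open_half_ball half_ball_mono negligible_frontier_half_ball step(1)])
         (use u r sh in auto)
    also have "(\<lambda>k. \<integral>\<^sup>+ z. indicator ?B' z * ennreal ((norm (u (z + ?s k *\<^sub>R n) - u z))\<^sup>2) \<partial>lborel)
       = (\<lambda>k. \<integral>\<^sup>+ z. ennreal ((norm (G k z - u z))\<^sup>2) \<partial>lebesgue_on ?B')"
      unfolding nn_integral_lebesgue_on[OF half_ball_lebesgue]
      by (intro ext nn_integral_cong) (use GB BK in \<open>auto simp: indicator_def\<close>)
    finally show "(\<lambda>k. \<integral>\<^sup>+ z. ennreal ((norm (G k z - u z))\<^sup>2) \<partial>lebesgue_on ?B') \<longlonglongrightarrow> 0" .
  qed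
  have H1: "H1_tendsto ?B' F f"
    unfolding H1_tendsto_def
  proof (intro conjI allI)
    show "L2_tendsto (lebesgue_on ?B') F f"
      by (rule conv[OF Ck_on_continuous[OF F]]) (use FB H_reg_lower[of 0 ?B f] f in auto)
    fix i
    show "\<exists>g. weak_pd ?B' i f g \<and> L2_tendsto (lebesgue_on ?B') (\<lambda>k. pd i (F k)) g"
    proof (intro exI[of _ "pd i f"] conjI)
      show "weak_pd ?B' i f (pd i f)"
        by (rule weak_pd_classical[OF open_half_ball Ck_on_subset[OF fC half_ball_mono]]) (use r in simp)
      show "L2_tendsto (lebesgue_on ?B') (\<lambda>k. pd i (F k)) (pd i f)"
        by (rule conv) (use F pF f in auto)
    qed
  qed
  have L2: "L2_tendsto (patch_measure x r' Q (\<lambda>_. 0)) (\<lambda>k y. F k (P y)) (\<lambda>y. normal_limit n f (P y))"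
  proof -
    have PK: "P y \<in> K" if "y \<in> disc r'" for y
      using P_inner[of y 0] P_norm[of y] that by (simp add: K_def dist_norm norm_minus_commute)
    note s = slices(1)[OF f r(2) N, unfolded L2_tendsto_def]
    have eq: "F k (P y) - normal_limit n f (P y) = f (P y + ?s k *\<^sub>R n) - normal_limit n f (P y)" if "y \<in> space (lebesgue_on (disc r'))" for k y
      using FB[OF PK] that by simp
    have i: "(\<integral>y. (norm (F k (P y) - normal_limit n f (P y)))\<^sup>2 \<partial>lebesgue_on (disc r'))
      = (\<integral>y. (norm (f (P y + ?s k *\<^sub>R n) - normal_limit n f (P y)))\<^sup>2 \<partial>lebesgue_on (disc r'))" for k
      by (rule Bochner_Integration.integral_cong[OF refl]) (simp only: eq)
    have "L2 (lebesgue_on (disc r')) (\<lambda>y. F k (P y) - normal_limit n f (P y))" for k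
    proof (rule L2_cong_AE)
      show "L2 (lebesgue_on (disc r')) (\<lambda>y. f (P y + ?s k *\<^sub>R n) - normal_limit n f (P y))" using s by blast
      show "(\<lambda>y. F k (P y) - normal_limit n f (P y)) \<in> borel_measurable (lebesgue_on (disc r'))"
        using s by (subst measurable_cong[OF eq]) (auto simp: L2_def)
      show "AE y in lebesgue_on (disc r'). f (P y + ?s k *\<^sub>R n) - normal_limit n f (P y) = F k (P y) - normal_limit n f (P y)"
        by (intro AE_I2) (simp only: eq)
    qed
    with s show ?thesis unfolding patch_measure_flat L2_tendsto_def i by blast
  qed
  show ?thesis by (rule that[OF F H1 L2])
qed

end


section \<open>Uniqueness of traces and tangential derivatives\<close>

lemma sum3_power2_le: "(a + b + c)\<^sup>2 \<le> 3 * (a\<^sup>2 + b\<^sup>2 + (c::real)\<^sup>2)"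
  using sum_squares_ge_zero[of "a - b" "b - c"] zero_le_power2[of "a - c"]
  by (simp add: power2_eq_square algebra_simps)

lemma norm_dir_deriv_le:
  fixes f :: "real^3 \<Rightarrow> 'b::real_normed_vector"
  assumes "norm v = 1"
  shows "(norm (dir_deriv v f z))\<^sup>2 \<le> 3 * (\<Sum>i\<in>UNIV. (norm (pd i f z))\<^sup>2)"
proof -
  have "norm (v$i *\<^sub>R pd i f z) \<le> norm (pd i f z)" for i
    using component_le_norm_cart[of v i] assms by (simp add: mult_left_le_one_le)
  then have "norm (dir_deriv v f z) \<le> (\<Sum>i\<in>UNIV. norm (pd i f z))"
    unfolding dir_deriv_def by (intro sum_norm_le)
  then have "(norm (dir_deriv v f z))\<^sup>2 \<le> (\<Sum>i\<in>UNIV. norm (pd i f z))\<^sup>2"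
    by (intro power_mono) auto
  also have "\<dots> \<le> 3 * (\<Sum>i\<in>UNIV. (norm (pd i f z))\<^sup>2)"
    unfolding sum_3 by (rule sum3_power2_le)
  finally show ?thesis .
qed

context flat_chart
begin

text \<open>The trace inequality applied to \<open>G k - f\<close>: its normal limit is bounded in
  L2 by its H1 norm, which tends to 0.\<close>

lemma trace_uniqueness_L2:
  fixes f :: "real^3 \<Rightarrow> 'b::euclidean_space"
  assumes f: "H_reg 1 (half_ball x n r) f" and G: "\<And>k. Ck_on 1 UNIV (G k)"
    and H1: "H1_tendsto (half_ball x n r) G f" and r: "r' < r"
  shows "(\<lambda>k. \<integral>\<^sup>+ y. ennreal ((norm (G k (P y) - normal_limit n f (P y)))\<^sup>2) \<partial>lebesgue_on (disc r')) \<longlonglongrightarrow> 0"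
proof -
  let ?B = "half_ball x n r"
  have fC: "Ck_on 1 ?B f" by (rule H_reg_Ck[OF f])
  have GC: "Ck_on 1 ?B (G k)" for k using Ck_on_subset[OF G] by simp
  have "\<exists>g. weak_pd ?B i f g \<and> L2_tendsto (lebesgue_on ?B) (\<lambda>k. pd i (G k)) g" for i
    using H1 by (simp add: H1_tendsto_def)
  then obtain g where g: "\<And>i. weak_pd ?B i f (g i)" "\<And>i. L2_tendsto (lebesgue_on ?B) (\<lambda>k. pd i (G k)) (g i)" by metis
  have L0: "L2_tendsto (lebesgue_on ?B) G f" using H1 by (simp add: H1_tendsto_def)
  \<comment> \<open>The limit differs by a square integrable function from
    \<open>pd i (G 0)\<close>, which is continuous everywhere and hence square integrable on the
    bounded half ball.\<close>
  have gL: "L2 (lebesgue_on ?B) (g i)" for i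
  proof -
    have "L2 (lebesgue_on ?B) (\<lambda>z. pd i (G 0) z - g i z)" using g(2)[of i] by (simp add: L2_tendsto_def)
    moreover have "L2 (lebesgue_on ?B) (pd i (G 0))" using G[of 0] by (intro L2_continuous) auto
    ultimately have "L2 (lebesgue_on ?B) (\<lambda>z. pd i (G 0) z - (pd i (G 0) z - g i z))" by (rule L2_diff[rotated])
    then show ?thesis by simp
  qed
  have gf: "AE z in lebesgue_on ?B. g i z = pd i f z" for i
    by (rule weak_pd_unique[OF open_half_ball fC g(1) L2_integrable_cbox[OF gL]]) auto
  define V where "V k z = G k z - f z" for k z
  have pV: "pd i (V k) z = pd i (G k) z - pd i f z" if "z \<in> ?B" for i k z
  proof -
    have d: "G k differentiable (at z)" "f differentiable (at z)" using fC GC[of k] that by auto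
    have "pd i (V k) z = pd i (\<lambda>z. G k z + - f z) z" by (simp add: V_def[abs_def])
    also have "\<dots> = pd i (G k) z + pd i (\<lambda>z. - f z) z" using d by (intro pd_add) auto
    also have "pd i (\<lambda>z. - f z) z = - pd i f z"
      by (rule pd_bounded_linear[OF d(2) bounded_linear_minus[OF bounded_linear_ident]])
    finally show ?thesis by simp
  qed
  have VC: "Ck_on 1 ?B (V k)" for k unfolding V_def[abs_def] by (rule Ck_on_diff2[OF open_half_ball GC fC])
  have VL: "L2 (lebesgue_on ?B) (V k)" for k using L0 by (simp add: V_def[abs_def] L2_tendsto_def)
  have pVL: "L2 (lebesgue_on ?B) (pd i (V k))" for i k
  proof (rule L2_cong_AE)
    show "L2 (lebesgue_on ?B) (\<lambda>z. pd i (G k) z - g i z)" using g(2)[of i] by (simp add: L2_tendsto_def)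
    show "pd i (V k) \<in> borel_measurable (lebesgue_on ?B)"
      using VC[of k] by (intro continuous_on_measurable_lebesgue_on) auto
    show "AE z in lebesgue_on ?B. pd i (G k) z - g i z = pd i (V k) z"
      using gf[of i] AE_space by eventually_elim (simp add: pV)
  qed
  have VH: "H_reg 1 ?B (V k)" for k using VC[of k] VL[of k] pVL[of _ k] by simp
  define A where "A k = (\<integral>z. (norm (V k z))\<^sup>2 \<partial>lebesgue_on ?B)" for k
  define B where "B k = (\<integral>z. (norm (dir_deriv n (V k) z))\<^sup>2 \<partial>lebesgue_on ?B)" for k
  define C where "C i k = (\<integral>z. (norm (pd i (V k) z))\<^sup>2 \<partial>lebesgue_on ?B)" for i k
  have A: "A \<longlonglongrightarrow> 0" using L0 by (simp add: L2_tendsto_def A_def[abs_def] V_def)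
  have C: "C i \<longlonglongrightarrow> 0" for i
  proof -
    have "C i k = (\<integral>z. (norm (pd i (G k) z - g i z))\<^sup>2 \<partial>lebesgue_on ?B)" for k
      unfolding C_def
    proof (rule integral_cong_AE)
      show "AE z in lebesgue_on ?B. (norm (pd i (V k) z))\<^sup>2 = (norm (pd i (G k) z - g i z))\<^sup>2"
        using gf[of i] AE_space by eventually_elim (simp add: pV)
    qed (use pVL[of i k] g(2)[of i] in \<open>auto simp: L2_def L2_tendsto_def\<close>)
    then have "C i = (\<lambda>k. \<integral>z. (norm (pd i (G k) z - g i z))\<^sup>2 \<partial>lebesgue_on ?B)" by (rule ext)
    then show ?thesis using g(2)[of i] by (simp add: L2_tendsto_def)
  qed
  have BC: "B k \<le> 3 * (\<Sum>i\<in>UNIV. C i k)" for k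
  proof -
    have pi: "integrable (lebesgue_on ?B) (\<lambda>z. (norm (pd i (V k) z))\<^sup>2)" for i using pVL[of i k] by (simp add: L2_def)
    have di: "integrable (lebesgue_on ?B) (\<lambda>z. (norm (dir_deriv n (V k) z))\<^sup>2)"
      using H_reg_L2[OF H_reg_dir_deriv[OF open_half_ball, of 0 x n r "V k" n]] VH[of k] by (simp add: L2_def)
    have "B k \<le> (\<integral>z. 3 * (\<Sum>i\<in>UNIV. (norm (pd i (V k) z))\<^sup>2) \<partial>lebesgue_on ?B)"
      unfolding B_def using pi di norm_dir_deriv_le[OF norm_n] by (intro integral_mono) auto
    also have "\<dots> = 3 * (\<Sum>i\<in>UNIV. C i k)" unfolding C_def using pi by simp
    finally show ?thesis .
  qed
  let ?\<tau> = "r - r'"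
  have bd: "(\<integral>\<^sup>+ y. ennreal ((norm (G k (P y) - normal_limit n f (P y)))\<^sup>2) \<partial>lebesgue_on (disc r'))
     \<le> ennreal (2 / ?\<tau> * A k + 2 * ?\<tau> * (3 * (\<Sum>i\<in>UNIV. C i k)))" for k
  proof -
    \<comment> \<open>\<open>G k\<close> is continuous across the disc, so its normal limit is its
      value there.\<close>
    have "AE y in lborel. norm y < r' \<longrightarrow> normal_limit n (V k) (P y) = G k (P y) - normal_limit n f (P y)"
      using normal_limit_AE[OF f r]
    proof eventually_elim
      case (elim y)
      have "(\<lambda>j. G k (P y + inverse (real (Suc j)) *\<^sub>R n)) \<longlonglongrightarrow> G k (P y + 0 *\<^sub>R n)"
        using Ck_on_continuous[OF G[of k]]
        by (intro continuous_on_tendsto_compose[of UNIV "G k"] tendsto_intros LIMSEQ_inverse_real_of_nat) auto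
      then have "norm y < r' \<longrightarrow> (\<lambda>j. V k (P y + inverse (real (Suc j)) *\<^sub>R n)) \<longlonglongrightarrow> G k (P y) - normal_limit n f (P y)"
        unfolding V_def using elim by (auto intro: tendsto_diff)
      then show ?case by (auto simp: normal_limit_def[of n "V k"] intro: limI)
    qed
    then have "(\<integral>\<^sup>+ y. indicator (disc r') y * ennreal ((norm (G k (P y) - normal_limit n f (P y)))\<^sup>2) \<partial>lborel)
      = (\<integral>\<^sup>+ y. indicator (disc r') y * ennreal ((norm (normal_limit n (V k) (P y)))\<^sup>2) \<partial>lborel)"
      by (intro nn_integral_cong_AE, eventually_elim) (auto simp: indicator_def)
    also have "\<dots> \<le> ennreal (2 / ?\<tau> * A k + 2 * ?\<tau> * B k)"
      unfolding A_def B_def by (rule estimates(3)[OF VH, of ?\<tau> r']) (use r in auto)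
    also have "\<dots> \<le> ennreal (2 / ?\<tau> * A k + 2 * ?\<tau> * (3 * (\<Sum>i\<in>UNIV. C i k)))"
      using BC[of k] r by (intro ennreal_leI add_left_mono mult_left_mono) auto
    finally show ?thesis unfolding nn_integral_lebesgue_on[OF disc_lebesgue] .
  qed
  have "(\<lambda>k. ennreal (2 / ?\<tau> * A k + 2 * ?\<tau> * (3 * (\<Sum>i\<in>UNIV. C i k)))) \<longlonglongrightarrow> ennreal (2 / ?\<tau> * 0 + 2 * ?\<tau> * (3 * (\<Sum>i\<in>(UNIV::3 set). 0)))"
    by (intro tendsto_ennrealI tendsto_add tendsto_mult tendsto_const tendsto_sum A C)
  then have lim: "(\<lambda>k. ennreal (2 / ?\<tau> * A k + 2 * ?\<tau> * (3 * (\<Sum>i\<in>UNIV. C i k)))) \<longlonglongrightarrow> 0" by simp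
  show ?thesis
    by (rule tendsto_sandwich[OF _ _ tendsto_const lim]) (use bd in auto)
qed

text \<open>Order 2 gives the derivative itself a normal limit in L2, so both sides of the
  integration by parts against a bump converge. The side with \<open>f\<close> undifferentiated
  tends to 0, and the bumps determine the other.\<close>

lemma tangential_derivative_trace_zero:
  fixes f :: "real^3 \<Rightarrow> 'b::euclidean_space"
  assumes f: "H_reg 2 (half_ball x n r) f" and r: "r' < r"
    and z: "AE y in lborel. norm y < r' \<longrightarrow> normal_limit n f (P y) = 0"
  shows "AE y in lborel. norm y < r' \<longrightarrow> normal_limit n (dir_deriv (Q (join3 (t, 0))) f) (P y) = 0"
proof -
  obtain N where N: "inverse (real (Suc N)) < r - r'" using reals_Archimedean[of "r - r'"] r by auto
  define v where "v = Q (join3 (t, 0))"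
  let ?B = "half_ball x n r" and ?s = "step N"
  have sk: "0 < ?s k" "?s k < r - r'" for k using step(2,3)[of N k] N by auto
  have f1: "H_reg 1 ?B f" using f H_reg_lower[of 1 ?B f] by (simp add: numeral_2_eq_2)
  have d1: "H_reg 1 ?B (dir_deriv v f)" using H_reg_dir_deriv[OF open_half_ball, of 1 x n r f v] f by (simp add: numeral_2_eq_2)
  note sf = slices[OF f1 r N] and sd = slices[OF d1 r N]
  have fin: "finite_measure (lebesgue_on (disc r'))"
    by (intro finite_measure_lebesgue_on bounded_set_imp_lmeasurable bounded_disc disc_lebesgue)
  note ib = L2_integrable_bounded[OF _ bounded_disc disc_lebesgue]
  define L where "L y = Q (join3 (y, 0))" for y
  have linL: "linear L"
  proof -
    have "linear (\<lambda>y::real^2. join3 (y, 0))" by (rule linearI) (auto simp: vec_eq_iff forall_3)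
    from linear_compose[OF this lin] show ?thesis by (simp add: L_def[abs_def] o_def)
  qed
  \<comment> \<open>The restriction of \<open>f\<close> to the disc at height \<open>?s k\<close>,
    as a function of the two disc parameters; its directional derivatives are the tangential
    derivatives of \<open>f\<close>.\<close>
  define h where "h k y = f ((x + ?s k *\<^sub>R n) + L y)" for k y
  have hP: "h k y = f (P y + ?s k *\<^sub>R n)" for k y by (simp add: h_def L_def plane_pt_eq algebra_simps)
  have hd: "(h k has_derivative (\<lambda>w. \<Sum>j\<in>UNIV. L w $ j *\<^sub>R pd j f (P y + ?s k *\<^sub>R n))) (at y)" if "y \<in> disc r'" for k y
  proof -
    have "P y + ?s k *\<^sub>R n \<in> ?B" by (rule disc_cylinder[OF that sk])
    then have "f differentiable (at ((x + ?s k *\<^sub>R n) + L y))" using f1 by (simp add: L_def plane_pt_eq algebra_simps)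
    from has_derivative_affine_comp[OF linL this] show ?thesis
      by (simp add: h_def[abs_def] L_def plane_pt_eq algebra_simps)
  qed
  have hC: "Ck_on 1 (disc r') (h k)" for k
  proof (rule Ck_on_subset)
    show "Ck_on 1 {y. (x + ?s k *\<^sub>R n) + L y \<in> ?B} (h k)"
      unfolding h_def[abs_def] by (rule Ck_on_affine[OF open_half_ball linL H_reg_Ck[OF f1]])
    show "disc r' \<subseteq> {y. (x + ?s k *\<^sub>R n) + L y \<in> ?B}"
      using disc_cylinder[OF _ sk] by (auto simp: L_def plane_pt_eq algebra_simps)
  qed
  have dh: "(\<Sum>j\<in>UNIV. t$j *\<^sub>R pd j (h k) y) = dir_deriv v f (P y + ?s k *\<^sub>R n)" if y: "y \<in> disc r'" for k y
  proof -
    have "h k differentiable (at y)" using hC[of k] y by simp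
    from has_derivative_unique[OF has_derivative_pd[OF this] hd[OF y]]
    show ?thesis unfolding dir_deriv_def v_def L_def by (rule fun_cong)
  qed
  define w where "w y = normal_limit n (dir_deriv v f) (P y)" for y
  have zf: "AE y in lebesgue_on (disc r'). normal_limit n f (P y) = 0"
    using AE_completion[OF z] by (subst AE_restrict_space_iff) (auto simp: disc_lebesgue)
  have "AE y in lebesgue_on (disc r'). w y = 0"
  proof (rule AE_eq_0_of_bump_integrals[OF open_disc])
    show "set_integrable lebesgue (cbox a b) w" if "cbox a b \<subseteq> disc r'" for a b
      unfolding w_def by (rule L2_integrable_cbox[OF sd(2) that disc_lebesgue])
    fix m a b assume ab: "cbox a b \<subseteq> disc r'"
    define \<phi> where "\<phi> = box_bump m a b"
    have C: "Ck_on k UNIV \<phi>" for k using smooth_box_bump by (auto simp only: smooth_on_def \<phi>_def)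
    have K: "compact (closure {y. \<phi> y \<noteq> 0})" "closure {y. \<phi> y \<noteq> 0} \<subseteq> disc r'"
      using closure_box_bump[of m a b] ab bounded_subset[OF bounded_cbox closure_box_bump[of m a b]]
      unfolding compact_eq_bounded_closed \<phi>_def by auto
    have \<phi>m: "\<phi> \<in> borel_measurable (lebesgue_on (disc r'))"
      by (rule continuous_on_measurable_lebesgue_on[OF _ open_disc]) (use C[of 0] in \<open>auto intro: continuous_on_subset\<close>)
    have pm: "pd j \<phi> \<in> borel_measurable (lebesgue_on (disc r'))" for j
      by (rule continuous_on_measurable_lebesgue_on[OF _ open_disc]) (use C[of 1] in \<open>auto intro: continuous_on_subset\<close>)
    \<comment> \<open>\<open>L2_tendsto_integral\<close> admits bounded multipliers only; the
      derivatives of the bump are bounded because they are continuous and live on a compact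
      set.\<close>
    have pb: "\<exists>M. \<forall>y. \<bar>pd j \<phi> y\<bar> \<le> M" for j
    proof -
      have "bounded (pd j \<phi> ` closure {y. \<phi> y \<noteq> 0})"
        using C[of 1] by (intro compact_imp_bounded compact_continuous_image K(1)) (auto intro: continuous_on_subset)
      then obtain M where M: "M > 0" "\<And>y. y \<in> closure {y. \<phi> y \<noteq> 0} \<Longrightarrow> \<bar>pd j \<phi> y\<bar> \<le> M" unfolding bounded_pos by auto
      have "pd j \<phi> y = 0" if "y \<notin> closure {y. \<phi> y \<noteq> 0}" for y
        by (rule pd_zero_outside[OF _ _ that]) (use closure_subset[of "{y. \<phi> y \<noteq> 0}"] in auto)
      then have "\<bar>pd j \<phi> y\<bar> \<le> M" for y using M by (cases "y \<in> closure {y. \<phi> y \<noteq> 0}") auto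
      then show ?thesis by blast
    qed
    have hz: "(\<lambda>k. \<integral>y. pd j \<phi> y *\<^sub>R h k y \<partial>lebesgue_on (disc r')) \<longlonglongrightarrow> 0" for j
    proof -
      obtain M where M: "\<And>y. \<bar>pd j \<phi> y\<bar> \<le> M" using pb by blast
      have "(\<lambda>k. \<integral>y. pd j \<phi> y *\<^sub>R f (P y + ?s k *\<^sub>R n) \<partial>lebesgue_on (disc r'))
         \<longlonglongrightarrow> (\<integral>y. pd j \<phi> y *\<^sub>R normal_limit n f (P y) \<partial>lebesgue_on (disc r'))"
        by (rule L2_tendsto_integral[OF fin sf(1) ib[OF sf(4)] ib[OF sf(2)] pm M])
      also have "(\<integral>y. pd j \<phi> y *\<^sub>R normal_limit n f (P y) \<partial>lebesgue_on (disc r')) = 0"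
        by (rule integral_eq_zero_AE) (use zf in eventually_elim, simp)
      finally show ?thesis by (simp add: hP)
    qed
    have ibp: "(\<integral>y. \<phi> y *\<^sub>R dir_deriv v f (P y + ?s k *\<^sub>R n) \<partial>lebesgue_on (disc r'))
      = - (\<Sum>j\<in>UNIV. t$j *\<^sub>R (\<integral>y. pd j \<phi> y *\<^sub>R h k y \<partial>lebesgue_on (disc r')))" for k
    proof -
      note I = integral_by_parts[OF open_disc hC C K]
      have "(\<integral>y. \<phi> y *\<^sub>R dir_deriv v f (P y + ?s k *\<^sub>R n) \<partial>lebesgue_on (disc r'))
        = (\<integral>y. (\<Sum>j\<in>UNIV. t$j *\<^sub>R (\<phi> y *\<^sub>R pd j (h k) y)) \<partial>lebesgue_on (disc r'))"
        by (rule Bochner_Integration.integral_cong[OF refl])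
           (simp add: dh[symmetric] scaleR_sum_right mult.commute)
      also have "\<dots> = (\<Sum>j\<in>UNIV. t$j *\<^sub>R (\<integral>y. \<phi> y *\<^sub>R pd j (h k) y \<partial>lebesgue_on (disc r')))"
        using integrable_scaleR_right[OF I(2)] by (simp only: Bochner_Integration.integral_sum integral_scaleR_right)
      also have "\<dots> = - (\<Sum>j\<in>UNIV. t$j *\<^sub>R (\<integral>y. pd j \<phi> y *\<^sub>R h k y \<partial>lebesgue_on (disc r')))"
        by (simp add: I(3) sum_negf)
      finally show ?thesis .
    qed
    have "(\<lambda>k. \<integral>y. \<phi> y *\<^sub>R dir_deriv v f (P y + ?s k *\<^sub>R n) \<partial>lebesgue_on (disc r'))
         \<longlonglongrightarrow> (\<integral>y. \<phi> y *\<^sub>R normal_limit n (dir_deriv v f) (P y) \<partial>lebesgue_on (disc r'))"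
      by (rule L2_tendsto_integral[OF fin sd(1) ib[OF sd(4)] ib[OF sd(2)] \<phi>m, of 1]) (auto simp: \<phi>_def box_bump_bounds)
    moreover have "(\<lambda>k. \<integral>y. \<phi> y *\<^sub>R dir_deriv v f (P y + ?s k *\<^sub>R n) \<partial>lebesgue_on (disc r')) \<longlonglongrightarrow> - (\<Sum>j\<in>(UNIV::2 set). t$j *\<^sub>R 0)"
      unfolding ibp by (intro tendsto_intros hz)
    ultimately have "(\<integral>y. \<phi> y *\<^sub>R normal_limit n (dir_deriv v f) (P y) \<partial>lebesgue_on (disc r')) = - (\<Sum>j\<in>(UNIV::2 set). t$j *\<^sub>R 0)"
      by (rule LIMSEQ_unique)
    then show "(\<integral>y. box_bump m a b y *\<^sub>R w y \<partial>lebesgue_on (disc r')) = 0"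
      by (simp add: w_def \<phi>_def)
  qed
  then have "AE y in lebesgue. norm y < r' \<longrightarrow> w y = 0"
    by (subst (asm) AE_restrict_space_iff) (auto simp: disc_lebesgue)
  then show ?thesis unfolding w_def v_def by (simp add: AE_completion_iff)
qed

end


section \<open>Flatness of the boundary piece\<close>

text \<open>Two candidates m and \<nu> cannot both qualify: v = m - \<nu> points strictly inwards
  for \<nu> and strictly outwards for m, so a short multiple of it would lie both in and outside
  \<open>D\<close>.\<close>

lemma outward_normal_eqI:
  assumes \<nu>: "norm \<nu> = 1"
    and half: "\<And>\<epsilon>. \<epsilon> > 0 \<Longrightarrow> \<exists>\<delta>>0. \<forall>y\<in>ball x \<delta>.
        ((y - x) \<bullet> \<nu> < - \<epsilon> * norm (y - x) \<longrightarrow> y \<in> D) \<and> ((y - x) \<bullet> \<nu> > \<epsilon> * norm (y - x) \<longrightarrow> y \<notin> D)"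
  shows "outward_normal D x = \<nu>"
  unfolding outward_normal_def
proof (rule the_equality)
  show "norm \<nu> = 1 \<and> (\<forall>\<epsilon>>0. \<exists>\<delta>>0. \<forall>y\<in>ball x \<delta>.
        ((y - x) \<bullet> \<nu> < - \<epsilon> * norm (y - x) \<longrightarrow> y \<in> D) \<and> ((y - x) \<bullet> \<nu> > \<epsilon> * norm (y - x) \<longrightarrow> y \<notin> D))"
    using assms by blast
  fix m assume m: "norm m = 1 \<and> (\<forall>\<epsilon>>0. \<exists>\<delta>>0. \<forall>y\<in>ball x \<delta>.
        ((y - x) \<bullet> m < - \<epsilon> * norm (y - x) \<longrightarrow> y \<in> D) \<and> ((y - x) \<bullet> m > \<epsilon> * norm (y - x) \<longrightarrow> y \<notin> D))"
  show "m = \<nu>"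
  proof (rule ccontr)
    assume ne: "m \<noteq> \<nu>"
    define v where "v = m - \<nu>"
    define b where "b = 1 - m \<bullet> \<nu>"
    have nv: "norm v > 0" using ne by (simp add: v_def)
    have mm: "m \<bullet> m = 1" "\<nu> \<bullet> \<nu> = 1" using m \<nu> by (simp_all add: dot_square_norm)
    have "v \<bullet> v = 2 * b" by (simp add: v_def b_def inner_diff_left inner_diff_right mm inner_commute)
    then have b: "b > 0" using nv by (metis inner_gt_zero_iff zero_less_mult_pos zero_less_norm_iff zero_less_numeral)
    have vi: "v \<bullet> \<nu> = - b" "v \<bullet> m = b" by (simp_all add: v_def b_def inner_diff_left inner_diff_right mm inner_commute)
    \<comment> \<open>Half of b / |v|: at x + s v both inner products have absolute value s b, which
      exceeds \<epsilon> s |v|.\<close>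
    define \<epsilon> where "\<epsilon> = b / (2 * norm v)"
    have \<epsilon>: "\<epsilon> > 0" "\<epsilon> * norm v < b" using nv b by (simp_all add: \<epsilon>_def)
    obtain \<delta>1 where d1: "\<delta>1 > 0" "\<forall>y\<in>ball x \<delta>1. (y - x) \<bullet> \<nu> < - \<epsilon> * norm (y - x) \<longrightarrow> y \<in> D"
      using half[OF \<epsilon>(1)] by blast
    obtain \<delta>2 where d2: "\<delta>2 > 0" "\<forall>y\<in>ball x \<delta>2. (y - x) \<bullet> m > \<epsilon> * norm (y - x) \<longrightarrow> y \<notin> D"
      using m \<epsilon>(1) by blast
    define s where "s = min \<delta>1 \<delta>2 / (2 * norm v)"
    have s: "s > 0" "s * norm v < \<delta>1" "s * norm v < \<delta>2" using d1 d2 nv by (auto simp: s_def)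
    define y where "y = x + s *\<^sub>R v"
    have yb: "y \<in> ball x \<delta>1" "y \<in> ball x \<delta>2" using s by (simp_all add: y_def dist_norm)
    have es: "\<epsilon> * (s * norm v) < s * b" using mult_strict_left_mono[OF \<epsilon>(2) s(1)] by (simp add: algebra_simps)
    have ny: "norm (y - x) = s * norm v" using s(1) by (simp add: y_def)
    have i: "(y - x) \<bullet> \<nu> = - (s * b)" "(y - x) \<bullet> m = s * b" by (simp_all add: y_def vi)
    have "y \<in> D" using d1(2) yb(1) es by (simp add: ny i)
    moreover have "y \<notin> D" using d2(2) yb(2) es by (simp add: ny i)
    ultimately show False by simp
  qed
qed

section \<open>Chart coordinates and the frontier of a subgraph\<close>

definition proj2 :: "real^3 \<Rightarrow> real^2" where "proj2 p = vector [p$1, p$2]"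

lemma proj2_nth [simp]: "proj2 p $ 1 = p $ 1" "proj2 p $ 2 = p $ 2" by (simp_all add: proj2_def)

lemma linear_proj2: "linear proj2" by (rule linearI) (auto simp: vec_eq_iff forall_2)

lemma join3_proj2: "join3 (proj2 p, p $ 3) = p" by (simp add: vec_eq_iff forall_3)

lemma proj2_join3: "proj2 (join3 (y, s)) = y" by (simp add: vec_eq_iff forall_2)

lemma inner_join3: "join3 (y, s) \<bullet> join3 (z, t) = y \<bullet> z + s * t"
  by (simp add: inner_vec_def sum_3 sum_2)

lemma norm_join3: "(norm (join3 (y, s)))\<^sup>2 = (norm y)\<^sup>2 + s\<^sup>2"
  unfolding power2_norm_eq_inner inner_join3 by (simp add: power2_eq_square)

lemma norm_join3_ge: "norm y \<le> norm (join3 (y, s))"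
  by (rule power2_le_imp_le) (simp_all add: norm_join3)

lemma join3_diff: "join3 (y, s) - join3 (z, t) = join3 (y - z, s - t)"
  by (simp add: vec_eq_iff forall_3)

lemma graph_map_eq: "graph_map x P h y = x + P (join3 (y, h y))"
  by (simp add: graph_map_def join3_def)

lemma subgraph_near_eq:
  "subgraph_near D x r P h \<longleftrightarrow> 0 < r \<and> orthogonal_transformation P \<and>
     D \<inter> ball x r = {x + P (join3 (y, s)) | y s. s < h y} \<inter> ball x r"
  by (simp add: subgraph_near_def join3_def)

lemma inv_orthogonal:
  fixes P :: "real^3 \<Rightarrow> real^3"
  assumes "orthogonal_transformation P"
  shows "linear (inv P)" "inv P (P v) = v" "P (inv P w) = w"
proof -
  have b: "bij P" by (rule orthogonal_transformation_bij[OF assms])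
  show "linear (inv P)" by (rule orthogonal_transformation_linear[OF orthogonal_transformation_inv[OF assms]])
  show "inv P (P v) = v" by (rule inv_f_f[OF bij_is_inj[OF b]])
  show "P (inv P w) = w" by (rule surj_f_inv_f[OF bij_is_surj[OF b]])
qed

lemma chart_coordinates:
  fixes P :: "real^3 \<Rightarrow> real^3"
  assumes "orthogonal_transformation P"
  shows "x + P (join3 (proj2 (inv P (z - x)), inv P (z - x) $ 3)) = z"
  by (simp add: join3_proj2 inv_orthogonal[OF assms])

lemma subgraph_mem:
  assumes "subgraph_near D x r P h" "x + P (join3 (y, s)) \<in> ball x r"
  shows "x + P (join3 (y, s)) \<in> D \<longleftrightarrow> s < h y"
proof -
  have P: "orthogonal_transformation P" using assms(1) by (simp add: subgraph_near_eq)
  have inj: "y' = y \<and> s' = s" if "x + P (join3 (y', s')) = x + P (join3 (y, s))" for y' s'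
  proof -
    have "join3 (y', s') = join3 (y, s)" using that inv_orthogonal(2)[OF P] by (metis add_left_cancel)
    then show ?thesis by (metis proj2_join3 join3_nth(3) snd_conv)
  qed
  define X where "X = {x + P (join3 (y, s)) | y s. s < h y}"
  have "D \<inter> ball x r = X \<inter> ball x r" using assms(1) by (simp add: subgraph_near_eq X_def)
  then have "x + P (join3 (y, s)) \<in> D \<longleftrightarrow> x + P (join3 (y, s)) \<in> X" using assms(2) by blast
  also have "\<dots> \<longleftrightarrow> s < h y"
  proof
    assume "x + P (join3 (y, s)) \<in> X"
    then obtain y' s' where "x + P (join3 (y, s)) = x + P (join3 (y', s'))" "s' < h y'"
      unfolding X_def by blast
    with inj[of y' s'] show "s < h y" by metis
  qed (auto simp: X_def)
  finally show ?thesis .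
qed

text \<open>Points below the graph are interior and points above it exterior, both by continuity of
  \<open>h\<close>. A point of the graph is outside \<open>D\<close> but is the limit of the points
  just below it.\<close>

lemma frontier_subgraph:
  assumes sg: "subgraph_near D x r P h" and h: "continuous_on UNIV h" and z: "x + P (join3 (y, s)) \<in> ball x r"
  shows "x + P (join3 (y, s)) \<in> frontier D \<longleftrightarrow> s = h y"
proof -
  have P: "orthogonal_transformation P" using sg by (simp add: subgraph_near_eq)
  define Y where "Y z = proj2 (inv P (z - x))" for z
  define T where "T z = inv P (z - x) $ 3" for z
  have zYT: "x + P (join3 (Y z, T z)) = z" for z unfolding Y_def T_def by (rule chart_coordinates[OF P])
  have YT: "Y (x + P (join3 (y, s))) = y" "T (x + P (join3 (y, s))) = s" for y s
    by (simp_all add: Y_def T_def inv_orthogonal[OF P] proj2_join3)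
  have ci: "continuous_on UNIV (\<lambda>z. inv P (z - x))"
    by (rule continuous_on_linear[OF inv_orthogonal(1)[OF P]]) (intro continuous_intros)
  have cY: "continuous_on UNIV Y" unfolding Y_def by (rule continuous_on_linear[OF linear_proj2 ci])
  have cT: "continuous_on UNIV T" unfolding T_def by (intro continuous_intros ci)
  have chY: "continuous_on UNIV (\<lambda>z. h (Y z))" by (rule continuous_on_compose2[OF h cY]) auto
  have mem: "z \<in> D \<longleftrightarrow> T z < h (Y z)" if "z \<in> ball x r" for z
    using subgraph_mem[OF sg, of "Y z" "T z"] that by (simp only: zYT)
  let ?z = "x + P (join3 (y, s))"
  consider "s < h y" | "s > h y" | "s = h y" by linarith
  then show ?thesis
  proof cases
    case 1
    have "open (ball x r \<inter> {z. T z < h (Y z)})" by (intro open_Int open_ball open_Collect_less cT chY)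
    moreover have "ball x r \<inter> {z. T z < h (Y z)} \<subseteq> D" using mem by blast
    moreover have "?z \<in> ball x r \<inter> {z. T z < h (Y z)}" using z 1 by (simp add: YT)
    ultimately have "?z \<in> interior D" by (meson interiorI)
    then show ?thesis using 1 by (simp add: frontier_def)
  next
    case 2
    have o: "open (ball x r \<inter> {z. h (Y z) < T z})" by (intro open_Int open_ball open_Collect_less cT chY)
    have "(ball x r \<inter> {z. h (Y z) < T z}) \<inter> D = {}" using mem by fastforce
    then have "(ball x r \<inter> {z. h (Y z) < T z}) \<inter> closure D = {}" using open_Int_closure_eq_empty[OF o] by simp
    moreover have "?z \<in> ball x r \<inter> {z. h (Y z) < T z}" using z 2 by (simp add: YT)
    ultimately have "?z \<notin> closure D" by blast
    then show ?thesis using 2 by (simp add: frontier_def)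
  next
    case 3
    have nD: "?z \<notin> D" using subgraph_mem[OF sg z] 3 by simp
    then have "?z \<notin> interior D" using interior_subset by blast
    moreover have "?z \<in> closure D"
    proof -
      define w where "w k = x + P (join3 (y, s - inverse (real (Suc k))))" for k
      have "w \<longlonglongrightarrow> x + P (join3 (y, s - 0))"
      proof -
        have cP: "continuous_on UNIV P" using continuous_on_linear[OF orthogonal_transformation_linear[OF P] continuous_on_id] by simp
        have cJ: "continuous_on UNIV join3" using continuous_on_linear[OF linear_join3 continuous_on_id] by simp
        have "(\<lambda>k. join3 (y, s - inverse (real (Suc k)))) \<longlonglongrightarrow> join3 (y, s - 0)"
          by (rule continuous_on_tendsto_compose[OF cJ]) (intro tendsto_intros LIMSEQ_inverse_real_of_nat, auto)
        then have "(\<lambda>k. P (join3 (y, s - inverse (real (Suc k))))) \<longlonglongrightarrow> P (join3 (y, s - 0))"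
          by (rule continuous_on_tendsto_compose[OF cP]) auto
        then show ?thesis unfolding w_def by (intro tendsto_intros)
      qed
      then have wl: "w \<longlonglongrightarrow> ?z" by simp
      have "\<forall>\<^sub>F k in sequentially. w k \<in> D"
        using topological_tendstoD[OF wl open_ball z]
      proof eventually_elim
        case (elim k)
        then show ?case using subgraph_mem[OF sg, of y "s - inverse (real (Suc k))"] 3 by (simp add: w_def)
      qed
      then have "\<forall>\<^sub>F k in sequentially. w k \<in> closure D"
        by (rule eventually_mono) (use closure_subset[of D] in auto)
      then show ?thesis by (rule Lim_in_closed_set[OF closed_closure _ trivial_limit_sequentially wl])
    qed
    ultimately show ?thesis using 3 by (simp add: frontier_def)
  qed
qed

text \<open>The upward unit normal of a graph with gradient \<open>a\<close>, rotated into the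
  chart; upward means outward since \<open>D\<close> lies below.\<close>

definition graph_normal :: "(real^3 \<Rightarrow> real^3) \<Rightarrow> real^2 \<Rightarrow> real^3" where
  "graph_normal P a = P (join3 (- a, 1)) /\<^sub>R sqrt (1 + (norm a)\<^sup>2)"

lemma graph_normal_inner:
  assumes "orthogonal_transformation P"
  shows "P (join3 (u, t)) \<bullet> graph_normal P a = (t - a \<bullet> u) / sqrt (1 + (norm a)\<^sup>2)" "norm (graph_normal P a) = 1"
proof -
  show 1: "P (join3 (u, t)) \<bullet> graph_normal P a = (t - a \<bullet> u) / sqrt (1 + (norm a)\<^sup>2)" for u t
    using assms by (simp add: graph_normal_def orthogonal_transformation_def inner_join3 inner_commute divide_inverse mult.commute)
  have "(norm (join3 (- a, 1)))\<^sup>2 = 1 + (norm a)\<^sup>2" by (simp add: norm_join3)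
  then have "norm (join3 (- a, 1)) = sqrt (1 + (norm a)\<^sup>2)" using real_sqrt_abs[of "norm (join3 (- a, 1))"] by simp
  moreover have "sqrt (1 + (norm a)\<^sup>2) > 0" by (simp add: add_pos_nonneg)
  ultimately show "norm (graph_normal P a) = 1"
    using assms by (simp add: graph_normal_def orthogonal_transformation_norm)
qed

text \<open>Up to the factor sqrt (1 + |a|^2), the inner product with this normal is the height
  above the tangent plane. It differs from the height above the graph by the first order Taylor
  remainder, and since the factor is at least 1, the same \<epsilon> absorbs that remainder.\<close>

lemma outward_normal_graph:
  assumes sg: "subgraph_near D x r P h" and z0: "graph_map x P h y0 \<in> ball x r"
    and h: "(h has_derivative (\<lambda>u. a \<bullet> u)) (at y0)"
  shows "outward_normal D (graph_map x P h y0) = graph_normal P a"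
proof (rule outward_normal_eqI)
  have P: "orthogonal_transformation P" using sg by (simp add: subgraph_near_eq)
  have linP: "linear P" by (rule orthogonal_transformation_linear[OF P])
  show "norm (graph_normal P a) = 1" by (rule graph_normal_inner(2)[OF P])
  let ?z0 = "graph_map x P h y0" and ?c = "sqrt (1 + (norm a)\<^sup>2)"
  have c1: "?c \<ge> 1" by simp
  fix \<epsilon> :: real assume \<epsilon>: "\<epsilon> > 0"
  obtain \<delta>1 where d1: "\<delta>1 > 0" "\<And>y. norm (y - y0) < \<delta>1 \<Longrightarrow> \<bar>h y - h y0 - a \<bullet> (y - y0)\<bar> \<le> \<epsilon> * norm (y - y0)"
    using h \<epsilon> unfolding has_derivative_at_alt by (auto simp: dist_norm)
  obtain \<delta>2 where d2: "\<delta>2 > 0" "ball ?z0 \<delta>2 \<subseteq> ball x r" using z0 open_contains_ball[of "ball x r"] by blast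
  show "\<exists>\<delta>>0. \<forall>z\<in>ball ?z0 \<delta>.
     ((z - ?z0) \<bullet> graph_normal P a < - \<epsilon> * norm (z - ?z0) \<longrightarrow> z \<in> D) \<and>
     ((z - ?z0) \<bullet> graph_normal P a > \<epsilon> * norm (z - ?z0) \<longrightarrow> z \<notin> D)"
  proof (intro exI[of _ "min \<delta>1 \<delta>2"] conjI ballI)
    show "0 < min \<delta>1 \<delta>2" using d1 d2 by simp
    fix z assume z: "z \<in> ball ?z0 (min \<delta>1 \<delta>2)"
    define y where "y = proj2 (inv P (z - x))"
    define s where "s = inv P (z - x) $ 3"
    have zz: "x + P (join3 (y, s)) = z" unfolding y_def s_def by (rule chart_coordinates[OF P])
    have df: "z - ?z0 = P (join3 (y - y0, s - h y0))"
      unfolding zz[symmetric] graph_map_eq by (simp add: linear_diff[OF linP, symmetric] join3_diff)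
    have i: "(z - ?z0) \<bullet> graph_normal P a = (s - h y0 - a \<bullet> (y - y0)) / ?c"
      unfolding df by (rule graph_normal_inner(1)[OF P])
    have nle: "norm (y - y0) \<le> norm (z - ?z0)"
      unfolding df using norm_join3_ge P by (simp add: orthogonal_transformation_norm)
    have "norm (z - ?z0) < \<delta>1" using z by (simp add: dist_norm norm_minus_commute)
    then have hd: "\<bar>h y - h y0 - a \<bullet> (y - y0)\<bar> \<le> \<epsilon> * norm (y - y0)" using nle by (intro d1(2)) simp
    have zb: "z \<in> ball x r" using z d2(2) by auto
    then have mem: "z \<in> D \<longleftrightarrow> s < h y" using subgraph_mem[OF sg, of y s] by (simp only: zz)
    have cle: "\<epsilon> * norm (y - y0) \<le> \<epsilon> * norm (z - ?z0) * ?c"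
    proof -
      have "norm (y - y0) \<le> norm (z - ?z0) * ?c" using nle mult_left_mono[OF c1, of "norm (z - ?z0)"] by simp
      then show ?thesis using \<epsilon> by (simp add: mult.assoc)
    qed
    have cpos: "?c > 0" using c1 by linarith
    show "(z - ?z0) \<bullet> graph_normal P a < - \<epsilon> * norm (z - ?z0) \<longrightarrow> z \<in> D"
    proof
      assume "(z - ?z0) \<bullet> graph_normal P a < - \<epsilon> * norm (z - ?z0)"
      then have "s - h y0 - a \<bullet> (y - y0) < - \<epsilon> * norm (z - ?z0) * ?c"
        unfolding i using cpos by (simp add: pos_divide_less_eq)
      then show "z \<in> D" unfolding mem using cle hd by (simp add: abs_le_iff)
    qed
    show "(z - ?z0) \<bullet> graph_normal P a > \<epsilon> * norm (z - ?z0) \<longrightarrow> z \<notin> D"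
    proof
      assume "(z - ?z0) \<bullet> graph_normal P a > \<epsilon> * norm (z - ?z0)"
      then have "s - h y0 - a \<bullet> (y - y0) > \<epsilon> * norm (z - ?z0) * ?c"
        unfolding i using cpos by (simp add: pos_less_divide_eq)
      then show "z \<notin> D" unfolding mem using cle hd by (simp add: abs_le_iff)
    qed
  qed
qed

text \<open>The remainder of the expansion is orthogonal to e1, e2 and \<nu>; were it nonzero, there
  would be four independent vectors in dimension 3.\<close>

lemma orthonormal_pair_expansion:
  fixes v :: "real^3"
  assumes "norm e1 = 1" "norm e2 = 1" "e1 \<bullet> e2 = 0" "e1 \<bullet> \<nu> = 0" "e2 \<bullet> \<nu> = 0" "norm \<nu> = 1" "v \<bullet> \<nu> = 0"
  shows "v = (v \<bullet> e1) *\<^sub>R e1 + (v \<bullet> e2) *\<^sub>R e2"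
proof (rule ccontr)
  assume ne: "v \<noteq> (v \<bullet> e1) *\<^sub>R e1 + (v \<bullet> e2) *\<^sub>R e2"
  define w where "w = v - (v \<bullet> e1) *\<^sub>R e1 - (v \<bullet> e2) *\<^sub>R e2"
  have w0: "w \<noteq> 0" using ne by (auto simp: w_def algebra_simps)
  have sq: "e1 \<bullet> e1 = 1" "e2 \<bullet> e2 = 1" "\<nu> \<bullet> \<nu> = 1" using assms by (simp_all add: dot_square_norm)
  have o: "w \<bullet> e1 = 0" "w \<bullet> e2 = 0" "w \<bullet> \<nu> = 0"
    using assms by (simp_all add: w_def inner_diff_left inner_diff_right sq inner_commute)
  have nz: "e1 \<noteq> 0" "e2 \<noteq> 0" "\<nu> \<noteq> 0" using assms by auto
  have "pairwise orthogonal {e1, e2, \<nu>, w}"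
    using assms o by (auto simp: pairwise_def orthogonal_def inner_commute)
  then have "independent {e1, e2, \<nu>, w}"
    using nz w0 by (intro pairwise_orthogonal_independent) auto
  then have "card {e1, e2, \<nu>, w} \<le> 3" using independent_bound[of "{e1, e2, \<nu>, w}"] by simp
  moreover have "card {e1, e2, \<nu>, w} = 4"
  proof -
    have "e1 \<noteq> e2" "e1 \<noteq> \<nu>" "e1 \<noteq> w" "e2 \<noteq> \<nu>" "e2 \<noteq> w" "\<nu> \<noteq> w"
      using assms(3-5) o sq by (auto simp: inner_commute)
    then show ?thesis by simp
  qed
  ultimately show False by simp
qed

text \<open>The curvatures come from a derivative taken within the frontier. Pulling the normal back
  by the graph map turns it into an ordinary derivative on a plane ball, where a vanishing
  derivative forces a constant.\<close>

lemma flat_if_curvatures_vanish: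
  assumes patch: "C21_patch D \<Gamma> x r P h" and x: "x \<in> frontier D"
    and K: "\<And>z. z \<in> \<Gamma> \<Longrightarrow> mean_and_gauss_curvature D z 0 0"
  obtains n \<delta> where "norm n = 1" "\<delta> > 0" "\<delta> \<le> r" "\<And>z. z \<in> ball x \<delta> \<Longrightarrow> z \<in> D \<longleftrightarrow> (z - x) \<bullet> n < 0"
proof -
  have sg: "subgraph_near D x r P h" and C2: "C21 h" and fr: "frontier D \<inter> ball x r \<subseteq> \<Gamma>"
    using patch by (auto simp: C21_patch_def)
  have P: "orthogonal_transformation P" and r: "r > 0" using sg by (auto simp: subgraph_near_eq)
  have linP: "linear P" by (rule orthogonal_transformation_linear[OF P])
  have C1: "Ck_on 1 UNIV h" using C2 Ck_on_le[of 2 UNIV h 1] by (simp add: C21_def)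
  have hc: "continuous_on UNIV h" by (rule Ck_on_continuous[OF C1])
  define a where "a y = (\<chi> i. pd i h y)" for y
  have hd: "(h has_derivative (\<lambda>u. a y \<bullet> u)) (at y)" for y
  proof -
    have "h differentiable (at y)" using C1 by simp
    from has_derivative_pd[OF this] show ?thesis by (simp add: a_def inner_vec_def mult.commute)
  qed
  let ?g = "graph_map x P h"
  have h0: "h 0 = 0"
  proof -
    have j: "join3 (0, 0) = 0" using linear_0[OF linear_join3] by (simp add: zero_prod_def)
    show ?thesis using frontier_subgraph[OF sg hc, of 0 0] x r by (simp add: j linear_0[OF linP])
  qed
  have g0: "?g 0 = x" by (simp add: graph_map_eq h0 linear_0[OF linP] linear_0[OF linear_join3] flip: zero_prod_def)
  have gd: "(?g has_derivative (\<lambda>u. P (join3 (u, a y \<bullet> u)))) (at y)" for y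
  proof -
    have "((\<lambda>y. (y, h y)) has_derivative (\<lambda>u. (u, a y \<bullet> u))) (at y)"
      by (rule has_derivative_Pair[OF has_derivative_ident hd])
    then have "((\<lambda>y. join3 (y, h y)) has_derivative (\<lambda>u. join3 (u, a y \<bullet> u))) (at y)"
      by (rule bounded_linear.has_derivative[OF linear_conv_bounded_linear[THEN iffD1, OF linear_join3]])
    then have "((\<lambda>y. P (join3 (y, h y))) has_derivative (\<lambda>u. P (join3 (u, a y \<bullet> u)))) (at y)"
      by (rule bounded_linear.has_derivative[OF linear_conv_bounded_linear[THEN iffD1, OF linP]])
    from has_derivative_add[OF has_derivative_const[of x] this] show ?thesis
      by (simp add: graph_map_eq[abs_def])
  qed
  have gc: "continuous_on UNIV ?g"
    by (rule has_derivative_continuous_on) (use gd in auto)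
  define W where "W = {y. ?g y \<in> ball x r}"
  have oW: "open W" unfolding W_def using open_vimage[OF open_ball gc] by (simp add: vimage_def)
  have "0 \<in> W" using r by (simp add: W_def g0)
  then obtain \<delta>0 where d0: "\<delta>0 > 0" "ball 0 \<delta>0 \<subseteq> W" using oW open_contains_ball by blast
  define N where "N y = outward_normal D (?g y)" for y
  have N: "N y = graph_normal P (a y)" if "y \<in> W" for y
    unfolding N_def using that by (intro outward_normal_graph[OF sg _ hd]) (simp add: W_def)
  have gF: "?g y \<in> frontier D" if "y \<in> W" for y
    using that frontier_subgraph[OF sg hc, of y "h y"] by (simp add: W_def graph_map_eq)
  have gorth: "P (join3 (u, a y \<bullet> u)) \<bullet> N y = 0" if "y \<in> W" for u y
    unfolding N[OF that] graph_normal_inner(1)[OF P] by simp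
  have Nd: "(N has_derivative (\<lambda>u. 0)) (at y)" if y: "y \<in> W" for y
  proof -
    have "?g y \<in> \<Gamma>" using gF[OF y] y fr by (auto simp: W_def)
    then obtain \<kappa>1 \<kappa>2 where k: "principal_curvatures D (?g y) \<kappa>1 \<kappa>2" "0 = (\<kappa>1 + \<kappa>2) / 2" "0 = \<kappa>1 * \<kappa>2"
      using K unfolding mean_and_gauss_curvature_def by blast
    \<comment> \<open>The sum gives \<kappa>2 = - \<kappa>1, so the product is -
      \<kappa>1^2.\<close>
    then have k0: "\<kappa>1 = 0" "\<kappa>2 = 0" by auto
    obtain S e1 e2 where S: "(outward_normal D has_derivative S) (at (?g y) within frontier D)"
      and e: "norm e1 = 1" "norm e2 = 1" "e1 \<bullet> e2 = 0" "e1 \<bullet> N y = 0" "e2 \<bullet> N y = 0"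
      and Se: "S e1 = 0" "S e2 = 0"
      using k(1) unfolding principal_curvatures_def k0 N_def by auto
    have linS: "linear S" by (rule has_derivative_linear[OF S])
    \<comment> \<open>\<open>S\<close> is known to vanish on tangent vectors only, and the
      derivative of the graph map takes its values among them.\<close>
    have "S (P (join3 (u, a y \<bullet> u))) = 0" for u
    proof -
      let ?v = "P (join3 (u, a y \<bullet> u))"
      have "?v = (?v \<bullet> e1) *\<^sub>R e1 + (?v \<bullet> e2) *\<^sub>R e2"
        by (rule orthonormal_pair_expansion[OF e _ gorth[OF y]]) (simp add: N[OF y] graph_normal_inner(2)[OF P])
      then have "S ?v = S ((?v \<bullet> e1) *\<^sub>R e1 + (?v \<bullet> e2) *\<^sub>R e2)" by (rule arg_cong)
      also have "\<dots> = 0" by (simp add: linear_add[OF linS] linear_cmul[OF linS] Se)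
      finally show ?thesis .
    qed
    moreover have "((outward_normal D \<circ> ?g) has_derivative (S \<circ> (\<lambda>u. P (join3 (u, a y \<bullet> u))))) (at y within W)"
    proof (rule diff_chain_within)
      show "(?g has_derivative (\<lambda>u. P (join3 (u, a y \<bullet> u)))) (at y within W)"
        by (rule has_derivative_at_withinI[OF gd])
      show "(outward_normal D has_derivative S) (at (?g y) within ?g ` W)"
        by (rule has_derivative_subset[OF S]) (use gF in auto)
    qed
    ultimately show ?thesis
      using at_within_open[OF y oW] by (simp add: N_def[abs_def] o_def)
  qed
  have "\<exists>c. \<forall>y\<in>ball 0 \<delta>0. N y = c"
    by (rule has_derivative_zero_constant[OF convex_ball]) (use Nd d0 has_derivative_at_withinI in blast)
  then obtain n where Nn: "\<And>y. y \<in> ball 0 \<delta>0 \<Longrightarrow> N y = n" by blast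
  have W0: "(0::real^2) \<in> ball 0 \<delta>0" using d0 by simp
  have n0: "n = graph_normal P (a 0)" using Nn[OF W0] N[of 0] \<open>0 \<in> W\<close> by simp
  \<comment> \<open>From a constant normal to a plane: the height over the plane through
    \<open>x\<close> has derivative 0, because tangent vectors are orthogonal to
    \<open>n\<close>.\<close>
  have "\<exists>c. \<forall>y\<in>ball 0 \<delta>0. (?g y - x) \<bullet> n = c"
  proof (rule has_derivative_zero_constant[OF convex_ball])
    fix y :: "real^2" assume y: "y \<in> ball 0 \<delta>0"
    have "((\<lambda>y. (?g y - x) \<bullet> n) has_derivative (\<lambda>u. P (join3 (u, a y \<bullet> u)) \<bullet> n)) (at y)"
      using gd[of y] by (auto intro!: derivative_eq_intros)
    moreover have "P (join3 (u, a y \<bullet> u)) \<bullet> n = 0" for u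
      using gorth[of y u] Nn[OF y] d0(2) y by auto
    ultimately show "((\<lambda>y. (?g y - x) \<bullet> n) has_derivative (\<lambda>u. 0)) (at y within ball 0 \<delta>0)"
      by (simp add: has_derivative_at_withinI)
  qed
  then have plane: "(?g y - x) \<bullet> n = 0" if "y \<in> ball 0 \<delta>0" for y
    using that W0 g0 by (metis inner_zero_left cancel_comm_monoid_add_class.diff_cancel)
  \<comment> \<open>The cosine of the angle between \<open>n\<close> and the vertical axis of the
    chart. Being positive, it turns \<open>s < h y\<close> into the sign of (z - x) \<bullet>
    n.\<close>
  define c where "c = P (join3 (0, 1)) \<bullet> n"
  have c: "c > 0" unfolding c_def n0 graph_normal_inner(1)[OF P] by (simp add: add_pos_nonneg)
  show ?thesis
  proof (rule that[of n "min \<delta>0 r"])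
    show "norm n = 1" unfolding n0 by (rule graph_normal_inner(2)[OF P])
    show "0 < min \<delta>0 r" "min \<delta>0 r \<le> r" using d0 r by auto
    fix z assume z: "z \<in> ball x (min \<delta>0 r)"
    define y where "y = proj2 (inv P (z - x))"
    define s where "s = inv P (z - x) $ 3"
    have zz: "x + P (join3 (y, s)) = z" unfolding y_def s_def by (rule chart_coordinates[OF P])
    have "norm y \<le> norm (z - x)"
      using norm_join3_ge[of y s] P unfolding zz[symmetric] by (simp add: orthogonal_transformation_norm)
    then have yb: "y \<in> ball 0 \<delta>0" using z by (simp add: dist_norm norm_minus_commute)
    have "z - x = (?g y - x) + (s - h y) *\<^sub>R P (join3 (0, 1))"
    proof -
      have "join3 (y, s) = join3 (y, h y) + (s - h y) *\<^sub>R join3 (0, 1)" by (simp add: vec_eq_iff forall_3)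
      then show ?thesis unfolding zz[symmetric] graph_map_eq
        by (simp add: linear_add[OF linP] linear_cmul[OF linP])
    qed
    then have "(z - x) \<bullet> n = ((?g y - x) + (s - h y) *\<^sub>R P (join3 (0, 1))) \<bullet> n" by (rule arg_cong)
    then have "(z - x) \<bullet> n = (s - h y) * c" using plane[OF yb] by (simp only: inner_add_left inner_scaleR_left c_def)
    then have "(z - x) \<bullet> n < 0 \<longleftrightarrow> s < h y" using c by (simp add: mult_less_0_iff)
    moreover have "z \<in> D \<longleftrightarrow> s < h y" using subgraph_mem[OF sg, of y s] z by (simp add: zz)
    ultimately show "z \<in> D \<longleftrightarrow> (z - x) \<bullet> n < 0" by simp
  qed
qed

section \<open>Charts adapted to a flat boundary point\<close>

lemma C21_zero: "C21 (\<lambda>_. 0)"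
proof -
  have "Ck_on 2 UNIV (\<lambda>_::real^2. 0::real)" by (rule Ck_on_const)
  moreover have "\<exists>L. L-lipschitz_on UNIV (\<lambda>_::real^2. 0::real)" by (intro exI[of _ 0] lipschitz_on_constant)
  ultimately show ?thesis by (simp add: C21_def)
qed

text \<open>The orthogonal map \<open>Q\<close>, with third axis \<open>n\<close>, replaces the map
  of the original chart, whose vertical axis may be tilted against \<open>n\<close>.\<close>

locale flat_boundary = flat_chart +
  fixes D :: "(real^3) set" and \<delta> :: real
  assumes \<delta>: "\<delta> > 0" and flat: "\<And>z. z \<in> ball x \<delta> \<Longrightarrow> z \<in> D \<longleftrightarrow> (z - x) \<bullet> n < 0"
begin

lemma Q_inner: "Q (join3 (y, s)) \<bullet> n = s"
  by (simp add: inner_n)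

lemma subgraph_flat:
  assumes "0 < \<rho>" "\<rho> \<le> \<delta>"
  shows "subgraph_near D x \<rho> Q (\<lambda>_. 0)"
  unfolding subgraph_near_eq
proof (intro conjI assms(1) Q set_eqI iffI)
  fix z assume z: "z \<in> D \<inter> ball x \<rho>"
  define p where "p = inv Q (z - x)"
  have zz: "x + Q (join3 (proj2 p, p $ 3)) = z" unfolding p_def by (rule chart_coordinates[OF Q])
  have "(z - x) \<bullet> n < 0" using z flat[of z] assms by auto
  then have "p $ 3 < 0" unfolding zz[symmetric] by (simp add: Q_inner)
  then show "z \<in> {x + Q (join3 (y, s)) |y s. s < 0} \<inter> ball x \<rho>" using z zz by blast
next
  fix z assume z: "z \<in> {x + Q (join3 (y, s)) |y s. s < 0} \<inter> ball x \<rho>"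
  then obtain y s where "z = x + Q (join3 (y, s))" "s < 0" by blast
  then have "(z - x) \<bullet> n < 0" by (simp add: Q_inner)
  then show "z \<in> D \<inter> ball x \<rho>" using z flat[of z] assms by auto
qed

lemma patch_flat:
  assumes "0 < \<rho>" "\<rho> \<le> \<delta>" "frontier D \<inter> ball x \<rho> \<subseteq> \<Gamma>"
  shows "C21_patch D \<Gamma> x \<rho> Q (\<lambda>_. 0)"
  using assms by (simp add: C21_patch_def subgraph_flat C21_zero)

lemma frontier_flat: "z \<in> ball x \<delta> \<Longrightarrow> z \<in> frontier D \<longleftrightarrow> (z - x) \<bullet> n = 0"
proof -
  assume z: "z \<in> ball x \<delta>"
  define p where "p = inv Q (z - x)"
  have zz: "x + Q (join3 (proj2 p, p $ 3)) = z" unfolding p_def by (rule chart_coordinates[OF Q])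
  have "z \<in> frontier D \<longleftrightarrow> p $ 3 = 0"
    using frontier_subgraph[OF subgraph_flat[OF \<delta> order_refl] continuous_on_const, of "proj2 p" "p $ 3"] z
    by (simp add: zz)
  moreover have "(z - x) \<bullet> n = p $ 3" unfolding zz[symmetric] by (simp add: Q_inner)
  ultimately show ?thesis by simp
qed

lemma exterior_flat:
  assumes "\<rho> \<le> \<delta>"
  shows "ball x \<rho> - closure D = half_ball x n \<rho>"
proof -
  have "z \<in> closure D \<longleftrightarrow> (z - x) \<bullet> n \<le> 0" if "z \<in> ball x \<rho>" for z
  proof -
    have "z \<in> ball x \<delta>" using that assms by auto
    then have "z \<in> D \<longleftrightarrow> (z - x) \<bullet> n < 0" "z \<in> frontier D \<longleftrightarrow> (z - x) \<bullet> n = 0" by (rule flat, rule frontier_flat)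
    moreover have "z \<in> closure D \<longleftrightarrow> z \<in> D \<or> z \<in> frontier D" unfolding closure_Un_frontier[of D] by simp
    ultimately show ?thesis by (simp add: order_le_less)
  qed
  then show ?thesis by (auto simp: half_ball_def not_le)
qed

lemma outward_normal_flat:
  assumes "norm y < \<delta>"
  shows "outward_normal D (P y) = n"
proof -
  have "outward_normal D (graph_map x Q (\<lambda>_. 0) y) = graph_normal Q 0"
    by (rule outward_normal_graph[OF subgraph_flat[OF \<delta> order_refl]]) (use assms P_in_ball in auto)
  also have "graph_normal Q 0 = n"
  proof -
    have "join3 (0, 1) = axis 3 1" by (simp add: vec_eq_iff forall_3 axis_def)
    then show ?thesis by (simp add: graph_normal_def n)
  qed
  finally show ?thesis .
qed

text \<open>The chart \<open>P'\<close>, \<open>h\<close> is the one picked by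
  \<open>has_trace\<close> or \<open>ae_on\<close>. Its graph coincides with the flat disc near
  \<open>x\<close>, so the change of parameters is linear and injective, and its linear left inverse
  sends null sets to null sets.\<close>

lemma AE_transport:
  assumes sg: "subgraph_near D x r P' h" and hC: "Ck_on 1 UNIV h"
    and \<rho>: "\<rho> \<le> r" "\<rho> \<le> \<delta>" "0 < \<rho>"
    and ae: "AE y in patch_measure x r P' h. R (graph_map x P' h y)"
  shows "AE y in lborel. norm y < \<rho> \<longrightarrow> R (P y)"
proof -
  have P': "orthogonal_transformation P'" using sg by (simp add: subgraph_near_eq)
  have hc: "continuous_on UNIV h" by (rule Ck_on_continuous[OF hC])
  let ?W = "{y. graph_map x P' h y \<in> ball x r}"
  have gc: "continuous_on UNIV (graph_map x P' h)"
  proof -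
    have "continuous_on UNIV (\<lambda>y. join3 (y, h y))"
      by (rule continuous_on_linear[OF linear_join3]) (intro continuous_on_Pair continuous_on_id hc)
    then show ?thesis unfolding graph_map_eq[abs_def]
      by (intro continuous_on_add continuous_on_const continuous_on_linear[OF orthogonal_transformation_linear[OF P']])
  qed
  have oW: "open ?W" using open_vimage[OF open_ball gc] by (simp add: vimage_def)
  define J where "J y = sqrt (1 + (\<Sum>i\<in>UNIV. (pd i h y)\<^sup>2))" for y
  have Jm: "(\<lambda>y. ennreal (J y)) \<in> borel_measurable (lebesgue_on ?W)"
  proof -
    have "continuous_on UNIV J" unfolding J_def using hC by (intro continuous_intros) auto
    then have "J \<in> borel_measurable (lebesgue_on ?W)"
      by (intro continuous_on_measurable_lebesgue_on[OF _ oW]) (auto intro: continuous_on_subset)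
    then show ?thesis by measurable
  qed
  have Jp: "J y > 0" for y unfolding J_def by (simp add: add_pos_nonneg sum_nonneg)
  \<comment> \<open>The surface density is positive, so its null sets are those of Lebesgue
    measure.\<close>
  have "AE y in lebesgue_on ?W. R (graph_map x P' h y)"
    using ae unfolding patch_measure_def J_def[symmetric] using Jp by (simp add: AE_density[OF Jm])
  then have aeW: "AE y in lebesgue. y \<in> ?W \<longrightarrow> R (graph_map x P' h y)"
    using oW by (subst (asm) AE_restrict_space_iff) auto
  define Nn where "Nn = {y. \<not> (y \<in> ?W \<longrightarrow> R (graph_map x P' h y))}"
  have negN: "negligible Nn"
  proof -
    obtain M where M: "M \<in> null_sets lebesgue" "Nn \<subseteq> M"
      using aeW unfolding eventually_ae_filter Nn_def by auto
    then show ?thesis using negligible_iff_null_sets negligible_subset by blast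
  qed
  \<comment> \<open>A disc point is expressed in the given chart and its height dropped. The height
    can be recovered from \<open>h\<close>, because points of the disc lie on the frontier.\<close>
  define M where "M y = proj2 (inv P' (Q (join3 (y, 0))))" for y
  have linM: "linear M"
  proof -
    have l1: "linear (\<lambda>y::real^2. join3 (y, 0))" by (rule linearI) (auto simp: vec_eq_iff forall_3)
    show ?thesis using linear_compose[OF linear_compose[OF linear_compose[OF l1 lin] inv_orthogonal(1)[OF P']] linear_proj2]
      by (simp add: M_def[abs_def] o_def)
  qed
  have key: "M y \<in> ?W \<and> graph_map x P' h (M y) = P y" if y: "norm y < \<rho>" for y
  proof -
    have zb: "P y \<in> ball x \<rho>" using P_in_ball y by blast
    then have zr: "P y \<in> ball x r" "P y \<in> ball x \<delta>" using \<rho> by auto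
    have fr: "P y \<in> frontier D" using frontier_flat[OF zr(2)] P_inner[of y 0] by simp
    define s where "s = inv P' (P y - x) $ 3"
    have My: "M y = proj2 (inv P' (P y - x))" by (simp add: M_def plane_pt_eq)
    have zz: "x + P' (join3 (M y, s)) = P y" unfolding My s_def by (rule chart_coordinates[OF P'])
    have "s = h (M y)" using frontier_subgraph[OF sg hc, of "M y" s] fr zr(1) by (simp add: zz)
    then have "graph_map x P' h (M y) = P y" using zz by (simp add: graph_map_eq)
    then show ?thesis using zr(1) by simp
  qed
  have injM: "inj M"
    unfolding linear_injective_0[OF linM]
  proof (intro allI impI)
    fix y assume My: "M y = 0"
    \<comment> \<open>\<open>key\<close> holds only inside the disc, so a vector of the kernel is
      first scaled to norm below \<rho>; adding 1 avoids a division by 0.\<close>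
    define t where "t = \<rho> / (2 * (norm y + 1))"
    have t: "t > 0" using \<rho>(3) by (auto simp: t_def intro!: divide_pos_pos add_nonneg_pos)
    have "t * norm y < \<rho>"
    proof -
      have "t * norm y \<le> t * (norm y + 1)" using t by simp
      also have "\<dots> = \<rho> / 2" unfolding t_def by (simp add: add_nonneg_eq_0_iff field_simps)
      also have "\<dots> < \<rho>" using \<rho>(3) by simp
      finally show ?thesis .
    qed
    then have 1: "norm (t *\<^sub>R y) < \<rho>" using t by simp
    have 0: "norm (0::real^2) < \<rho>" using \<rho>(3) by simp
    have "M (t *\<^sub>R y) = M 0" by (simp add: linear_cmul[OF linM] linear_0[OF linM] My)
    then have "P (t *\<^sub>R y) = P 0" using key[OF 1] key[OF 0] by metis
    then have "norm (P (t *\<^sub>R y) - x) = norm (P 0 - x)" by simp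
    then show "y = 0" unfolding P_norm using t by simp
  qed
  obtain M' where M': "linear M'" "\<And>y. M' (M y) = y"
    using linear_injective_left_inverse[OF linM injM] by (metis comp_apply id_apply)
  have "{y. \<not> (norm y < \<rho> \<longrightarrow> R (P y))} \<subseteq> M' ` Nn"
  proof
    fix y assume y: "y \<in> {y. \<not> (norm y < \<rho> \<longrightarrow> R (P y))}"
    then have "M y \<in> Nn" using key[of y] by (auto simp: Nn_def)
    then show "y \<in> M' ` Nn" using M'(2)[of y] by (metis imageI)
  qed
  moreover have "negligible (M' ` Nn)"
    by (rule negligible_differentiable_image_negligible[OF order_refl negN])
       (rule linear_imp_differentiable_on[OF M'(1)])
  ultimately have "negligible {y. \<not> (norm y < \<rho> \<longrightarrow> R (P y))}" by (rule negligible_subset[rotated])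
  then have "AE y in lebesgue. norm y < \<rho> \<longrightarrow> R (P y)"
    unfolding negligible_iff_null_sets eventually_ae_filter by auto
  then show ?thesis by (simp add: AE_completion_iff)
qed

end


section \<open>Traces on flat pieces\<close>

lemma L2_tendsto_cong:
  assumes "L2_tendsto M F f" "\<And>y. y \<in> space M \<Longrightarrow> f y = g y"
  shows "L2_tendsto M F g"
proof -
  have L: "L2 M (\<lambda>y. F k y - g y)" for k
  proof (rule L2_cong_AE)
    show "L2 M (\<lambda>y. F k y - f y)" using assms(1) by (simp add: L2_tendsto_def)
    then show "(\<lambda>y. F k y - g y) \<in> borel_measurable M"
      using assms(2) by (subst measurable_cong[of M _ "\<lambda>y. F k y - f y"]) (auto simp: L2_def)
    show "AE y in M. F k y - f y = F k y - g y" using assms(2) by (intro AE_I2) simp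
  qed
  have "(\<integral>y. (norm (F k y - g y))\<^sup>2 \<partial>M) = (\<integral>y. (norm (F k y - f y))\<^sup>2 \<partial>M)" for k
    using assms(2) by (intro Bochner_Integration.integral_cong) auto
  with L assms(1) show ?thesis by (simp add: L2_tendsto_def)
qed

lemma L2_tendsto_subseq: "L2_tendsto M F f \<Longrightarrow> strict_mono s \<Longrightarrow> L2_tendsto M (\<lambda>k. F (s k)) f"
  unfolding L2_tendsto_def using LIMSEQ_subseq_LIMSEQ[of "\<lambda>k. \<integral>x. (norm (F k x - f x))\<^sup>2 \<partial>M" 0 s]
  by (simp add: o_def)

lemma L2_tendsto_AE_subseq:
  assumes "L2_tendsto M F f"
  obtains s where "strict_mono s" "AE x in M. (\<lambda>k. F (s k) x) \<longlonglongrightarrow> f x"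
proof -
  have "\<exists>s::nat\<Rightarrow>nat. strict_mono s \<and> (AE x in M. (\<lambda>k. (norm (F (s k) x - f x))\<^sup>2) \<longlonglongrightarrow> 0)"
    by (rule tendsto_L1_AE_subseq) (use assms in \<open>auto simp: L2_tendsto_def L2_def\<close>)
  then obtain s where s: "strict_mono s" "AE x in M. (\<lambda>k. (norm (F (s k) x - f x))\<^sup>2) \<longlonglongrightarrow> 0" by blast
  have "AE x in M. (\<lambda>k. F (s k) x) \<longlonglongrightarrow> f x"
    using s(2)
  proof eventually_elim
    case (elim x)
    then have "(\<lambda>k. sqrt ((norm (F (s k) x - f x))\<^sup>2)) \<longlonglongrightarrow> sqrt 0" by (rule tendsto_real_sqrt)
    then show ?case by - (rule LIM_zero_cancel, rule tendsto_norm_zero_cancel, simp)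
  qed
  then show ?thesis using that s(1) by blast
qed

lemma L2_tendsto_subset:
  fixes f :: "'a::euclidean_space \<Rightarrow> 'b::euclidean_space"
  assumes "L2_tendsto (lebesgue_on S) F f" "T \<subseteq> S" "S \<in> sets lebesgue" "T \<in> sets lebesgue"
  shows "L2_tendsto (lebesgue_on T) F f"
proof (rule L2_tendstoI)
  have L: "L2 (lebesgue_on T) (\<lambda>x. F k x - f x)" for k
    using assms(1) by (intro L2_subset[OF _ assms(2-4)]) (simp add: L2_tendsto_def)
  then show "(\<lambda>x. F k x - f x) \<in> borel_measurable (lebesgue_on T)" for k by (simp add: L2_def)
  show "(\<integral>\<^sup>+ x. ennreal ((norm (F k x - f x))\<^sup>2) \<partial>lebesgue_on T) < \<infinity>" for k
    using L[of k] by (simp add: L2_def integrable_iff_bounded)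
  have le: "(\<integral>\<^sup>+ x. ennreal ((norm (F k x - f x))\<^sup>2) \<partial>lebesgue_on T) \<le> (\<integral>\<^sup>+ x. ennreal ((norm (F k x - f x))\<^sup>2) \<partial>lebesgue_on S)" for k
    unfolding nn_integral_lebesgue_on[OF assms(3)] nn_integral_lebesgue_on[OF assms(4)]
    using assms(2) by (intro nn_integral_mono mult_right_mono) (auto simp: indicator_def)
  show "(\<lambda>k. \<integral>\<^sup>+ x. ennreal ((norm (F k x - f x))\<^sup>2) \<partial>lebesgue_on T) \<longlonglongrightarrow> 0"
    by (rule tendsto_sandwich[OF _ _ tendsto_const L2_tendstoD[OF assms(1)]]) (use le in auto)
qed

lemma H1_tendsto_subset:
  fixes f :: "real^3 \<Rightarrow> 'b::euclidean_space"
  assumes "H1_tendsto S F f" "T \<subseteq> S" "open S" "open T"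
  shows "H1_tendsto T F f"
  unfolding H1_tendsto_def
proof (intro conjI allI)
  have s: "S \<in> sets lebesgue" "T \<in> sets lebesgue" using assms by auto
  show "L2_tendsto (lebesgue_on T) F f"
    using assms(1) by (intro L2_tendsto_subset[OF _ assms(2) s]) (simp add: H1_tendsto_def)
  fix i
  obtain g where "weak_pd S i f g" "L2_tendsto (lebesgue_on S) (\<lambda>k. pd i (F k)) g"
    using assms(1) by (auto simp: H1_tendsto_def)
  then show "\<exists>g. weak_pd T i f g \<and> L2_tendsto (lebesgue_on T) (\<lambda>k. pd i (F k)) g"
    using weak_pd_subset[OF _ assms(2,4,3)] L2_tendsto_subset[OF _ assms(2) s] by blast
qed

lemma flat_boundary_smaller:
  assumes "flat_boundary x Q n D \<delta>" "0 < \<delta>'" "\<delta>' \<le> \<delta>"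
  shows "flat_boundary x Q n D \<delta>'"
  using assms unfolding flat_boundary_def flat_boundary_axioms_def by auto

context flat_boundary
begin

text \<open>The approximants converge to \<open>g\<close> in the chart of the trace and to the
  normal limit in the flat chart. Along a common subsequence both hold almost everywhere, so
  \<open>g\<close> is the normal limit.\<close>

lemma trace_AE:
  fixes f :: "real^3 \<Rightarrow> 'b::euclidean_space"
  assumes f: "H_reg 1 (half_ball x n \<delta>) f" and \<Gamma>: "x \<in> \<Gamma>" and tr: "has_trace D \<Gamma> f g"
  obtains \<rho> where "0 < \<rho>" "\<rho> < \<delta>"
    "AE y in lborel. norm y < \<rho> \<longrightarrow> (\<lambda>k. f (P y + inverse (real (Suc k)) *\<^sub>R n)) \<longlonglongrightarrow> g (P y)"
proof -
  obtain r P' h G where patch: "C21_patch D \<Gamma> x r P' h" and G: "\<And>k. Ck_on 1 UNIV (G k)"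
    and H1: "H1_tendsto (ball x r - closure D) G f"
    and L2: "L2_tendsto (patch_measure x r P' h) (\<lambda>k y. G k (graph_map x P' h y)) (\<lambda>y. g (graph_map x P' h y))"
    using tr \<Gamma> unfolding has_trace_def by blast
  have sg: "subgraph_near D x r P' h" and hC: "Ck_on 1 UNIV h"
    using patch Ck_on_le[of 2 UNIV h 1] by (auto simp: C21_patch_def C21_def)
  have r: "r > 0" using sg by (simp add: subgraph_near_eq)
  define \<rho>1 where "\<rho>1 = min r \<delta>"
  have \<rho>1: "0 < \<rho>1" "\<rho>1 \<le> r" "\<rho>1 \<le> \<delta>" using r \<delta> by (auto simp: \<rho>1_def)
  \<comment> \<open>Strictly below the radius on which the approximants converge in H1, to leave
    room for the cylinder over the disc.\<close>
  define \<rho> where "\<rho> = \<rho>1 / 2"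
  have \<rho>: "0 < \<rho>" "\<rho> < \<rho>1" "\<rho> < \<delta>" "\<rho> \<le> r" "\<rho> \<le> \<delta>" using \<rho>1 by (auto simp: \<rho>_def)
  have f1: "H_reg 1 (half_ball x n \<rho>1) f" by (rule H_reg_subset[OF f half_ball_mono[OF \<rho>1(3)]]) auto
  have H1': "H1_tendsto (half_ball x n \<rho>1) G f"
  proof (rule H1_tendsto_subset[OF H1])
    show "half_ball x n \<rho>1 \<subseteq> ball x r - closure D" unfolding exterior_flat[OF \<rho>1(3), symmetric] using \<rho>1(2) by auto
  qed (auto simp: open_Diff)
  obtain N where N: "inverse (real (Suc N)) < \<rho>1 - \<rho>" using reals_Archimedean[of "\<rho>1 - \<rho>"] \<rho> by auto
  have Lnl: "L2 (lebesgue_on (disc \<rho>)) (\<lambda>y. normal_limit n f (P y))" by (rule slices(2)[OF f1 \<rho>(2) N])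
  have conv: "L2_tendsto (lebesgue_on (disc \<rho>)) (\<lambda>k y. G k (P y)) (\<lambda>y. normal_limit n f (P y))"
  proof (rule L2_tendstoI)
    have "L2 (lebesgue_on (disc \<rho>)) (\<lambda>y. G k (P y))" for k
    proof (rule L2_continuous[OF _ bounded_disc disc_lebesgue])
      show "continuous_on UNIV (\<lambda>y. G k (P y))"
        by (rule continuous_on_compose2[OF Ck_on_continuous[OF G] continuous_on_plane_pt[OF lin]]) auto
    qed
    then have L: "L2 (lebesgue_on (disc \<rho>)) (\<lambda>y. G k (P y) - normal_limit n f (P y))" for k
      using Lnl by (rule L2_diff)
    then show "(\<lambda>y. G k (P y) - normal_limit n f (P y)) \<in> borel_measurable (lebesgue_on (disc \<rho>))" for k by (simp add: L2_def)
    show "(\<integral>\<^sup>+ y. ennreal ((norm (G k (P y) - normal_limit n f (P y)))\<^sup>2) \<partial>lebesgue_on (disc \<rho>)) < \<infinity>" for k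
      using L[of k] by (simp add: L2_def integrable_iff_bounded)
    show "(\<lambda>k. \<integral>\<^sup>+ y. ennreal ((norm (G k (P y) - normal_limit n f (P y)))\<^sup>2) \<partial>lebesgue_on (disc \<rho>)) \<longlonglongrightarrow> 0"
      by (rule trace_uniqueness_L2[OF f1 G H1' \<rho>(2)])
  qed
  obtain s where s: "strict_mono s" "AE y in patch_measure x r P' h. (\<lambda>k. G (s k) (graph_map x P' h y)) \<longlonglongrightarrow> g (graph_map x P' h y)"
    using L2_tendsto_AE_subseq[OF L2] by blast
  have ae1: "AE y in lborel. norm y < \<rho> \<longrightarrow> (\<lambda>k. G (s k) (P y)) \<longlonglongrightarrow> g (P y)"
    by (rule AE_transport[OF sg hC \<rho>(4,5,1), of "\<lambda>z. (\<lambda>k. G (s k) z) \<longlonglongrightarrow> g z"]) (rule s(2))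
  obtain t where t: "strict_mono t" "AE y in lebesgue_on (disc \<rho>). (\<lambda>k. G (s (t k)) (P y)) \<longlonglongrightarrow> normal_limit n f (P y)"
    using L2_tendsto_AE_subseq[OF L2_tendsto_subseq[OF conv s(1)]] by blast
  have ae2: "AE y in lborel. norm y < \<rho> \<longrightarrow> (\<lambda>k. G (s (t k)) (P y)) \<longlonglongrightarrow> normal_limit n f (P y)"
    using t(2) disc_lebesgue by (subst (asm) AE_restrict_space_iff) (auto simp: AE_completion_iff)
  have "AE y in lborel. norm y < \<rho> \<longrightarrow> (\<lambda>k. f (P y + inverse (real (Suc k)) *\<^sub>R n)) \<longlonglongrightarrow> g (P y)"
    using ae1 ae2 normal_limit_AE[OF f \<rho>(3)]
  proof eventually_elim
    case (elim y)
    show ?case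
    proof
      assume y: "norm y < \<rho>"
      have "(\<lambda>k. G (s (t k)) (P y)) \<longlonglongrightarrow> g (P y)"
        using LIMSEQ_subseq_LIMSEQ[OF elim(1)[rule_format, OF y] t(1)] by (simp add: o_def)
      then have "g (P y) = normal_limit n f (P y)" using elim(2) y LIMSEQ_unique by blast
      then show "(\<lambda>k. f (P y + inverse (real (Suc k)) *\<^sub>R n)) \<longlonglongrightarrow> g (P y)" using elim(3) y by simp
    qed
  qed
  then show ?thesis using that \<rho> by blast
qed

lemma ae_onD:
  assumes "ae_on D \<Gamma> R" "x \<in> \<Gamma>"
  obtains \<rho> where "0 < \<rho>" "\<rho> < \<delta>" "AE y in lborel. norm y < \<rho> \<longrightarrow> R (P y)"
proof -
  obtain r P' h where patch: "C21_patch D \<Gamma> x r P' h" and ae: "AE y in patch_measure x r P' h. R (graph_map x P' h y)"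
    using assms unfolding ae_on_def by blast
  have sg: "subgraph_near D x r P' h" and hC: "Ck_on 1 UNIV h"
    using patch Ck_on_le[of 2 UNIV h 1] by (auto simp: C21_patch_def C21_def)
  have r: "r > 0" using sg by (simp add: subgraph_near_eq)
  show ?thesis
    by (rule that[OF _ _ AE_transport[OF sg hC _ _ _ ae, of "min r (\<delta>/2)"]]) (use r \<delta> in auto)
qed

end

definition flat_piece :: "(real^3) set \<Rightarrow> (real^3) set \<Rightarrow> bool" where
  "flat_piece D \<Gamma> \<longleftrightarrow> (\<forall>x\<in>\<Gamma>. \<exists>Q n \<delta>. flat_boundary x Q n D \<delta> \<and> frontier D \<inter> ball x \<delta> \<subseteq> \<Gamma>)"

lemma flat_pieceI:
  assumes "regular_piece D \<Gamma>" "\<And>z. z \<in> \<Gamma> \<Longrightarrow> mean_and_gauss_curvature D z 0 0"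
  shows "flat_piece D \<Gamma>"
  unfolding flat_piece_def
proof
  fix x assume x: "x \<in> \<Gamma>"
  then obtain r P h where patch: "C21_patch D \<Gamma> x r P h" and fx: "x \<in> frontier D"
    using assms(1) unfolding regular_piece_def by blast
  obtain n \<delta> where n: "norm n = 1" "\<delta> > 0" "\<delta> \<le> r" "\<And>z. z \<in> ball x \<delta> \<Longrightarrow> z \<in> D \<longleftrightarrow> (z - x) \<bullet> n < 0"
    using flat_if_curvatures_vanish[OF patch fx assms(2)] by blast
  obtain Q :: "real^3 \<Rightarrow> real^3" where Q: "orthogonal_transformation Q" "Q (axis 3 1) = n"
    using orthogonal_transformation_exists[of "axis 3 1 :: real^3" n] n(1) by (auto simp: norm_axis_1)
  have "flat_boundary x Q n D \<delta>" by unfold_locales (use Q n in auto)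
  moreover have "frontier D \<inter> ball x \<delta> \<subseteq> \<Gamma>"
    using patch n(3) unfolding C21_patch_def by (meson Int_mono order_refl subset_ball subset_trans)
  ultimately show "\<exists>Q n \<delta>. flat_boundary x Q n D \<delta> \<and> frontier D \<inter> ball x \<delta> \<subseteq> \<Gamma>" by blast
qed

lemma flat_piece_small:
  assumes "flat_piece D \<Gamma>" "x \<in> \<Gamma>" "r > 0"
  obtains Q n \<delta> where "flat_boundary x Q n D \<delta>" "frontier D \<inter> ball x \<delta> \<subseteq> \<Gamma>" "\<delta> \<le> r"
proof -
  obtain Q n \<delta> where q: "flat_boundary x Q n D \<delta>" "frontier D \<inter> ball x \<delta> \<subseteq> \<Gamma>"
    using assms by (auto simp: flat_piece_def)
  then have "\<delta> > 0" by (simp add: flat_boundary_def flat_boundary_axioms_def)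
  then have "flat_boundary x Q n D (min \<delta> r)" using flat_boundary_smaller[OF q(1)] assms(3) by auto
  moreover have "frontier D \<inter> ball x (min \<delta> r) \<subseteq> \<Gamma>" using q(2) by auto
  ultimately show ?thesis using that[of Q n "min \<delta> r"] by simp
qed

lemma ae_onI:
  assumes "\<And>x. x \<in> \<Gamma> \<Longrightarrow> \<exists>Q n \<delta> \<rho>. flat_boundary x Q n D \<delta> \<and> frontier D \<inter> ball x \<delta> \<subseteq> \<Gamma> \<and>
     0 < \<rho> \<and> (AE y in lborel. norm y < \<rho> \<longrightarrow> R (plane_pt x Q y))"
  shows "ae_on D \<Gamma> R"
  unfolding ae_on_def
proof
  fix x assume "x \<in> \<Gamma>"
  then obtain Q n \<delta> \<rho> where q: "flat_boundary x Q n D \<delta>" "frontier D \<inter> ball x \<delta> \<subseteq> \<Gamma>" "0 < \<rho>"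
    and ae: "AE y in lborel. norm y < \<rho> \<longrightarrow> R (plane_pt x Q y)"
    using assms by blast
  interpret flat_boundary x Q n D \<delta> by fact
  define r where "r = min \<delta> \<rho>"
  have r: "0 < r" "r \<le> \<delta>" "r \<le> \<rho>" using q(3) \<delta> by (auto simp: r_def)
  have "C21_patch D \<Gamma> x r Q (\<lambda>_. 0)" by (rule patch_flat[OF r(1,2)]) (use q(2) r in auto)
  moreover have "AE y in patch_measure x r Q (\<lambda>_. 0). R (plane_pt x Q y)"
    unfolding patch_measure_flat using AE_completion[OF ae] r(3) disc_lebesgue
    by (subst AE_restrict_space_iff) (auto elim!: eventually_mono)
  ultimately show "\<exists>r P h. C21_patch D \<Gamma> x r P h \<and> (AE y in patch_measure x r P h. R (graph_map x P h y))" by blast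
qed

text \<open>Existence gives the \<open>SOME\<close> in \<open>bdry_trace\<close> its meaning. The
  witness has to be one function on all of \<open>\<Gamma>\<close>; taking the limit in the
  direction \<open>outward_normal\<close> makes it independent of the chart.\<close>

lemma has_trace_bdry_trace:
  fixes f :: "real^3 \<Rightarrow> 'b::euclidean_space"
  assumes flat: "flat_piece D \<Gamma>" and f: "\<And>x. x \<in> \<Gamma> \<Longrightarrow> \<exists>r>0. H_reg 1 (ball x r - closure D) f"
  shows "has_trace D \<Gamma> f (bdry_trace D \<Gamma> f)"
proof -
  let ?g = "\<lambda>z. normal_limit (outward_normal D z) f z"
  have "has_trace D \<Gamma> f ?g"
    unfolding has_trace_def
  proof
    fix x assume x: "x \<in> \<Gamma>"
    obtain r where r: "r > 0" "H_reg 1 (ball x r - closure D) f" using f[OF x] by blast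
    obtain Q n \<delta> where q: "flat_boundary x Q n D \<delta>" "frontier D \<inter> ball x \<delta> \<subseteq> \<Gamma>" "\<delta> \<le> r"
      by (rule flat_piece_small[OF flat x r(1)])
    interpret flat_boundary x Q n D \<delta> by fact
    have f1: "H_reg 1 (half_ball x n \<delta>) f"
    proof (rule H_reg_subset[OF r(2)])
      show "half_ball x n \<delta> \<subseteq> ball x r - closure D" unfolding exterior_flat[OF order_refl, symmetric] using q(3) by auto
    qed (auto simp: open_Diff)
    have d2: "0 < \<delta> / 2" "\<delta> / 2 < \<delta>" "\<delta> / 2 \<le> \<delta>" using \<delta> by auto
    obtain F where F: "\<And>k. Ck_on 1 UNIV (F k)" "H1_tendsto (half_ball x n (\<delta>/2)) F f"
      "L2_tendsto (patch_measure x (\<delta>/2) Q (\<lambda>_. 0)) (\<lambda>k y. F k (P y)) (\<lambda>y. normal_limit n f (P y))"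
      using trace_approximation[OF f1 d2(1,2)] by blast
    have "L2_tendsto (patch_measure x (\<delta>/2) Q (\<lambda>_. 0)) (\<lambda>k y. F k (P y)) (\<lambda>y. ?g (P y))"
      by (rule L2_tendsto_cong[OF F(3)]) (use d2 in \<open>auto simp: patch_measure_flat outward_normal_flat\<close>)
    moreover have "C21_patch D \<Gamma> x (\<delta>/2) Q (\<lambda>_. 0)"
      by (rule patch_flat[OF d2(1,3)]) (use q(2) d2 in auto)
    ultimately show "\<exists>r P h. C21_patch D \<Gamma> x r P h \<and> (\<exists>F. (\<forall>n. Ck_on 1 UNIV (F n)) \<and>
        H1_tendsto (ball x r - closure D) F f \<and>
        L2_tendsto (patch_measure x r P h) (\<lambda>n y. F n (graph_map x P h y)) (\<lambda>y. ?g (graph_map x P h y)))"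
      using F(1,2) exterior_flat[OF d2(3)] by (intro exI[of _ "\<delta>/2"] exI[of _ Q] exI[of _ "\<lambda>_. 0"]) auto
  qed
  then show ?thesis unfolding bdry_trace_def by (rule someI[of "has_trace D \<Gamma> f"])
qed


section \<open>Algebra of the boundary operators\<close>

lemmas scaleR_complex = scaleR_conv_of_real[where 'a=complex]

lemma bounded_linear_ccross: "bounded_linear (ccross a)"
  unfolding linear_conv_bounded_linear[symmetric]
  by (rule linearI) (simp_all add: ccross_def vec_eq_iff forall_3 algebra_simps scaleR_complex)

lemma bounded_linear_cdot: "bounded_linear (cdot a)"
  unfolding linear_conv_bounded_linear[symmetric]
  by (rule linearI) (simp_all add: cdot_def sum_3 algebra_simps scaleR_complex)

lemma bounded_linear_scale_right: "bounded_linear (\<lambda>c::complex. c *s (a::complex^3))"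
  unfolding linear_conv_bounded_linear[symmetric]
  by (rule linearI) (simp_all add: vec_eq_iff algebra_simps scaleR_complex)

lemma cvec_nth [simp]: "cvec v $ i = complex_of_real (v $ i)"
  by (simp add: cvec_def)

lemma ccross_nth [simp]:
  "ccross a b $ 1 = a$2 * b$3 - a$3 * b$2" "ccross a b $ 2 = a$3 * b$1 - a$1 * b$3" "ccross a b $ 3 = a$1 * b$2 - a$2 * b$1"
  by (simp_all add: ccross_def)

text \<open>Here and in the next two facts the operator becomes a sum of constant linear maps
  applied to partial derivatives, so that one rule for such sums covers its regularity and another
  its derivatives.\<close>

lemma divg_eq: "divg U = (\<lambda>z. \<Sum>i\<in>UNIV. cdot (cvec (axis i 1)) (pd i U z))"
  by (intro ext) (simp add: divg_def cdot_def sum_3 axis_def)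

lemma curl_eq: "curl U = (\<lambda>z. \<Sum>i\<in>UNIV. ccross (cvec (axis i 1)) (pd i U z))"
  by (intro ext) (simp add: curl_def sum_3 vec_eq_iff forall_3 axis_def)

lemma grad_eq: "grad f = (\<lambda>z. \<Sum>i\<in>UNIV. pd i f z *s cvec (axis i 1))"
  by (intro ext) (simp add: grad_def sum_3 vec_eq_iff forall_3 axis_def)

lemma pd_sum_linear:
  fixes f :: "3 \<Rightarrow> real^3 \<Rightarrow> 'b::real_normed_vector"
  assumes "\<And>i. f i differentiable (at z)" "\<And>i. bounded_linear (T i)"
  shows "pd j (\<lambda>z. \<Sum>i\<in>UNIV. T i (f i z)) z = (\<Sum>i\<in>UNIV. T i (pd j (f i) z))"
proof -
  have d: "(\<lambda>z. T i (f i z)) differentiable (at z)" for i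
    using assms(1)[of i] bounded_linear.has_derivative[OF assms(2)[of i]] unfolding differentiable_def by blast
  show ?thesis unfolding sum_3 using d assms
    by (simp add: pd_add differentiable_add pd_bounded_linear)
qed

lemma H_reg_sum_linear:
  fixes f :: "3 \<Rightarrow> real^3 \<Rightarrow> 'b::euclidean_space" and T :: "3 \<Rightarrow> 'b \<Rightarrow> 'c::euclidean_space"
  assumes "open S" "\<And>i. H_reg k S (f i)" "\<And>i. bounded_linear (T i)"
  shows "H_reg k S (\<lambda>z. \<Sum>i\<in>UNIV. T i (f i z))"
  by (intro H_reg_sum assms(1) finite_UNIV H_reg_bounded_linear[OF assms(1,3,2)]) simp

lemma H_reg_divg: "open S \<Longrightarrow> H_reg (Suc k) S U \<Longrightarrow> H_reg k S (divg U)"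
  unfolding divg_eq by (rule H_reg_sum_linear) (auto simp: bounded_linear_cdot)

lemma H_reg_curl: "open S \<Longrightarrow> H_reg (Suc k) S U \<Longrightarrow> H_reg k S (curl U)"
  unfolding curl_eq by (rule H_reg_sum_linear) (auto simp: bounded_linear_ccross)

lemma H_reg_grad: "open S \<Longrightarrow> H_reg (Suc k) S f \<Longrightarrow> H_reg k S (grad f)"
  unfolding grad_eq by (rule H_reg_sum_linear) (auto simp: bounded_linear_scale_right)

text \<open>First component of a \<times> (a \<times> w) = a (a \<bullet> w) - |a|^2 w; the other
  two components are cyclic permutations of it.\<close>

lemma double_cross_component:
  fixes a b c x y z :: complex
  assumes "a\<^sup>2 + b\<^sup>2 + c\<^sup>2 = 1" "a * x + b * y + c * z = 0"
  shows "b * (a * y - b * x) - c * (c * x - a * z) = - x"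
proof -
  have "b * (a * y - b * x) - c * (c * x - a * z) = a * (a * x + b * y + c * z) - (a\<^sup>2 + b\<^sup>2 + c\<^sup>2) * x"
    by (simp add: algebra_simps power2_eq_square)
  then show ?thesis using assms by simp
qed

lemma ccross_ccross_unit:
  assumes "norm n = 1" "cdot (cvec n) w = 0"
  shows "ccross (cvec n) (ccross (cvec n) w) = - w"
proof -
  have h: "(n$1)\<^sup>2 + (n$2)\<^sup>2 + (n$3)\<^sup>2 = 1"
    using assms(1) by (simp add: norm_eq_sqrt_inner inner_vec_def sum_3 power2_eq_square)
  have u: "(complex_of_real (n$1))\<^sup>2 + (complex_of_real (n$2))\<^sup>2 + (complex_of_real (n$3))\<^sup>2 = 1"
    by (simp only: of_real_power[symmetric] of_real_add[symmetric] h of_real_1)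
  have d: "complex_of_real (n$1) * w$1 + complex_of_real (n$2) * w$2 + complex_of_real (n$3) * w$3 = 0"
    using assms(2) by (simp add: cdot_def sum_3)
  let ?a = "complex_of_real (n$1)" and ?b = "complex_of_real (n$2)" and ?c = "complex_of_real (n$3)"
  have "?b * (?a * w$2 - ?b * w$1) - ?c * (?c * w$1 - ?a * w$3) = - w$1"
    using double_cross_component[OF u d] .
  moreover have "?c * (?b * w$3 - ?c * w$2) - ?a * (?a * w$2 - ?b * w$1) = - w$2"
    by (rule double_cross_component) (use u d in \<open>simp_all add: algebra_simps\<close>)
  moreover have "?a * (?c * w$1 - ?a * w$3) - ?b * (?b * w$3 - ?c * w$2) = - w$3"
    by (rule double_cross_component) (use u d in \<open>simp_all add: algebra_simps\<close>)
  ultimately show ?thesis unfolding vec_eq_iff forall_3 ccross_nth cvec_nth vector_uminus_component by blast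
qed

lemma cdot_ccross [simp]: "cdot a (ccross a w) = 0"
  by (simp add: cdot_def sum_3 algebra_simps)

text \<open>n \<times> w is orthogonal to n, so multiplying it by n twice more only changes its
  sign.\<close>

lemma ccross_eq_0_if_ccross_ccross:
  assumes "norm n = 1" "ccross (cvec n) (ccross (cvec n) w) = 0"
  shows "ccross (cvec n) w = 0"
  using ccross_ccross_unit[OF assms(1), of "ccross (cvec n) w"] assms(2)
  by (metis bounded_linear_ccross linear_0 linear_conv_bounded_linear neg_equal_0_iff_equal cdot_ccross)

text \<open>Orthonormality of the three vectors, stated as the completeness relation.\<close>

definition orthonormal_frame :: "real^3 \<Rightarrow> real^3 \<Rightarrow> real^3 \<Rightarrow> bool" where
  "orthonormal_frame n v w \<longleftrightarrow> norm n = 1 \<and>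
    (\<forall>i j. n$i * n$j + v$i * v$j + w$i * w$j = (if i = j then 1 else 0))"

lemma orthonormal_frame_complex:
  assumes "orthonormal_frame n v w"
  shows "complex_of_real (if i = j then 1 else 0) =
    of_real (n$i) * of_real (n$j) + of_real (v$i) * of_real (v$j) + of_real (w$i) * of_real (w$j)"
proof -
  have "(if i = j then 1 else 0) = n$i * n$j + v$i * v$j + w$i * w$j"
    using assms by (simp add: orthonormal_frame_def)
  from arg_cong[OF this, of complex_of_real] show ?thesis by (simp only: of_real_add of_real_mult)
qed

text \<open>Expand the i-th axis vector in the rotated basis and read off the j-th
  coordinate.\<close>

lemma orthonormal_frameI:
  fixes Q :: "real^3 \<Rightarrow> real^3"
  assumes "orthogonal_transformation Q"
  shows "orthonormal_frame (Q (axis 3 1)) (Q (axis 1 1)) (Q (axis 2 1))"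
proof -
  let ?n = "Q (axis 3 1)" and ?v = "Q (axis 1 1)" and ?w = "Q (axis 2 1)"
  have o: "Q (axis i 1) \<bullet> Q (axis j 1) = (if i = j then 1 else 0)" for i j
    using assms by (simp add: orthogonal_transformation_def inner_axis_axis inner_real_def)
  have nn: "norm (Q (axis i 1)) = 1" for i using assms by (simp add: orthogonal_transformation_norm norm_axis_1)
  have "?n$i * ?n$j + ?v$i * ?v$j + ?w$i * ?w$j = (if i = j then 1 else 0)" for i j
  proof -
    let ?e = "axis i 1 :: real^3"
    have e: "?e - (?e \<bullet> ?n) *\<^sub>R ?n = ((?e - (?e \<bullet> ?n) *\<^sub>R ?n) \<bullet> ?v) *\<^sub>R ?v + ((?e - (?e \<bullet> ?n) *\<^sub>R ?n) \<bullet> ?w) *\<^sub>R ?w"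
      by (rule orthonormal_pair_expansion[of _ _ ?n]) (simp_all add: nn o inner_diff_left)
    have "?e = (?e \<bullet> ?n) *\<^sub>R ?n + (?e \<bullet> ?v) *\<^sub>R ?v + (?e \<bullet> ?w) *\<^sub>R ?w"
      using e by (simp add: inner_diff_left o algebra_simps)
    then have "?e $ j = ((?e \<bullet> ?n) *\<^sub>R ?n + (?e \<bullet> ?v) *\<^sub>R ?v + (?e \<bullet> ?w) *\<^sub>R ?w) $ j" by (rule arg_cong)
    moreover have "?e \<bullet> u = u $ i" for u by (simp add: inner_axis')
    moreover have "?e $ j = (if i = j then 1 else 0)" by (simp add: axis_def)
    ultimately show ?thesis by simp
  qed
  then show ?thesis by (simp add: orthonormal_frame_def nn)
qed

text \<open>If the tangential derivatives of the normal component vanish, then the normal part of the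
  gradient matrix \<open>A\<close> is \<open>c n\<close>, and both conditions reduce to \<open>n \<times> \<partial>\<^sub>n U = 0\<close>.\<close>

lemma traction_iff_curl:
  fixes A :: "3 \<Rightarrow> complex^3"
  assumes fr: "orthonormal_frame n v w" and \<mu>: "\<mu> \<noteq> 0"
    and v: "(\<Sum>i\<in>UNIV. v$i *\<^sub>R cdot (cvec n) (A i)) = 0" and w: "(\<Sum>i\<in>UNIV. w$i *\<^sub>R cdot (cvec n) (A i)) = 0"
  defines "C \<equiv> \<Sum>i\<in>UNIV. ccross (cvec (axis i 1)) (A i)"
  shows "ccross (cvec n) ((2 * \<mu>) *\<^sub>R (\<Sum>i\<in>UNIV. n$i *\<^sub>R A i) + lam *\<^sub>R (d *s cvec n) + \<mu> *\<^sub>R ccross (cvec n) C) = 0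
     \<longleftrightarrow> ccross (cvec n) C = 0"
proof -
  have n1: "norm n = 1" using fr by (simp add: orthonormal_frame_def)
  define b where "b = (\<chi> i. cdot (cvec n) (A i))"
  define c where "c = cdot (cvec n) b"
  define a where "a = (\<Sum>i\<in>UNIV. n$i *\<^sub>R A i)"
  \<comment> \<open>The completeness relation expands \<open>b\<close> in the frame; the
    coefficients along v and w are the tangential derivatives that vanish by assumption.\<close>
  have bn: "b = c *s cvec n"
  proof -
    have "b $ j = c * complex_of_real (n $ j)" for j
    proof -
      have r: "complex_of_real (if i = j then 1 else 0) = of_real (n$i) * of_real (n$j) + of_real (v$i) * of_real (v$j) + of_real (w$i) * of_real (w$j)" for i
        by (rule orthonormal_frame_complex[OF fr])
      have "b $ j = (\<Sum>i\<in>UNIV. complex_of_real (if i = j then 1 else 0) * b $ i)"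
        by (simp add: if_distrib if_distribR cong: if_cong)
      also have "\<dots> = of_real (n$j) * (\<Sum>i\<in>UNIV. of_real (n$i) * b$i) + of_real (v$j) * (\<Sum>i\<in>UNIV. of_real (v$i) * b$i) + of_real (w$j) * (\<Sum>i\<in>UNIV. of_real (w$i) * b$i)"
        unfolding r sum_distrib_left sum.distrib[symmetric] by (intro sum.cong refl) (simp add: algebra_simps)
      also have "(\<Sum>i\<in>UNIV. of_real (v$i) * b$i) = 0" using v by (simp add: b_def scaleR_complex)
      also have "(\<Sum>i\<in>UNIV. of_real (w$i) * b$i) = 0" using w by (simp add: b_def scaleR_complex)
      also have "(\<Sum>i\<in>UNIV. of_real (n$i) * b$i) = c" by (simp add: c_def cdot_def)
      finally show ?thesis by (simp add: mult.commute)
    qed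
    then show ?thesis by (simp add: vec_eq_iff)
  qed
  \<comment> \<open>With \<open>A i\<close> as the i-th derivative of U and n constant, this says
    that n \<times> curl U is the gradient of n \<bullet> U minus the normal derivative of
    U.\<close>
  have CC: "ccross (cvec n) C = b - a"
    by (simp add: C_def b_def a_def vec_eq_iff forall_3 sum_3 cdot_def axis_def scaleR_complex algebra_simps)
  interpret cr: bounded_linear "ccross (cvec n)" by (rule bounded_linear_ccross)
  have nz: "ccross (cvec n) (e *s cvec n) = 0" for e
    by (simp add: vec_eq_iff forall_3 algebra_simps)
  have nb: "ccross (cvec n) b = 0" unfolding bn by (rule nz)
  have n0: "ccross (cvec n) (lam *\<^sub>R (d *s cvec n)) = 0" by (simp add: cr.scaleR nz)
  \<comment> \<open>Of the factor 2 \<mu> on the normal derivative the curl term takes away \<mu>;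
    the remaining \<mu> is nonzero, so nothing is lost.\<close>
  have "ccross (cvec n) ((2 * \<mu>) *\<^sub>R a + lam *\<^sub>R (d *s cvec n) + \<mu> *\<^sub>R ccross (cvec n) C)
     = (2 * \<mu>) *\<^sub>R ccross (cvec n) a - \<mu> *\<^sub>R ccross (cvec n) a"
    unfolding CC by (simp add: cr.add cr.diff cr.scaleR nz nb)
  also have "\<dots> = \<mu> *\<^sub>R ccross (cvec n) a" by (simp add: scaleR_left_diff_distrib[symmetric])
  finally have T: "ccross (cvec n) ((2 * \<mu>) *\<^sub>R a + lam *\<^sub>R (d *s cvec n) + \<mu> *\<^sub>R ccross (cvec n) C) = \<mu> *\<^sub>R ccross (cvec n) a" .
  have CCC: "ccross (cvec n) (ccross (cvec n) C) = - ccross (cvec n) a" unfolding CC by (simp add: cr.diff nb)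
  have "ccross (cvec n) C = 0 \<longleftrightarrow> ccross (cvec n) a = 0"
  proof
    assume "ccross (cvec n) C = 0"
    then show "ccross (cvec n) a = 0" using CCC cr.zero by simp
  next
    assume "ccross (cvec n) a = 0"
    then show "ccross (cvec n) C = 0" using ccross_eq_0_if_ccross_ccross[OF n1, of C] CCC by simp
  qed
  then show ?thesis using T \<mu> by (simp add: a_def)
qed

lemma cdot_cvec_sum:
  fixes V :: "3 \<Rightarrow> complex^3"
  shows "cdot (cvec u) (\<Sum>i\<in>UNIV. u$i *\<^sub>R V i) = (\<Sum>i\<in>UNIV. \<Sum>j\<in>UNIV. (of_real (u$i) * of_real (u$j)) * V i $ j)"
proof -
  have "cdot (cvec u) (\<Sum>i\<in>UNIV. u$i *\<^sub>R V i) = (\<Sum>j\<in>UNIV. \<Sum>i\<in>UNIV. (of_real (u$i) * of_real (u$j)) * V i $ j)"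
    by (simp add: cdot_def sum_distrib_left scaleR_complex ac_simps)
  then show ?thesis by (subst sum.swap)
qed

text \<open>Since \<open>V = n \<times> curl U\<close> is tangential, its divergence only involves tangential derivatives.\<close>

lemma normal_component_identity:
  fixes H :: "3 \<Rightarrow> 3 \<Rightarrow> complex^3"
  assumes fr: "orthonormal_frame n v w" and sym: "\<And>i j. H i j = H j i"
  defines "V \<equiv> \<lambda>i. ccross (cvec n) (\<Sum>j\<in>UNIV. ccross (cvec (axis j 1)) (H i j))"
  defines "G \<equiv> \<Sum>i\<in>UNIV. (\<Sum>j\<in>UNIV. cdot (cvec (axis j 1)) (H i j)) *s cvec (axis i 1)"
  shows "cdot (cvec n) (\<Sum>i\<in>UNIV. H i i) = cdot (cvec n) G
     + cdot (cvec v) (\<Sum>i\<in>UNIV. v$i *\<^sub>R V i) + cdot (cvec w) (\<Sum>i\<in>UNIV. w$i *\<^sub>R V i)"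
proof -
  have r: "complex_of_real (if i = j then 1 else 0) = of_real (n$i) * of_real (n$j) + of_real (v$i) * of_real (v$j) + of_real (w$i) * of_real (w$j)" for i j
    by (rule orthonormal_frame_complex[OF fr])
  \<comment> \<open>The divergence is a trace and may be computed in the frame; its n entry is zero
    because every \<open>V i\<close> is orthogonal to n.\<close>
  have "(\<Sum>i\<in>UNIV. V i $ i) = (\<Sum>i\<in>UNIV. \<Sum>j\<in>UNIV. complex_of_real (if i = j then 1 else 0) * V i $ j)"
    by (simp add: if_distrib if_distribR cong: if_cong)
  also have "\<dots> = cdot (cvec n) (\<Sum>i\<in>UNIV. n$i *\<^sub>R V i) + cdot (cvec v) (\<Sum>i\<in>UNIV. v$i *\<^sub>R V i) + cdot (cvec w) (\<Sum>i\<in>UNIV. w$i *\<^sub>R V i)"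
    unfolding r cdot_cvec_sum by (simp add: sum.distrib distrib_right)
  also have "cdot (cvec n) (\<Sum>i\<in>UNIV. n$i *\<^sub>R V i) = 0"
  proof -
    interpret cd: bounded_linear "cdot (cvec n)" by (rule bounded_linear_cdot)
    show ?thesis by (simp add: cd.sum cd.scaleR V_def)
  qed
  finally have V: "(\<Sum>i\<in>UNIV. V i $ i) = cdot (cvec v) (\<Sum>i\<in>UNIV. v$i *\<^sub>R V i) + cdot (cvec w) (\<Sum>i\<in>UNIV. w$i *\<^sub>R V i)" by simp
  \<comment> \<open>In terms of U: n \<bullet> \<Delta>U - n \<bullet> grad div U = div (n \<times>
    curl U), by symmetry of the second derivatives.\<close>
  have "cdot (cvec n) (\<Sum>i\<in>UNIV. H i i) - cdot (cvec n) G = (\<Sum>i\<in>UNIV. V i $ i)"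
    using sym[of 2 1] sym[of 3 1] sym[of 3 2]
    by (simp add: V_def G_def cdot_def sum_3 axis_def algebra_simps)
  then show ?thesis using V by (simp add: algebra_simps)
qed


section \<open>The boundary conditions\<close>

lemma smooth_imp_Ck: "smooth_on S f \<Longrightarrow> Ck_on k S f"
  by (simp add: smooth_on_def)

lemma dir_deriv_linear_image:
  assumes "f differentiable (at z)" "bounded_linear T"
  shows "dir_deriv v (\<lambda>z. T (f z)) z = (\<Sum>i\<in>UNIV. v$i *\<^sub>R T (pd i f z))"
  unfolding dir_deriv_def using assms by (simp add: pd_bounded_linear)

lemma pd_divg:
  assumes "\<And>i. pd i U differentiable (at z)"
  shows "pd j (divg U) z = (\<Sum>i\<in>UNIV. cdot (cvec (axis i 1)) (pd j (pd i U) z))"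
  unfolding divg_eq by (rule pd_sum_linear) (auto simp: assms bounded_linear_cdot)

lemma pd_curl:
  assumes "\<And>i. pd i U differentiable (at z)"
  shows "pd j (curl U) z = (\<Sum>i\<in>UNIV. ccross (cvec (axis i 1)) (pd j (pd i U) z))"
  unfolding curl_eq by (rule pd_sum_linear) (auto simp: assms bounded_linear_ccross)

text \<open>Normal component of the Navier equation with n \<bullet> \<Delta>U rewritten by
  \<open>normal_component_identity\<close>, which adds a further \<mu> to the factor lam + \<mu> of
  the grad div term.\<close>

lemma lame_normal_component:
  assumes S: "open S" "z \<in> S" and U: "Ck_on 2 S U" and fr: "orthonormal_frame n v w"
    and eq: "lame lam \<mu> U z + (\<omega>\<^sup>2) *\<^sub>R U z = 0"
  defines "V \<equiv> \<lambda>z. ccross (cvec n) (curl U z)"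
  shows "(lam + 2 * \<mu>) *\<^sub>R cdot (cvec n) (grad (divg U) z)
     + \<mu> *\<^sub>R (cdot (cvec v) (dir_deriv v V z) + cdot (cvec w) (dir_deriv w V z)) + \<omega>\<^sup>2 *\<^sub>R cdot (cvec n) (U z) = 0"
proof -
  define H where "H i j = pd i (pd j U) z" for i j
  have sym: "H i j = H j i" for i j unfolding H_def by (rule pd_commute[OF S(1) U S(2)])
  have d: "pd i U differentiable (at z)" for i using U S(2) by (simp add: numeral_2_eq_2)
  have dc: "curl U differentiable (at z)"
  proof -
    have p1: "Ck_on 1 S (pd i U)" for i using U by (simp add: numeral_2_eq_2)
    have "Ck_on 1 S (curl U)" unfolding curl_eq
      by (intro Ck_on_sum S(1) finite Ck_on_bounded_linear[OF S(1) bounded_linear_ccross] p1)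
    then show ?thesis using S(2) by simp
  qed
  have dV: "dir_deriv u V z = (\<Sum>i\<in>UNIV. u$i *\<^sub>R ccross (cvec n) (\<Sum>j\<in>UNIV. ccross (cvec (axis j 1)) (H i j)))" for u
    unfolding V_def dir_deriv_linear_image[OF dc bounded_linear_ccross] H_def by (simp add: pd_curl[OF d])
  have g: "grad (divg U) z = (\<Sum>i\<in>UNIV. (\<Sum>j\<in>UNIV. cdot (cvec (axis j 1)) (H i j)) *s cvec (axis i 1))"
    unfolding grad_eq H_def by (simp add: pd_divg[OF d])
  have l: "laplacian U z = (\<Sum>i\<in>UNIV. H i i)" by (simp add: laplacian_def H_def)
  interpret cd: bounded_linear "cdot (cvec n)" by (rule bounded_linear_cdot)
  have "cdot (cvec n) (lame lam \<mu> U z + (\<omega>\<^sup>2) *\<^sub>R U z) = 0" unfolding eq by (rule cd.zero)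
  then have "\<mu> *\<^sub>R cdot (cvec n) (laplacian U z) + (lam + \<mu>) *\<^sub>R cdot (cvec n) (grad (divg U) z) + \<omega>\<^sup>2 *\<^sub>R cdot (cvec n) (U z) = 0"
    by (simp add: lame_def cd.add cd.scaleR)
  moreover have "cdot (cvec n) (laplacian U z) = cdot (cvec n) (grad (divg U) z) + cdot (cvec v) (dir_deriv v V z) + cdot (cvec w) (dir_deriv w V z)"
    unfolding l g dV by (rule normal_component_identity[OF fr sym])
  ultimately show ?thesis by (simp add: scaleR_complex algebra_simps)
qed

context flat_boundary
begin

lemma frame: "orthonormal_frame n (Q (join3 (axis 1 1, 0))) (Q (join3 (axis 2 1, 0)))"
proof -
  have "join3 (axis 1 1, 0) = axis 1 1" "join3 (axis 2 1, 0) = axis 2 1"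
    by (simp_all add: vec_eq_iff forall_3 axis_def)
  then show ?thesis using orthonormal_frameI[OF Q] by (simp add: n)
qed

lemma normal_point_in_half_ball:
  assumes "norm y < \<delta>"
  shows "\<forall>\<^sub>F k in sequentially. P y + inverse (real (Suc k)) *\<^sub>R n \<in> half_ball x n \<delta>"
proof -
  have "\<forall>\<^sub>F k in sequentially. inverse (real (Suc k)) < \<delta> - norm y"
    by (rule order_tendstoD(2)[OF LIMSEQ_inverse_real_of_nat]) (use assms in simp)
  then show ?thesis by eventually_elim (rule P_in_half_ball, auto)
qed

text \<open>Serves twice: for n \<bullet> U, and for n \<times> curl U with curl U in the place of
  \<open>f\<close>. The boundary value \<open>b\<close> is only a limit, so \<open>T\<close> is
  first passed through it to see that the normal limit of the composition is 0.\<close>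

lemma normal_limit_bounded_linear_AE:
  fixes f :: "real^3 \<Rightarrow> 'b::euclidean_space" and T :: "'b \<Rightarrow> 'c::euclidean_space"
  assumes f: "H_reg 2 (half_ball x n \<delta>) f" and T: "bounded_linear T" and r: "r < \<delta>"
    and b: "AE y in lborel. norm y < r \<longrightarrow> (\<lambda>k. f (P y + inverse (real (Suc k)) *\<^sub>R n)) \<longlonglongrightarrow> b y"
    and z: "AE y in lborel. norm y < r \<longrightarrow> T (b y) = 0"
  shows "AE y in lborel. norm y < r \<longrightarrow> (\<lambda>k. dir_deriv (Q (join3 (t, 0))) (\<lambda>z. T (f z)) (P y + inverse (real (Suc k)) *\<^sub>R n)) \<longlonglongrightarrow> 0"
proof -
  let ?g = "\<lambda>z. T (f z)" and ?v = "Q (join3 (t, 0))"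
  have g2: "H_reg 2 (half_ball x n \<delta>) ?g" by (rule H_reg_bounded_linear[OF open_half_ball T f])
  then have d1: "H_reg 1 (half_ball x n \<delta>) (dir_deriv ?v ?g)"
    using H_reg_dir_deriv[OF open_half_ball, of 1 x n \<delta> ?g ?v] by (simp add: numeral_2_eq_2)
  have "AE y in lborel. norm y < r \<longrightarrow> normal_limit n ?g (P y) = 0"
    using b z
  proof eventually_elim
    case (elim y)
    have "(\<lambda>k. T (f (P y + inverse (real (Suc k)) *\<^sub>R n))) \<longlonglongrightarrow> 0" if "norm y < r"
      using bounded_linear.tendsto[OF T elim(1)[rule_format, OF that]] elim(2) that by simp
    then show ?case unfolding normal_limit_def by (auto intro: limI)
  qed
  from tangential_derivative_trace_zero[OF g2 r this, of t] normal_limit_AE[OF d1 r]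
  show ?thesis by eventually_elim auto
qed

end

text \<open>The boundary fields stand for traces chosen independently of each other; what ties them
  together is convergence along the same points of the same normal lines.\<close>

locale traces = flat_boundary +
  fixes U :: "real^3 \<Rightarrow> complex^3" and lam \<mu> \<omega> \<rho> :: real
    and bU bC bG :: "real^3 \<Rightarrow> complex^3" and bA :: "3 \<Rightarrow> real^3 \<Rightarrow> complex^3" and bD :: "real^3 \<Rightarrow> complex"
  assumes U: "H_reg 3 (half_ball x n \<delta>) U"
    and eq: "\<And>z. z \<in> half_ball x n \<delta> \<Longrightarrow> lame lam \<mu> U z + (\<omega>\<^sup>2) *\<^sub>R U z = 0"
    and \<rho>: "0 < \<rho>" "\<rho> < \<delta>" and \<mu>: "\<mu> > 0" and pos: "lam + 2 * \<mu> > 0" and \<omega>: "\<omega> > 0"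
    and conv: "AE y in lborel. norm y < \<rho> \<longrightarrow> 
        (\<lambda>k. U (P y + inverse (real (Suc k)) *\<^sub>R n)) \<longlonglongrightarrow> bU (P y) \<and>
        (\<forall>i. (\<lambda>k. pd i U (P y + inverse (real (Suc k)) *\<^sub>R n)) \<longlonglongrightarrow> bA i (P y)) \<and>
        (\<lambda>k. divg U (P y + inverse (real (Suc k)) *\<^sub>R n)) \<longlonglongrightarrow> bD (P y) \<and>
        (\<lambda>k. curl U (P y + inverse (real (Suc k)) *\<^sub>R n)) \<longlonglongrightarrow> bC (P y) \<and>
        (\<lambda>k. grad (divg U) (P y + inverse (real (Suc k)) *\<^sub>R n)) \<longlonglongrightarrow> bG (P y)"
begin

abbreviation "T z \<equiv> (2 * \<mu>) *\<^sub>R (\<Sum>i\<in>UNIV. n$i *\<^sub>R bA i z) + lam *\<^sub>R (bD z *s cvec n) + \<mu> *\<^sub>R ccross (cvec n) (bC z)"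

lemma traction_curl:
  assumes r: "r \<le> \<rho>" and z: "AE y in lborel. norm y < r \<longrightarrow> cdot (cvec n) (bU (P y)) = 0"
  shows "AE y in lborel. norm y < r \<longrightarrow> (ccross (cvec n) (T (P y)) = 0 \<longleftrightarrow> ccross (cvec n) (bC (P y)) = 0)"
proof -
  have U2: "H_reg 2 (half_ball x n \<delta>) U" using U H_reg_lower[of 2 "half_ball x n \<delta>" U] by (simp add: eval_nat_numeral)
  have rd: "r < \<delta>" using r \<rho> by simp
  have bU: "AE y in lborel. norm y < r \<longrightarrow> (\<lambda>k. U (P y + inverse (real (Suc k)) *\<^sub>R n)) \<longlonglongrightarrow> bU (P y)"
    using conv by eventually_elim (use r in auto)
  note tan = normal_limit_bounded_linear_AE[OF U2 bounded_linear_cdot rd bU z]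
  show ?thesis
    using conv tan[of "axis 1 1"] tan[of "axis 2 1"]
  proof eventually_elim
    case (elim y)
    show ?case
    proof
      assume y: "norm y < r"
      then have yr: "norm y < \<rho>" "norm y < \<delta>" using r \<rho> by auto
      let ?p = "\<lambda>k. P y + inverse (real (Suc k)) *\<^sub>R n"
      have A: "(\<lambda>k. pd i U (?p k)) \<longlonglongrightarrow> bA i (P y)" for i using elim(1) yr by blast
      \<comment> \<open>The tangential derivatives of n \<bullet> U tend to 0 and also to an
        expression in the boundary values \<open>bA\<close>, which yields the hypotheses of
        \<open>traction_iff_curl\<close>.\<close>
      have dd: "(\<Sum>i\<in>UNIV. v$i *\<^sub>R cdot (cvec n) (bA i (P y))) = 0"
        if "(\<lambda>k. dir_deriv v (\<lambda>z. cdot (cvec n) (U z)) (?p k)) \<longlonglongrightarrow> 0" for v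
      proof -
        have X: "(\<lambda>k. \<Sum>i\<in>UNIV. v$i *\<^sub>R cdot (cvec n) (pd i U (?p k))) \<longlonglongrightarrow> (\<Sum>i\<in>UNIV. v$i *\<^sub>R cdot (cvec n) (bA i (P y)))"
          by (intro tendsto_sum tendsto_scaleR tendsto_const bounded_linear.tendsto[OF bounded_linear_cdot] A)
        have Y: "\<forall>\<^sub>F k in sequentially. dir_deriv v (\<lambda>z. cdot (cvec n) (U z)) (?p k) = (\<Sum>i\<in>UNIV. v$i *\<^sub>R cdot (cvec n) (pd i U (?p k)))"
          using normal_point_in_half_ball[OF yr(2)]
          by eventually_elim (rule dir_deriv_linear_image[OF _ bounded_linear_cdot], use U2 in \<open>simp add: numeral_2_eq_2\<close>)
        show ?thesis by (rule LIMSEQ_unique[OF X Lim_transform_eventually[OF that Y]])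
      qed
      \<comment> \<open>\<open>bC\<close> is given separately from \<open>bA\<close>; uniqueness of
        limits makes it the curl formed from \<open>bA\<close>.\<close>
      have C: "bC (P y) = (\<Sum>i\<in>UNIV. ccross (cvec (axis i 1)) (bA i (P y)))"
      proof (rule LIMSEQ_unique)
        show "(\<lambda>k. curl U (?p k)) \<longlonglongrightarrow> bC (P y)" using elim(1) yr by blast
        show "(\<lambda>k. curl U (?p k)) \<longlonglongrightarrow> (\<Sum>i\<in>UNIV. ccross (cvec (axis i 1)) (bA i (P y)))"
          unfolding curl_eq by (intro tendsto_sum bounded_linear.tendsto[OF bounded_linear_ccross] A)
      qed
      show "ccross (cvec n) (T (P y)) = 0 \<longleftrightarrow> ccross (cvec n) (bC (P y)) = 0"
        unfolding C
      proof (rule traction_iff_curl[OF frame])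
        show "\<mu> \<noteq> 0" using \<mu> by simp
        show "(\<Sum>i\<in>UNIV. Q (join3 (axis 1 1, 0)) $ i *\<^sub>R cdot (cvec n) (bA i (P y))) = 0" using elim(2) y by (intro dd) blast
        show "(\<Sum>i\<in>UNIV. Q (join3 (axis 2 1, 0)) $ i *\<^sub>R cdot (cvec n) (bA i (P y))) = 0" using elim(3) y by (intro dd) blast
      qed
    qed
  qed
qed

lemma normal_grad_div:
  assumes r: "r \<le> \<rho>" and z: "AE y in lborel. norm y < r \<longrightarrow> ccross (cvec n) (bC (P y)) = 0"
  shows "AE y in lborel. norm y < r \<longrightarrow> (cdot (cvec n) (bG (P y)) = 0 \<longleftrightarrow> cdot (cvec n) (bU (P y)) = 0)"
proof -
  let ?B = "half_ball x n \<delta>"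
  have U2: "H_reg 2 ?B U" using U H_reg_lower[of 2 ?B U] by (simp add: eval_nat_numeral)
  have c2: "H_reg 2 ?B (curl U)" by (rule H_reg_curl[OF open_half_ball]) (use U in \<open>simp add: eval_nat_numeral\<close>)
  have rd: "r < \<delta>" using r \<rho> by simp
  have bC: "AE y in lborel. norm y < r \<longrightarrow> (\<lambda>k. curl U (P y + inverse (real (Suc k)) *\<^sub>R n)) \<longlonglongrightarrow> bC (P y)"
    using conv by eventually_elim (use r in auto)
  note tan = normal_limit_bounded_linear_AE[OF c2 bounded_linear_ccross rd bC z]
  show ?thesis
    using conv tan[of "axis 1 1"] tan[of "axis 2 1"]
  proof eventually_elim
    case (elim y)
    show ?case
    proof
      assume y: "norm y < r"
      then have yr: "norm y < \<rho>" "norm y < \<delta>" using r \<rho> by auto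
      let ?p = "\<lambda>k. P y + inverse (real (Suc k)) *\<^sub>R n" and ?V = "\<lambda>z. ccross (cvec n) (curl U z)"
      let ?v = "Q (join3 (axis 1 1, 0))" and ?w = "Q (join3 (axis 2 1, 0))"
      let ?E = "\<lambda>z. (lam + 2 * \<mu>) *\<^sub>R cdot (cvec n) (grad (divg U) z)
         + \<mu> *\<^sub>R (cdot (cvec ?v) (dir_deriv ?v ?V z) + cdot (cvec ?w) (dir_deriv ?w ?V z)) + \<omega>\<^sup>2 *\<^sub>R cdot (cvec n) (U z)"
      \<comment> \<open>By \<open>tan\<close> the tangential derivatives of n \<times> curl U tend
        to 0; only the grad div term and the zeroth order term survive.\<close>
      have "(\<lambda>k. ?E (?p k)) \<longlonglongrightarrow> (lam + 2 * \<mu>) *\<^sub>R cdot (cvec n) (bG (P y)) 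
         + \<mu> *\<^sub>R (cdot (cvec ?v) 0 + cdot (cvec ?w) 0) + \<omega>\<^sup>2 *\<^sub>R cdot (cvec n) (bU (P y))"
        by (intro tendsto_add tendsto_scaleR tendsto_const bounded_linear.tendsto[OF bounded_linear_cdot])
           (use elim y yr in blast)+
      moreover have "\<forall>\<^sub>F k in sequentially. ?E (?p k) = 0"
        using normal_point_in_half_ball[OF yr(2)]
      proof eventually_elim
        case (elim k)
        show ?case by (rule lame_normal_component[OF open_half_ball elim H_reg_Ck[OF U2] frame eq[OF elim]])
      qed
      ultimately have "(lam + 2 * \<mu>) *\<^sub>R cdot (cvec n) (bG (P y)) 
         + \<mu> *\<^sub>R (cdot (cvec ?v) 0 + cdot (cvec ?w) 0) + \<omega>\<^sup>2 *\<^sub>R cdot (cvec n) (bU (P y)) = 0"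
        using LIMSEQ_unique[OF _ tendsto_eventually] by blast
      then have "(lam + 2 * \<mu>) *\<^sub>R cdot (cvec n) (bG (P y)) + \<omega>\<^sup>2 *\<^sub>R cdot (cvec n) (bU (P y)) = 0"
        by (simp add: cdot_def)
      then show "cdot (cvec n) (bG (P y)) = 0 \<longleftrightarrow> cdot (cvec n) (bU (P y)) = 0"
        using pos \<omega> by auto
    qed
  qed
qed

text \<open>Each auxiliary equivalence needs its hypothesis almost everywhere on the disc, since
  that hypothesis is differentiated tangentially; the conditions are therefore exchanged one at a
  time. From the left the curl condition is won first, from the right n \<bullet> U = 0.\<close>

lemma boundary_conditions_iff:
  assumes r: "r \<le> \<rho>"
  shows "(AE y in lborel. norm y < r \<longrightarrow> cdot (cvec n) (bU (P y)) = 0 \<and> ccross (cvec n) (T (P y)) = 0) \<longleftrightarrow>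
    (AE y in lborel. norm y < r \<longrightarrow> cdot (cvec n) (bG (P y)) = 0 \<and> ccross (cvec n) (bC (P y)) = 0)"
proof
  assume a: "AE y in lborel. norm y < r \<longrightarrow> cdot (cvec n) (bU (P y)) = 0 \<and> ccross (cvec n) (T (P y)) = 0"
  then have u: "AE y in lborel. norm y < r \<longrightarrow> cdot (cvec n) (bU (P y)) = 0" by eventually_elim simp
  have c: "AE y in lborel. norm y < r \<longrightarrow> ccross (cvec n) (bC (P y)) = 0"
    using a traction_curl[OF r u] by eventually_elim auto
  show "AE y in lborel. norm y < r \<longrightarrow> cdot (cvec n) (bG (P y)) = 0 \<and> ccross (cvec n) (bC (P y)) = 0"
    using u c normal_grad_div[OF r c] by eventually_elim auto
next
  assume a: "AE y in lborel. norm y < r \<longrightarrow> cdot (cvec n) (bG (P y)) = 0 \<and> ccross (cvec n) (bC (P y)) = 0"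
  then have c: "AE y in lborel. norm y < r \<longrightarrow> ccross (cvec n) (bC (P y)) = 0" by eventually_elim simp
  have u: "AE y in lborel. norm y < r \<longrightarrow> cdot (cvec n) (bU (P y)) = 0"
    using a normal_grad_div[OF r c] by eventually_elim auto
  show "AE y in lborel. norm y < r \<longrightarrow> cdot (cvec n) (bU (P y)) = 0 \<and> ccross (cvec n) (T (P y)) = 0"
    using u c traction_curl[OF r u] by eventually_elim auto
qed

end

section \<open>From single discs to the whole piece\<close>

lemma ae_on_mono:
  assumes "ae_on D \<Gamma> R" "\<And>z. R z \<Longrightarrow> R' z"
  shows "ae_on D \<Gamma> R'"
  unfolding ae_on_def
proof
  fix x assume "x \<in> \<Gamma>"
  then obtain r P h where p: "C21_patch D \<Gamma> x r P h" "AE y in patch_measure x r P h. R (graph_map x P h y)"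
    using assms(1) unfolding ae_on_def by blast
  from p(2) have "AE y in patch_measure x r P h. R' (graph_map x P h y)"
    by eventually_elim (rule assms(2))
  with p(1) show "\<exists>r P h. C21_patch D \<Gamma> x r P h \<and> (AE y in patch_measure x r P h. R' (graph_map x P h y))" by blast
qed

theorem theorem2p3:
  fixes lam \<mu> \<omega> :: real
    and D \<Gamma> :: "(real^3) set"
    and H K :: "real^3 \<Rightarrow> real"
    and d d' :: "real^3"
    and \<alpha>p \<alpha>s :: complex
    and U :: "real^3 \<Rightarrow> complex^3"
  assumes "\<mu> > 0" and "3 * lam + 2 * \<mu> > 0" and "\<omega> > 0"
    and "scatterer D"
    and "regular_piece D \<Gamma>"
    and "\<forall>x\<in>\<Gamma>. mean_and_gauss_curvature D x (H x) (K x)"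
    and "\<forall>x\<in>\<Gamma>. H x = 0 \<and> K x = 0"
    and "norm d = 1" and "norm d' = 1" and "d \<bullet> d' = 0"
    and "elastic_scattering_solution lam \<mu> \<omega> D (incident_wave lam \<mu> \<omega> d d' \<alpha>p \<alpha>s) U"
    and "locally_H3_near D \<Gamma> U"
  shows "third_kind_condition lam \<mu> D \<Gamma> U \<longleftrightarrow>
      ae_on D \<Gamma> (\<lambda>x. cdot (cvec (outward_normal D x)) (bdry_trace D \<Gamma> (grad (divg U)) x) = 0) \<and>
      ae_on D \<Gamma> (\<lambda>x. ccross (cvec (outward_normal D x)) (bdry_trace D \<Gamma> (curl U) x) = 0)"
proof -
  \<comment> \<open>3 (lam + 2 \<mu>) = (3 lam + 2 \<mu>) + 4 \<mu>.\<close>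
  have pos: "lam + 2 * \<mu> > 0" using assms(1,2) by linarith
  have flat: "flat_piece D \<Gamma>"
    by (rule flat_pieceI[OF assms(5)]) (use assms(6,7) in force)
  have smooth: "Ck_on 3 (- closure D) U"
    and eq: "\<And>z. z \<in> - closure D \<Longrightarrow> lame lam \<mu> U z + (\<omega>\<^sup>2) *\<^sub>R U z = 0"
    using assms(11) by (auto simp: elastic_scattering_solution_def intro: smooth_imp_Ck)
  have reg3: "\<exists>r>0. H_reg 3 (ball x r - closure D) U" if x: "x \<in> \<Gamma>" for x
  proof -
    obtain r where r: "r > 0" "sobolev 3 (ball x r - closure D) U"
      using assms(12) x by (auto simp: locally_H3_near_def)
    have "Ck_on 3 (ball x r - closure D) U" by (rule Ck_on_subset[OF smooth]) auto
    with r show ?thesis using sobolev_imp_H_reg[OF _ r(2)] by (auto simp: open_Diff)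
  qed
  have oB: "open (ball x r - closure D)" for x r by (simp add: open_Diff)
  have low: "H_reg 1 S f" if "H_reg 2 S f" for S :: "(real^3) set" and f :: "real^3 \<Rightarrow> complex^3"
    using that H_reg_lower[of 1 S f] by (simp add: numeral_2_eq_2)
  have lowc: "H_reg 1 S f" if "H_reg 2 S f" for S :: "(real^3) set" and f :: "real^3 \<Rightarrow> complex"
    using that H_reg_lower[of 1 S f] by (simp add: numeral_2_eq_2)
  have R: "H_reg 1 S U" "H_reg 1 S (pd i U)" "H_reg 1 S (divg U)" "H_reg 1 S (curl U)" "H_reg 1 S (grad (divg U))"
    if S: "open S" and U3: "H_reg 3 S U" for S i
  proof -
    have U3s: "H_reg (Suc 2) S U" using U3 by (simp add: eval_nat_numeral)
    show "H_reg 1 S U" by (rule low[OF H_reg_lower[OF U3s]])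
    show "H_reg 1 S (pd i U)" by (rule low[OF H_reg_pd[OF U3s]])
    show "H_reg 1 S (divg U)" by (rule lowc[OF H_reg_divg[OF S U3s]])
    show "H_reg 1 S (curl U)" by (rule low[OF H_reg_curl[OF S U3s]])
    show "H_reg 1 S (grad (divg U))"
      using H_reg_divg[OF S U3s] by (intro H_reg_grad[OF S]) (simp add: numeral_2_eq_2)
  qed
  have tr: "has_trace D \<Gamma> U (bdry_trace D \<Gamma> U)" "has_trace D \<Gamma> (pd i U) (bdry_trace D \<Gamma> (pd i U))"
    "has_trace D \<Gamma> (divg U) (bdry_trace D \<Gamma> (divg U))" "has_trace D \<Gamma> (curl U) (bdry_trace D \<Gamma> (curl U))"
    "has_trace D \<Gamma> (grad (divg U)) (bdry_trace D \<Gamma> (grad (divg U)))" for i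
    using reg3 R[OF oB] by (blast intro!: has_trace_bdry_trace[OF flat])+
  let ?u = "bdry_trace D \<Gamma> U" and ?A = "\<lambda>i. bdry_trace D \<Gamma> (pd i U)" and ?d = "bdry_trace D \<Gamma> (divg U)"
    and ?c = "bdry_trace D \<Gamma> (curl U)" and ?g = "bdry_trace D \<Gamma> (grad (divg U))" and ?\<nu> = "outward_normal D"
  let ?P1 = "\<lambda>z. cdot (cvec (?\<nu> z)) (?u z) = 0" and ?P2 = "\<lambda>z. ccross (cvec (?\<nu> z)) (traction lam \<mu> D \<Gamma> U z) = 0"
    and ?P3 = "\<lambda>z. cdot (cvec (?\<nu> z)) (?g z) = 0" and ?P4 = "\<lambda>z. ccross (cvec (?\<nu> z)) (?c z) = 0"
  \<comment> \<open>Stated for all radii up to \<rho>, because the boundary conditions will be given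
    on discs of unknown, possibly smaller radius.\<close>
  have main: "\<exists>Q n \<delta> \<rho>. flat_boundary x Q n D \<delta> \<and> frontier D \<inter> ball x \<delta> \<subseteq> \<Gamma> \<and> 0 < \<rho> \<and>
      (\<forall>r\<le>\<rho>. (AE y in lborel. norm y < r \<longrightarrow> ?P1 (plane_pt x Q y) \<and> ?P2 (plane_pt x Q y)) \<longleftrightarrow>
              (AE y in lborel. norm y < r \<longrightarrow> ?P3 (plane_pt x Q y) \<and> ?P4 (plane_pt x Q y)))"
    if x: "x \<in> \<Gamma>" for x
  proof -
    obtain r where r: "r > 0" "H_reg 3 (ball x r - closure D) U" using reg3[OF x] by blast
    obtain Q n \<delta> where q: "flat_boundary x Q n D \<delta>" "frontier D \<inter> ball x \<delta> \<subseteq> \<Gamma>" "\<delta> \<le> r"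
      by (rule flat_piece_small[OF flat x r(1)])
    interpret flat_boundary x Q n D \<delta> by fact
    let ?B = "half_ball x n \<delta>"
    have sub: "?B \<subseteq> ball x r - closure D" unfolding exterior_flat[OF order_refl, symmetric] using q(3) by auto
    have U3: "H_reg 3 ?B U" by (rule H_reg_subset[OF r(2) sub oB open_half_ball])
    note RB = R[OF open_half_ball U3]
    define p where "p k y = P y + inverse (real (Suc k)) *\<^sub>R n" for k y
    have ex: "\<exists>\<rho>. 0 < \<rho> \<and> (AE y in lborel. norm y < \<rho> \<longrightarrow> (\<lambda>k. f (p k y)) \<longlonglongrightarrow> g (P y))"
      if "H_reg 1 ?B f" "has_trace D \<Gamma> f g" for f g :: "real^3 \<Rightarrow> complex^3"
      using trace_AE[OF that(1) x that(2)] unfolding p_def by blast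
    obtain \<rho>0 where \<rho>0: "0 < \<rho>0" "\<rho>0 < \<delta>" "AE y in lborel. norm y < \<rho>0 \<longrightarrow> (\<lambda>k. divg U (p k y)) \<longlonglongrightarrow> ?d (P y)"
      using trace_AE[OF RB(3) x tr(3)] unfolding p_def by blast
    obtain \<rho>1 where \<rho>1: "0 < \<rho>1" "AE y in lborel. norm y < \<rho>1 \<longrightarrow> (\<lambda>k. U (p k y)) \<longlonglongrightarrow> ?u (P y)"
      using ex[OF RB(1) tr(1)] by blast
    have "\<forall>i. \<exists>\<rho>. 0 < \<rho> \<and> (AE y in lborel. norm y < \<rho> \<longrightarrow> (\<lambda>k. pd i U (p k y)) \<longlonglongrightarrow> ?A i (P y))"
      using ex[OF RB(2) tr(2)] by blast
    from choice[OF this] obtain \<rho>2 where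
      *: "\<forall>i. 0 < \<rho>2 i \<and> (AE y in lborel. norm y < \<rho>2 i \<longrightarrow> (\<lambda>k. pd i U (p k y)) \<longlonglongrightarrow> ?A i (P y))" ..
    have \<rho>2: "0 < \<rho>2 i" "AE y in lborel. norm y < \<rho>2 i \<longrightarrow> (\<lambda>k. pd i U (p k y)) \<longlonglongrightarrow> ?A i (P y)" for i
      using * by (rule allE, simp)+
    obtain \<rho>3 where \<rho>3: "0 < \<rho>3" "AE y in lborel. norm y < \<rho>3 \<longrightarrow> (\<lambda>k. curl U (p k y)) \<longlonglongrightarrow> ?c (P y)"
      using ex[OF RB(4) tr(4)] by blast
    obtain \<rho>4 where \<rho>4: "0 < \<rho>4" "AE y in lborel. norm y < \<rho>4 \<longrightarrow> (\<lambda>k. grad (divg U) (p k y)) \<longlonglongrightarrow> ?g (P y)"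
      using ex[OF RB(5) tr(5)] by blast
    \<comment> \<open>Each trace comes with its own disc of convergence; there are finitely many, so
      a common radius exists.\<close>
    define \<rho> where "\<rho> = Min (insert \<rho>0 (insert \<rho>1 (insert \<rho>3 (insert \<rho>4 (range \<rho>2)))))"
    have \<rho>: "0 < \<rho>" "\<rho> \<le> \<rho>0" "\<rho> \<le> \<rho>1" "\<rho> \<le> \<rho>2 i" "\<rho> \<le> \<rho>3" "\<rho> \<le> \<rho>4" for i
    proof -
      show "0 < \<rho>" using \<rho>0(1) \<rho>1(1) \<rho>2(1) \<rho>3(1) \<rho>4(1) by (auto simp: \<rho>_def)
      show "\<rho> \<le> \<rho>0" "\<rho> \<le> \<rho>1" "\<rho> \<le> \<rho>2 i" "\<rho> \<le> \<rho>3" "\<rho> \<le> \<rho>4"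
        unfolding \<rho>_def by (rule Min_le; simp)+
    qed
    have all2: "AE y in lborel. \<forall>i. norm y < \<rho>2 i \<longrightarrow> (\<lambda>k. pd i U (p k y)) \<longlonglongrightarrow> ?A i (P y)"
      using \<rho>2(2) by (simp add: AE_all_countable)
    interpret traces x Q n D \<delta> U lam \<mu> \<omega> \<rho> ?u ?c ?g ?A ?d
    proof unfold_locales
      show "AE y in lborel. norm y < \<rho> \<longrightarrow> 
        (\<lambda>k. U (P y + inverse (real (Suc k)) *\<^sub>R n)) \<longlonglongrightarrow> ?u (P y) \<and>
        (\<forall>i. (\<lambda>k. pd i U (P y + inverse (real (Suc k)) *\<^sub>R n)) \<longlonglongrightarrow> ?A i (P y)) \<and>
        (\<lambda>k. divg U (P y + inverse (real (Suc k)) *\<^sub>R n)) \<longlonglongrightarrow> ?d (P y) \<and>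
        (\<lambda>k. curl U (P y + inverse (real (Suc k)) *\<^sub>R n)) \<longlonglongrightarrow> ?c (P y) \<and>
        (\<lambda>k. grad (divg U) (P y + inverse (real (Suc k)) *\<^sub>R n)) \<longlonglongrightarrow> ?g (P y)"
        using \<rho>0(3) \<rho>1(2) all2 \<rho>3(2) \<rho>4(2) unfolding p_def
      proof eventually_elim
        case (elim y)
        then show ?case using \<rho>(2,3,5,6) \<rho>(4) by (meson order_less_le_trans)
      qed
      show "\<rho> < \<delta>" using \<rho>(2) \<rho>0(2) by simp
      show "lame lam \<mu> U z + \<omega>\<^sup>2 *\<^sub>R U z = 0" if "z \<in> ?B" for z using eq sub that by blast
    qed (use U3 \<rho>(1) assms(1,3) pos in auto)
    \<comment> \<open>On the disc the normal is the constant n, which turns the boundary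
      expressions, traction included, into those of the locale.\<close>
    have nu: "?\<nu> (P y) = n" if "norm y < \<rho>" for y
      by (rule outward_normal_flat) (use that \<rho>(2) \<rho>0(2) in linarith)
    have c1: "(?P1 (P y) \<and> ?P2 (P y)) \<longleftrightarrow> cdot (cvec n) (?u (P y)) = 0 \<and> ccross (cvec n) (T (P y)) = 0"
      and c2: "(?P3 (P y) \<and> ?P4 (P y)) \<longleftrightarrow> cdot (cvec n) (?g (P y)) = 0 \<and> ccross (cvec n) (?c (P y)) = 0" if "norm y < \<rho>" for y
      using nu[OF that] by (simp_all add: traction_def Let_def)
    have "(AE y in lborel. norm y < s \<longrightarrow> ?P1 (P y) \<and> ?P2 (P y)) \<longleftrightarrow> (AE y in lborel. norm y < s \<longrightarrow> ?P3 (P y) \<and> ?P4 (P y))"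
      if s: "s \<le> \<rho>" for s
    proof -
      have "(AE y in lborel. norm y < s \<longrightarrow> ?P1 (P y) \<and> ?P2 (P y)) \<longleftrightarrow>
          (AE y in lborel. norm y < s \<longrightarrow> cdot (cvec n) (?u (P y)) = 0 \<and> ccross (cvec n) (T (P y)) = 0)"
      proof -
        have "(norm y < s \<longrightarrow> ?P1 (P y) \<and> ?P2 (P y)) = (norm y < s \<longrightarrow> cdot (cvec n) (?u (P y)) = 0 \<and> ccross (cvec n) (T (P y)) = 0)" for y
          by (rule imp_cong[OF refl c1]) (use s in linarith)
        then show ?thesis by (simp only:)
      qed
      also have "\<dots> \<longleftrightarrow> (AE y in lborel. norm y < s \<longrightarrow> cdot (cvec n) (?g (P y)) = 0 \<and> ccross (cvec n) (?c (P y)) = 0)"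
        by (rule boundary_conditions_iff[OF s])
      also have "\<dots> \<longleftrightarrow> (AE y in lborel. norm y < s \<longrightarrow> ?P3 (P y) \<and> ?P4 (P y))"
      proof -
        have "(norm y < s \<longrightarrow> ?P3 (P y) \<and> ?P4 (P y)) = (norm y < s \<longrightarrow> cdot (cvec n) (?g (P y)) = 0 \<and> ccross (cvec n) (?c (P y)) = 0)" for y
          by (rule imp_cong[OF refl c2]) (use s in linarith)
        then show ?thesis by (simp only:)
      qed
      finally show ?thesis .
    qed
    then show ?thesis using q(1,2) \<rho>(1) by (intro exI[of _ Q] exI[of _ n] exI[of _ \<delta>] exI[of _ \<rho>]) blast
  qed
  \<comment> \<open>The two conditions come with separate charts and radii. They are combined on a
    common flat disc around each point, exchanged there, and separated again.\<close>
  have transfer: "ae_on D \<Gamma> A' \<and> ae_on D \<Gamma> B'"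
    if hyp: "ae_on D \<Gamma> A" "ae_on D \<Gamma> B"
      and loc: "\<And>x. x \<in> \<Gamma> \<Longrightarrow> \<exists>Q n \<delta> \<rho>. flat_boundary x Q n D \<delta> \<and> frontier D \<inter> ball x \<delta> \<subseteq> \<Gamma> \<and> 0 < \<rho> \<and>
      (\<forall>r\<le>\<rho>. (AE y in lborel. norm y < r \<longrightarrow> A (plane_pt x Q y) \<and> B (plane_pt x Q y)) \<longrightarrow>
              (AE y in lborel. norm y < r \<longrightarrow> A' (plane_pt x Q y) \<and> B' (plane_pt x Q y)))" for A B A' B'
  proof -
    have "\<exists>Q n \<delta> \<rho>. flat_boundary x Q n D \<delta> \<and> frontier D \<inter> ball x \<delta> \<subseteq> \<Gamma> \<and> 0 < \<rho> \<and>
        (AE y in lborel. norm y < \<rho> \<longrightarrow> A' (plane_pt x Q y) \<and> B' (plane_pt x Q y))" if x: "x \<in> \<Gamma>" for x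
    proof -
      obtain Q n \<delta> \<rho> where q: "flat_boundary x Q n D \<delta>" "frontier D \<inter> ball x \<delta> \<subseteq> \<Gamma>" "0 < \<rho>"
        and im: "\<And>r. r \<le> \<rho> \<Longrightarrow> (AE y in lborel. norm y < r \<longrightarrow> A (plane_pt x Q y) \<and> B (plane_pt x Q y)) \<Longrightarrow>
              (AE y in lborel. norm y < r \<longrightarrow> A' (plane_pt x Q y) \<and> B' (plane_pt x Q y))"
        using loc[OF x] by blast
      interpret flat_boundary x Q n D \<delta> by fact
      obtain r1 where r1: "0 < r1" "AE y in lborel. norm y < r1 \<longrightarrow> A (P y)" using ae_onD[OF hyp(1) x] by blast
      obtain r2 where r2: "0 < r2" "AE y in lborel. norm y < r2 \<longrightarrow> B (P y)" using ae_onD[OF hyp(2) x] by blast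
      define r where "r = min \<rho> (min r1 r2)"
      have r: "0 < r" "r \<le> \<rho>" "r \<le> r1" "r \<le> r2" using q(3) r1(1) r2(1) by (auto simp: r_def)
      have "AE y in lborel. norm y < r \<longrightarrow> A (P y) \<and> B (P y)"
        using r1(2) r2(2) by eventually_elim (use r in auto)
      from im[OF r(2) this] show ?thesis using q(1,2) r(1) by blast
    qed
    then have both: "ae_on D \<Gamma> (\<lambda>z. A' z \<and> B' z)" by (rule ae_onI)
    show ?thesis using ae_on_mono[OF both, of A'] ae_on_mono[OF both, of B'] by simp
  qed
  have fw: "ae_on D \<Gamma> ?P3 \<and> ae_on D \<Gamma> ?P4" if "ae_on D \<Gamma> ?P1" "ae_on D \<Gamma> ?P2"
    by (rule transfer[OF that], drule main, elim exE conjE, intro exI conjI, assumption+)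
      (intro allI impI, rule iffD1, (drule spec, erule mp, assumption)+)
  have bw: "ae_on D \<Gamma> ?P1 \<and> ae_on D \<Gamma> ?P2" if "ae_on D \<Gamma> ?P3" "ae_on D \<Gamma> ?P4"
    by (rule transfer[OF that], drule main, elim exE conjE, intro exI conjI, assumption+)
      (intro allI impI, rule iffD2, (drule spec, erule mp, assumption)+)
  show ?thesis unfolding third_kind_condition_def using fw bw by blast
qed

end
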